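(* Let $h\in\mathcal{O}_M(\mathbb{R})$. Then the following properties are equivalent (where "(uniformly) mean ergodic" may be read in each item either as "mean ergodic" or as "uniformly mean ergodic"): (1) $M_h$ is (uniformly) mean ergodic on $\mathcal{S}(\mathbb{R})$. (1)' $\mathcal{M}_h$ is (uniformly) mean ergodic on $\mathcal{S}'(\mathbb{R})$. (2) $M_h$ is (uniformly) mean ergodic on $\mathcal{O}_M(\mathbb{R})$. (2)' $\mathcal{M}_h$ is (uniformly) mean ergodic on $\mathcal{O}_M'(\mathbb{R})$. (3) The sequence $\{h_{[n]}\}_{n\in\mathbb{N}}$, $h_{[n]}:=\frac1n\sum_{m=1}^nh^m$ (pointwise powers), converges to some $g$ in $\mathcal{O}_M(\mathbb{R})$.
   Context: All functions are complex-valued. $\mathcal{S}(\mathbb{R})$ is the Schwartz space of $f\in C^\infty(\mathbb{R})$ with $\|f\|_n:=\sup_{x\in\mathbb{R}}\sup_{0\le i\le n}(1+x^2)^n|f^{(i)}(x)|<\infty$ for all $n\in\mathbb{N}_0$, a Fréchet space with these norms. $\mathcal{O}_M(\mathbb{R})$ is the space of all $f\in C^\infty(\mathbb{R})$ such that for every $m\in\mathbb{N}$ there is $n\in\mathbb{N}$ with $|f|_{m,n}:=\sup_{x\in\mathbb{R}}\sup_{0\le i\le m}(1+x^2)^{-n}|f^{(i)}(x)|<\infty$. Its locally convex topology is the one of $\mathrm{proj}_m\,\mathrm{ind}_n$ of the spaces normed by $|\cdot|_{m,n}$; it is generated by the norms $p_{m,v}(f)=\sup_{x\in\mathbb{R}}\sup_{0\le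 i\le m}|v(x)||f^{(i)}(x)|$, $m\in\mathbb{N}$, $v\in\mathcal{S}(\mathbb{R})$. $\mathcal{S}'(\mathbb{R})$ and $\mathcal{O}_M'(\mathbb{R})$ are the strong duals of $\mathcal{S}(\mathbb{R})$ and $\mathcal{O}_M(\mathbb{R})$. For $h\in\mathcal{O}_M(\mathbb{R})$, $M_hf=hf$ is a continuous linear operator on $\mathcal{S}(\mathbb{R})$ and on $\mathcal{O}_M(\mathbb{R})$; $\mathcal{M}_h:=M_h'$, $S\mapsto hS$, denotes its transpose, acting on $\mathcal{S}'(\mathbb{R})$, resp. on $\mathcal{O}_M'(\mathbb{R})$. For a locally convex Hausdorff space $E$, $\mathcal{L}(E)$ is the space of continuous linear operators on $E$; $\mathcal{L}_s(E)$ (resp. $\mathcal{L}_b(E)$) is $\mathcal{L}(E)$ with the topology of uniform convergence on finite (resp. bounded) subsets of $E$. $T\in\mathcal{L}(E)$ is mean ergodic (resp. uniformly mean ergodic) if its Cesàro means $T_{[n]}=\frac1n\sum_{m=1}^nT^m$, $n\in\mathbb{N}$, form a convergent sequence in $\mathcal{L}_s(E)$ (resp. $\mathcal{L}_b(E)$). *)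

theory Defs
  imports "HOL-Analysis.Analysis" "HOL-Library.Function_Algebras"
begin

section \<open>Locally convex spaces given by seminorms\<close>

text \<open>
  A locally convex space is represented by its underlying set and a nonempty family of seminorms
  generating its topology.  The values of the seminorms off the underlying set play no role.
  All spaces below consist of functions with pointwise operations (addition and
  subtraction are those of \<open>Function_Algebras\<close>).
\<close>

record 'a lcs =
  elems :: "'a set"
  seminorms :: "('a \<Rightarrow> real) set"

definition lcs_topology :: "'a::ab_group_add lcs \<Rightarrow> 'a topology" where
  "lcs_topology E = topology_generated_by
     {{g \<in> elems E. p (g - f) < r} | p f r. p \<in> seminorms E \<and> f \<in> elems E \<and> 0 < r}"

definition bounded_in :: "'a lcs \<Rightarrow> 'a set \<Rightarrow> bool" where
  "bounded_in E B \<longleftrightarrow> B \<subseteq> elems E \<and> (\<forall>p\<in>seminorms E. bdd_above (p ` B))"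

definition finite_in :: "'a lcs \<Rightarrow> 'a set \<Rightarrow> bool" where
  "finite_in E B \<longleftrightarrow> B \<subseteq> elems E \<and> finite B"


section \<open>Strong duals and spaces of operators\<close>

text \<open>
  Functionals and operators on \<open>E\<close> are total functions in HOL; they are made unique by requiring
  the value 0 off \<open>elems E\<close>, which is compatible with the pointwise vector space operations.
  The sets \<open>B\<close> over which suprema are taken are nonempty only because the real supremum of the
  empty set is unspecified.
\<close>

definition dual :: "('x \<Rightarrow> complex) lcs \<Rightarrow> (('x \<Rightarrow> complex) \<Rightarrow> complex) set" where
  "dual E = {u.
     (\<forall>f\<in>elems E. \<forall>g\<in>elems E. u (f + g) = u f + u g) \<and>
     (\<forall>c. \<forall>f\<in>elems E. u (\<lambda>x. c * f x) = c * u f) \<and>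
     continuous_map (lcs_topology E) euclidean u \<and>
     (\<forall>f. f \<notin> elems E \<longrightarrow> u f = 0)}"

definition strong_dual :: "('x \<Rightarrow> complex) lcs \<Rightarrow> (('x \<Rightarrow> complex) \<Rightarrow> complex) lcs" where
  "strong_dual E = \<lparr>elems = dual E,
     seminorms = {\<lambda>u. SUP f\<in>B. cmod (u f) | B. bounded_in E B \<and> B \<noteq> {}}\<rparr>"

definition cont_operators ::
  "('x \<Rightarrow> complex) lcs \<Rightarrow> (('x \<Rightarrow> complex) \<Rightarrow> ('x \<Rightarrow> complex)) set" where
  "cont_operators E = {T.
     (\<forall>f\<in>elems E. \<forall>g\<in>elems E. T (f + g) = T f + T g) \<and>
     (\<forall>c. \<forall>f\<in>elems E. T (\<lambda>x. c * f x) = (\<lambda>x. c * T f x)) \<and>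
     continuous_map (lcs_topology E) (lcs_topology E) T \<and>
     (\<forall>f. f \<notin> elems E \<longrightarrow> T f = 0)}"

definition cont_operators_s ::
  "('x \<Rightarrow> complex) lcs \<Rightarrow> (('x \<Rightarrow> complex) \<Rightarrow> ('x \<Rightarrow> complex)) lcs" where
  "cont_operators_s E = \<lparr>elems = cont_operators E,
     seminorms = {\<lambda>T. SUP f\<in>B. p (T f) | p B. p \<in> seminorms E \<and> finite_in E B \<and> B \<noteq> {}}\<rparr>"

definition cont_operators_b ::
  "('x \<Rightarrow> complex) lcs \<Rightarrow> (('x \<Rightarrow> complex) \<Rightarrow> ('x \<Rightarrow> complex)) lcs" where
  "cont_operators_b E = \<lparr>elems = cont_operators E,
     seminorms = {\<lambda>T. SUP f\<in>B. p (T f) | p B. p \<in> seminorms E \<and> bounded_in E B \<and> B \<noteq> {}}\<rparr>"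

definition transpose_op ::
  "('x \<Rightarrow> complex) lcs \<Rightarrow> (('x \<Rightarrow> complex) \<Rightarrow> ('x \<Rightarrow> complex)) \<Rightarrow>
   (('x \<Rightarrow> complex) \<Rightarrow> complex) \<Rightarrow> (('x \<Rightarrow> complex) \<Rightarrow> complex)" where
  "transpose_op E T u = (if u \<in> dual E then (\<lambda>f. u (T f)) else 0)"


section \<open>Mean ergodicity\<close>

text \<open>The sequences of means start at \<open>n = 1\<close>; the term for \<open>n = 0\<close> is a dummy value 0.\<close>

definition cesaro_mean ::
  "(('x \<Rightarrow> complex) \<Rightarrow> ('x \<Rightarrow> complex)) \<Rightarrow> nat \<Rightarrow> ('x \<Rightarrow> complex) \<Rightarrow> ('x \<Rightarrow> complex)" where
  "cesaro_mean T n f = (\<lambda>x. (1 / of_nat n) * (\<Sum>m=1..n. (T ^^ m) f x))"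

definition mean_ergodic ::
  "('x \<Rightarrow> complex) lcs \<Rightarrow> (('x \<Rightarrow> complex) \<Rightarrow> ('x \<Rightarrow> complex)) \<Rightarrow> bool" where
  "mean_ergodic E T \<longleftrightarrow> T \<in> cont_operators E \<and>
     (\<exists>P. limitin (lcs_topology (cont_operators_s E)) (cesaro_mean T) P sequentially)"

definition uniformly_mean_ergodic ::
  "('x \<Rightarrow> complex) lcs \<Rightarrow> (('x \<Rightarrow> complex) \<Rightarrow> ('x \<Rightarrow> complex)) \<Rightarrow> bool" where
  "uniformly_mean_ergodic E T \<longleftrightarrow> T \<in> cont_operators E \<and>
     (\<exists>P. limitin (lcs_topology (cont_operators_b E)) (cesaro_mean T) P sequentially)"


section \<open>The spaces of rapidly decreasing and of slowly increasing smooth functions\<close>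

definition nth_deriv :: "nat \<Rightarrow> (real \<Rightarrow> complex) \<Rightarrow> (real \<Rightarrow> complex)" where
  "nth_deriv i f = ((\<lambda>g x. vector_derivative g (at x)) ^^ i) f"

definition smooth :: "(real \<Rightarrow> complex) \<Rightarrow> bool" where
  "smooth f \<longleftrightarrow> (\<forall>i x. nth_deriv i f differentiable (at x))"

definition schwartz_fun :: "(real \<Rightarrow> complex) set" where
  "schwartz_fun = {f. smooth f \<and>
     (\<forall>n. bdd_above ((\<lambda>(x, i). (1 + x\<^sup>2) ^ n * cmod (nth_deriv i f x)) ` (UNIV \<times> {0..n})))}"

definition schwartz_norm :: "nat \<Rightarrow> (real \<Rightarrow> complex) \<Rightarrow> real" where
  "schwartz_norm n f = (SUP (x, i)\<in>UNIV \<times> {0..n}. (1 + x\<^sup>2) ^ n * cmod (nth_deriv i f x))"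

definition schwartz_space :: "(real \<Rightarrow> complex) lcs" where
  "schwartz_space = \<lparr>elems = schwartz_fun, seminorms = range schwartz_norm\<rparr>"

definition OM_fun :: "(real \<Rightarrow> complex) set" where
  "OM_fun = {f. smooth f \<and>
     (\<forall>m. \<exists>n. bdd_above ((\<lambda>(x, i). cmod (nth_deriv i f x) / (1 + x\<^sup>2) ^ n) ` (UNIV \<times> {0..m})))}"

definition OM_norm :: "nat \<Rightarrow> (real \<Rightarrow> complex) \<Rightarrow> (real \<Rightarrow> complex) \<Rightarrow> real" where
  "OM_norm m v f = (SUP (x, i)\<in>UNIV \<times> {0..m}. cmod (v x) * cmod (nth_deriv i f x))"

definition OM_space :: "(real \<Rightarrow> complex) lcs" where
  "OM_space = \<lparr>elems = OM_fun, seminorms = {OM_norm m v | m v. v \<in> schwartz_fun}\<rparr>"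


section \<open>Multiplication operators\<close>

definition mult_op ::
  "(real \<Rightarrow> complex) lcs \<Rightarrow> (real \<Rightarrow> complex) \<Rightarrow> (real \<Rightarrow> complex) \<Rightarrow> (real \<Rightarrow> complex)" where
  "mult_op E h f = (if f \<in> elems E then (\<lambda>x. h x * f x) else 0)"

definition mean_power :: "(real \<Rightarrow> complex) \<Rightarrow> nat \<Rightarrow> real \<Rightarrow> complex" where
  "mean_power h n = (\<lambda>x. (1 / of_nat n) * (\<Sum>m=1..n. h x ^ m))"

end

theory Submission
  imports Defs
begin

text \<open>
  Write \<open>a\<^sub>n\<close> for the means \<open>h\<^sub>[\<^sub>n\<^sub>]\<close>. Each of the nine properties makes \<open>u (a\<^sub>n f)\<close> converge for all
  functionals \<open>u\<close> and all \<open>f\<close> in the Schwartz space (or for \<open>f = 1\<close> in the space of multipliers), because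
  convergence on the strong dual contains convergence at single points. Testing with point evaluations
  and with absolutely convergent series of them, a gliding hump shows that \<open>a\<^sub>n\<close> converges pointwise and
  is bounded among the multipliers. A pointwise limit of Cesaro means of powers is 0 or 1, hence
  by equicontinuity it is a constant \<open>c\<close>; interpolating derivatives, \<open>a\<^sub>n - c\<close> tends to 0 in
  the Mackey sense, i.e. \<open>\<Lambda>\<^sub>n (a\<^sub>n - c)\<close> is still bounded for some \<open>\<Lambda>\<^sub>n\<close> tending to infinity.
  Since products of bounded sets are bounded, all the (uniform) convergences on the
  two spaces and on their strong duals follow with rate \<open>1 / \<Lambda>\<^sub>n\<close>.
\<close>

section \<open>Locally convex spaces of functions\<close>

text \<open>Uniform convergence on a bounded set of functionals asks for control of
  \<open>u (\<lambda>x. (a\<^sub>n x - c) * f x)\<close> jointly in \<open>u\<close> and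
  \<open>f\<close>, and the seminorms of the multipliers are indexed by all Schwartz weights, so a
  rate common to all of them is not evident. The scalars \<Lambda> settle both points: the scaled
  differences form one bounded set, its product with a bounded set of functions \<open>f\<close> is
  bounded again, and over that product a single seminorm of the strong dual can be taken. Products
  stay bounded because a family of functions that decreases rapidly in a uniform way has one
  Schwartz majorant, which serves as a weight; the entire series with fast decaying coefficients is
  there to build this majorant. The scalars come from a diagonal choice: on compact sets all
  derivatives of a bounded, pointwise null sequence become small, while near infinity a spare factor
  \<open>1 + x\<^sup>2\<close> of the weight pays for the gain. The gliding hump is set up for
  functionals that are dominated by one seminorm, so that every series of them with geometric
  coefficients is again a continuous functional and can be used for testing.\<close>

lemma limitin_lcsI:
  fixes E :: "'a::ab_group_add lcs"
  assumes l: "l \<in> elems E" and mem: "\<And>n. a n \<in> elems E" and ne: "seminorms E \<noteq> {}"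
    and tri: "\<And>p f g k. p \<in> seminorms E \<Longrightarrow> f \<in> elems E \<Longrightarrow> g \<in> elems E \<Longrightarrow> k \<in> elems E
      \<Longrightarrow> p (f - k) \<le> p (f - g) + p (g - k)"
    and refl: "\<And>p. p \<in> seminorms E \<Longrightarrow> p 0 = 0"
    and lim: "\<And>p r. p \<in> seminorms E \<Longrightarrow> 0 < r \<Longrightarrow> eventually (\<lambda>n. p (a n - l) < r) F"
  shows "limitin (lcs_topology E) a l F"
proof -
  let ?S = "{{g \<in> elems E. p (g - f) < r} | p f r. p \<in> seminorms E \<and> f \<in> elems E \<and> 0 < (r::real)}"
  have ev: "eventually (\<lambda>n. a n \<in> U) F" if "generate_topology_on ?S U" "l \<in> U" for U
    using that
  proof (induction rule: generate_topology_on.induct)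
    case Empty
    then show ?case by simp
  next
    case (Int A B)
    then show ?case by (auto intro: eventually_conj)
  next
    case (UN K)
    then obtain k where "k \<in> K" "l \<in> k" by blast
    then have "eventually (\<lambda>n. a n \<in> k) F" using UN by blast
    then show ?case by (rule eventually_mono) (use \<open>k \<in> K\<close> in blast)
  next
    case (Basis U)
    then obtain p f r where p: "p \<in> seminorms E" "f \<in> elems E" and U: "U = {g \<in> elems E. p (g - f) < r}"
      by blast
    then have "0 < r - p (l - f)" using Basis by auto
    from lim[OF p(1) this] show ?case
    proof (rule eventually_mono)
      fix n assume "p (a n - l) < r - p (l - f)"
      then show "a n \<in> U" using tri[OF p(1) mem[of n] l p(2)] mem[of n] by (simp add: U)
    qed
  qed
  obtain p where p: "p \<in> seminorms E" using ne by blast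
  have "l \<in> {g \<in> elems E. p (g - l) < 1}" using l refl[OF p] by simp
  then have "l \<in> topspace (lcs_topology E)"
    unfolding lcs_topology_def topology_generated_by_topspace
    using p l zero_less_one by blast
  then show ?thesis
    using ev unfolding limitin_def lcs_topology_def openin_topology_generated_by_iff by blast
qed

text \<open>Stated outside the locale \<open>fn_lcs\<close>, like its converse, because both are
  also applied to \<open>cont_operators_s E\<close> and \<open>cont_operators_b E\<close>, whose
  elements are not complex-valued functions.\<close>

lemma limitin_lcsD:
  fixes E :: "'a::ab_group_add lcs"
  assumes "limitin (lcs_topology E) a l F" and p: "p \<in> seminorms E" "p 0 = 0" and "0 < r"
  shows "l \<in> elems E" "eventually (\<lambda>n. p (a n - l) < r) F"
proof -
  show l: "l \<in> elems E"
    using assms(1) limitin_topspace unfolding lcs_topology_def topology_generated_by_topspace by fastforce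
  let ?U = "{g \<in> elems E. p (g - l) < r}"
  have "openin (lcs_topology E) ?U"
    unfolding lcs_topology_def by (rule topology_generated_by_Basis) (use p l \<open>0 < r\<close> in blast)
  moreover have "l \<in> ?U" using l p \<open>0 < r\<close> by simp
  ultimately have "eventually (\<lambda>n. a n \<in> ?U) F"
    using assms(1) unfolding limitin_def by blast
  then show "eventually (\<lambda>n. p (a n - l) < r) F" by (rule eventually_mono) simp
qed

lemma topspace_lcs:
  fixes E :: "'a::ab_group_add lcs"
  assumes "seminorms E \<noteq> {}" "\<And>p. p \<in> seminorms E \<Longrightarrow> p 0 = 0"
  shows "topspace (lcs_topology E) = elems E"
proof -
  obtain p where p: "p \<in> seminorms E" using assms by blast
  let ?S = "{{g \<in> elems E. p (g - f) < r} | p f r. p \<in> seminorms E \<and> f \<in> elems E \<and> 0 < (r::real)}"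
  have "f \<in> \<Union> ?S" if f: "f \<in> elems E" for f
  proof (rule UnionI)
    show "{g \<in> elems E. p (g - f) < 1} \<in> ?S" using p f zero_less_one by blast
    show "f \<in> {g \<in> elems E. p (g - f) < 1}" using f assms(2)[OF p] by simp
  qed
  then show ?thesis
    unfolding lcs_topology_def topology_generated_by_topspace by blast
qed

text \<open>\<open>'x\<close> may be the real line or itself a function space, so the locale covers
  the two spaces of functions and, through \<open>fn_lcs_strong_dual\<close>, their strong duals.
  Nonnegativity of the seminorms follows from \<open>p 0 \<le> p f + p f\<close>.\<close>

locale fn_lcs =
  fixes E :: "('x \<Rightarrow> complex) lcs"
  assumes add: "f \<in> elems E \<Longrightarrow> g \<in> elems E \<Longrightarrow> f + g \<in> elems E"
    and scale: "f \<in> elems E \<Longrightarrow> (\<lambda>x. c * f x) \<in> elems E"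
    and zero: "0 \<in> elems E"
    and sem_ne: "seminorms E \<noteq> {}"
    and sem_add: "p \<in> seminorms E \<Longrightarrow> f \<in> elems E \<Longrightarrow> g \<in> elems E \<Longrightarrow> p (f + g) \<le> p f + p g"
    and sem_scale: "p \<in> seminorms E \<Longrightarrow> f \<in> elems E \<Longrightarrow> p (\<lambda>x. c * f x) = cmod c * p f"
begin

lemma sem_zero: "p \<in> seminorms E \<Longrightarrow> p 0 = 0"
  using sem_scale[OF _ zero, of p 0] by (simp add: zero_fun_def)

lemma diff_eq: "f - g = f + (\<lambda>x. (-1) * g x)" for f g :: "'x \<Rightarrow> complex"
  by (simp add: fun_eq_iff)

lemma diff: "f \<in> elems E \<Longrightarrow> g \<in> elems E \<Longrightarrow> f - g \<in> elems E"
  unfolding diff_eq by (intro add scale)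

lemma sem_diff: 
  assumes "p \<in> seminorms E" "f \<in> elems E" "g \<in> elems E"
  shows "p (f - g) \<le> p f + p g"
proof -
  have "p (f - g) \<le> p f + p (\<lambda>x. (-1) * g x)"
    unfolding diff_eq by (rule sem_add[OF assms(1,2) scale[OF assms(3)]])
  also have "p (\<lambda>x. (-1) * g x) = p g"
    by (subst sem_scale[OF assms(1,3)]) simp
  finally show ?thesis .
qed

lemma sem_nonneg: "p \<in> seminorms E \<Longrightarrow> f \<in> elems E \<Longrightarrow> 0 \<le> p f"
  using sem_diff[of p f f] sem_zero by fastforce

lemma sem_triangle:
  assumes "p \<in> seminorms E" "f \<in> elems E" "g \<in> elems E" "k \<in> elems E"
  shows "p (f - k) \<le> p (f - g) + p (g - k)"
  using sem_add[OF assms(1) diff[OF assms(2,3)] diff[OF assms(3,4)]] by simp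

lemma topspace_E: "topspace (lcs_topology E) = elems E"
  by (intro topspace_lcs sem_ne sem_zero)

lemma limitinI:
  assumes "l \<in> elems E" "\<And>n. a n \<in> elems E"
    and "\<And>p r. p \<in> seminorms E \<Longrightarrow> 0 < r \<Longrightarrow> eventually (\<lambda>n. p (a n - l) < r) F"
  shows "limitin (lcs_topology E) a l F"
proof (rule limitin_lcsI)
  show "l \<in> elems E" by (rule assms(1))
  show "a n \<in> elems E" for n by (rule assms(2))
  show "seminorms E \<noteq> {}" by (rule sem_ne)
  show "p (f - k) \<le> p (f - g) + p (g - k)"
    if "p \<in> seminorms E" "f \<in> elems E" "g \<in> elems E" "k \<in> elems E" for p f g k
    using that by (rule sem_triangle)
  show "p 0 = 0" if "p \<in> seminorms E" for p using that by (rule sem_zero)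
  show "eventually (\<lambda>n. p (a n - l) < r) F" if "p \<in> seminorms E" "0 < r" for p r
    using that by (rule assms(3))
qed

lemma limitinD:
  assumes "limitin (lcs_topology E) a l F" "p \<in> seminorms E" "0 < r"
  shows "l \<in> elems E" "eventually (\<lambda>n. p (a n - l) < r) F"
  using limitin_lcsD[OF assms(1,2) _ assms(3)] sem_zero[OF assms(2)] by auto

text \<open>If \<open>\<phi>\<close> exceeds \<open>n\<close> at \<open>f\<^sub>n\<close> in the bounded set, then it exceeds 1 along the null sequence \<open>f\<^sub>n / n\<close>.\<close>
lemma bounded_on_bounded:
  assumes B: "bounded_in E B"
    and hom: "\<And>c f. f \<in> elems E \<Longrightarrow> \<phi> (\<lambda>x. c * f x) = cmod c * \<phi> f"
    and null: "\<And>a. limitin (lcs_topology E) a 0 sequentially \<Longrightarrow> eventually (\<lambda>n. \<phi> (a n) < 1) sequentially"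
  shows "bdd_above (\<phi> ` B)"
proof (rule ccontr)
  assume "\<not> bdd_above (\<phi> ` B)"
  then have "\<exists>f\<in>B. \<phi> f > real (Suc n)" for n
    by (metis bdd_aboveI2 linorder_not_less)
  then obtain f where f: "\<And>n. f n \<in> B" "\<And>n. \<phi> (f n) > real (Suc n)" by metis
  have fE: "f n \<in> elems E" for n using f(1) B unfolding bounded_in_def by blast
  define a where "a = (\<lambda>n x. (1 / of_nat (Suc n)) * f n x)"
  have aE: "a n \<in> elems E" for n unfolding a_def by (intro scale fE)
  have "limitin (lcs_topology E) a 0 sequentially"
  proof (rule limitinI[OF zero aE])
    fix p and r :: real assume p: "p \<in> seminorms E" and r: "0 < r"
    obtain M where M: "\<And>g. g \<in> B \<Longrightarrow> p g \<le> M"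
      using B p unfolding bounded_in_def by (meson bdd_above.E image_eqI)
    have "(\<lambda>n. M * (1 / real (Suc n))) \<longlonglongrightarrow> M * 0"
      by (intro tendsto_intros LIMSEQ_Suc[OF lim_1_over_n])
    then have "eventually (\<lambda>n. M * (1 / real (Suc n)) < r) sequentially"
      using r by (auto dest: order_tendstoD)
    then show "eventually (\<lambda>n. p (a n - 0) < r) sequentially"
    proof (rule eventually_mono)
      fix n assume n: "M * (1 / real (Suc n)) < r"
      have "p (a n) = 1 / real (Suc n) * p (f n)"
        unfolding a_def by (subst sem_scale[OF p fE]) (simp add: norm_divide del: of_nat_Suc)
      also have "\<dots> \<le> 1 / real (Suc n) * M" by (intro mult_left_mono M f) simp
      finally show "p (a n - 0) < r" using n by (simp add: mult.commute)
    qed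
  qed
  from null[OF this] obtain n where "\<phi> (a n) < 1" by (auto simp: eventually_sequentially)
  moreover have "\<phi> (a n) = 1 / real (Suc n) * \<phi> (f n)"
    unfolding a_def by (subst hom[OF fE]) (simp add: norm_divide del: of_nat_Suc)
  moreover have "1 / real (Suc n) * \<phi> (f n) > 1 / real (Suc n) * real (Suc n)"
    by (intro mult_strict_left_mono f) simp
  ultimately show False by (simp del: of_nat_Suc)
qed

lemma bounded_singleton: "f \<in> elems E \<Longrightarrow> bounded_in E {f}"
  unfolding bounded_in_def by simp

lemma finite_imp_bounded: "finite_in E B \<Longrightarrow> bounded_in E B"
  unfolding finite_in_def bounded_in_def by simp

section \<open>Continuous functionals and operators on bounded sets\<close>

lemma continuous_sequentially:
  assumes "continuous_map (lcs_topology E) Y T" "limitin (lcs_topology E) a l sequentially"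
  shows "limitin Y (\<lambda>n. T (a n)) (T l) sequentially"
  using continuous_map_limit[OF assms] by (simp add: o_def)

text \<open>This turns the real suprema in the seminorms of the strong dual into genuine ones;
  \<open>op_bounded\<close> does the same for the operator spaces. Only continuity along null
  sequences is exploited.\<close>

lemma dual_bounded:
  assumes u: "u \<in> dual E" and B: "bounded_in E B"
  shows "bdd_above ((\<lambda>f. cmod (u f)) ` B)"
proof (rule bounded_on_bounded[OF B])
  have hom: "u (\<lambda>x. c * f x) = c * u f" if "f \<in> elems E" for c f
    using u that by (simp add: dual_def)
  then show "cmod (u (\<lambda>x. c * f x)) = cmod c * cmod (u f)" if "f \<in> elems E" for c f
    using that by (simp add: norm_mult)
  fix a assume "limitin (lcs_topology E) a 0 sequentially"
  then have "limitin euclidean (\<lambda>n. u (a n)) (u 0) sequentially"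
    using continuous_sequentially u unfolding dual_def by blast
  moreover have "u 0 = 0"
    using hom[OF zero, of 0] by (simp add: zero_fun_def)
  ultimately have "(\<lambda>n. u (a n)) \<longlonglongrightarrow> 0" by simp
  from order_tendstoD(2)[OF tendsto_norm_zero[OF this] zero_less_one]
  show "eventually (\<lambda>n. cmod (u (a n)) < 1) sequentially" .
qed

lemma op_zero:
  assumes "T \<in> cont_operators E"
  shows "T 0 = 0"
proof -
  have "T (\<lambda>x. 0 * (0::'x \<Rightarrow> complex) x) = (\<lambda>x. 0 * T 0 x)"
    using assms zero unfolding cont_operators_def by blast
  then show ?thesis by (simp add: zero_fun_def)
qed

lemma op_mem:
  assumes "T \<in> cont_operators E" "f \<in> elems E"
  shows "T f \<in> elems E"
proof -
  have "continuous_map (lcs_topology E) (lcs_topology E) T"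
    using assms(1) by (simp add: cont_operators_def)
  from continuous_map_image_subset_topspace[OF this] show ?thesis
    using assms(2) by (auto simp: topspace_E)
qed

lemma op_bounded:
  assumes T: "T \<in> cont_operators E" and B: "bounded_in E B" and p: "p \<in> seminorms E"
  shows "bdd_above ((\<lambda>f. p (T f)) ` B)"
proof (rule bounded_on_bounded[OF B])
  show "p (T (\<lambda>x. c * f x)) = cmod c * p (T f)" if f: "f \<in> elems E" for c f
    using T f sem_scale[OF p op_mem[OF T f]] by (simp add: cont_operators_def)
  fix a assume "limitin (lcs_topology E) a 0 sequentially"
  then have "limitin (lcs_topology E) (\<lambda>n. T (a n)) (T 0) sequentially"
    using continuous_sequentially T unfolding cont_operators_def by blast
  from limitinD(2)[OF this p zero_less_one] op_zero[OF T]
  show "eventually (\<lambda>n. p (T (a n)) < 1) sequentially" by simp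
qed

section \<open>Continuity from seminorm estimates\<close>

lemma continuous_lcsI:
  assumes mem: "\<And>f. f \<in> elems E \<Longrightarrow> T f \<in> elems E"
    and sub: "\<And>f g. f \<in> elems E \<Longrightarrow> g \<in> elems E \<Longrightarrow> T (f - g) = T f - T g"
    and bd: "\<And>p. p \<in> seminorms E \<Longrightarrow> \<exists>q\<in>seminorms E. \<exists>C. \<forall>f\<in>elems E. p (T f) \<le> C * q f"
  shows "continuous_map (lcs_topology E) (lcs_topology E) T"
  \<comment> \<open>Only the topology of the codomain is unfolded, since preimages have to be tested
    on its generating sets; the domain keeps its name for the openness argument.\<close>
  unfolding lcs_topology_def[of E, THEN arg_cong[where f="\<lambda>X. continuous_map (lcs_topology E) X T"]]
proof (rule continuous_on_generated_topo)
  let ?S = "{{g \<in> elems E. p (g - f) < r} | p f r. p \<in> seminorms E \<and> f \<in> elems E \<and> 0 < (r::real)}"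
  fix U assume "U \<in> ?S"
  then obtain p g r where p: "p \<in> seminorms E" and g: "g \<in> elems E" and U: "U = {k \<in> elems E. p (k - g) < r}"
    by blast
  obtain q C where q: "q \<in> seminorms E" and C: "\<And>f. f \<in> elems E \<Longrightarrow> p (T f) \<le> C * q f"
    using bd[OF p] by blast
  show "openin (lcs_topology E) (T -` U \<inter> topspace (lcs_topology E))"
  proof (subst openin_subopen, intro ballI)
    fix f assume "f \<in> T -` U \<inter> topspace (lcs_topology E)"
    then have f: "f \<in> elems E" and Tf: "p (T f - g) < r" by (auto simp: U topspace_E)
    \<comment> \<open>\<open>C\<close> may have any sign; \<open>\<bar>C\<bar> + 1\<close> is both
      an upper bound for it and a positive denominator.\<close>
    define e where "e = (r - p (T f - g)) / (\<bar>C\<bar> + 1)"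
    have e: "0 < e" using Tf by (auto simp: e_def)
    let ?V = "{k \<in> elems E. q (k - f) < e}"
    have "openin (lcs_topology E) ?V"
      unfolding lcs_topology_def by (rule topology_generated_by_Basis) (use q f e in blast)
    moreover have "f \<in> ?V" using f e sem_zero[OF q] by simp
    moreover have "k \<in> T -` U \<inter> topspace (lcs_topology E)" if k: "k \<in> ?V" for k
    proof -
      have kE: "k \<in> elems E" using k by simp
      have "p (T k - T f) \<le> C * q (k - f)"
        using C[OF diff[OF kE f]] sub[OF kE f] by simp
      also have "\<dots> \<le> (\<bar>C\<bar> + 1) * q (k - f)"
        using sem_nonneg[OF q diff[OF kE f]] by (intro mult_right_mono) auto
      also have "\<dots> < (\<bar>C\<bar> + 1) * e" using k by (intro mult_strict_left_mono) auto
      also have "\<dots> = r - p (T f - g)" by (simp add: e_def)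
      finally have "p (T k - g) < r"
        using sem_triangle[OF p mem[OF kE] mem[OF f] g] by linarith
      then show ?thesis using mem[OF kE] kE by (simp add: U topspace_E)
    qed
    ultimately show "\<exists>V. openin (lcs_topology E) V \<and> f \<in> V \<and> V \<subseteq> T -` U \<inter> topspace (lcs_topology E)"
      by blast
  qed
next
  show "T ` topspace (lcs_topology E) \<subseteq> \<Union> {{g \<in> elems E. p (g - f) < r} | p f r. p \<in> seminorms E \<and> f \<in> elems E \<and> 0 < (r::real)}"
  proof
    fix k assume "k \<in> T ` topspace (lcs_topology E)"
    then have k: "k \<in> elems E" using mem by (auto simp: topspace_E)
    obtain p where p: "p \<in> seminorms E" using sem_ne by blast
    have "{g \<in> elems E. p (g - k) < 1} \<in> {{g \<in> elems E. p (g - f) < r} | p f r. p \<in> seminorms E \<and> f \<in> elems E \<and> 0 < (r::real)}"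
      using p k zero_less_one by blast
    moreover have "k \<in> {g \<in> elems E. p (g - k) < 1}" using k sem_zero[OF p] by simp
    ultimately show "k \<in> \<Union> {{g \<in> elems E. p (g - f) < r} | p f r. p \<in> seminorms E \<and> f \<in> elems E \<and> 0 < (r::real)}"
      by (rule UnionI)
  qed
qed

lemma continuous_functionalI:
  fixes u :: "('x \<Rightarrow> complex) \<Rightarrow> complex"
  assumes sub: "\<And>f g. f \<in> elems E \<Longrightarrow> g \<in> elems E \<Longrightarrow> u (f - g) = u f - u g"
    and p: "p \<in> seminorms E" and bd: "\<And>f. f \<in> elems E \<Longrightarrow> cmod (u f) \<le> C * p f"
  shows "continuous_map (lcs_topology E) euclidean u"
  unfolding continuous_map_def topspace_E
proof (intro conjI allI impI)
  fix U :: "complex set" assume U: "openin euclidean U"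
  show "openin (lcs_topology E) {f \<in> elems E. u f \<in> U}"
  proof (subst openin_subopen, intro ballI)
    fix f assume "f \<in> {f \<in> elems E. u f \<in> U}"
    then have f: "f \<in> elems E" "u f \<in> U" by auto
    obtain r where r: "0 < r" "ball (u f) r \<subseteq> U"
      using U f(2) open_contains_ball by (metis open_openin)
    define e where "e = r / (\<bar>C\<bar> + 1)"
    have e: "0 < e" using r by (auto simp: e_def)
    let ?V = "{k \<in> elems E. p (k - f) < e}"
    have "openin (lcs_topology E) ?V"
      unfolding lcs_topology_def by (rule topology_generated_by_Basis) (use p f e in blast)
    moreover have "f \<in> ?V" using f e sem_zero[OF p] by simp
    moreover have "u k \<in> U" if k: "k \<in> ?V" for k
    proof -
      have kE: "k \<in> elems E" using k by simp
      have "cmod (u k - u f) \<le> C * p (k - f)"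
        using bd[OF diff[OF kE f(1)]] sub[OF kE f(1)] by simp
      also have "\<dots> \<le> (\<bar>C\<bar> + 1) * p (k - f)"
        using sem_nonneg[OF p diff[OF kE f(1)]] by (intro mult_right_mono) auto
      also have "\<dots> < (\<bar>C\<bar> + 1) * e" using k by (intro mult_strict_left_mono) auto
      also have "\<dots> = r" by (simp add: e_def)
      finally show ?thesis using r(2) by (auto simp: dist_norm norm_minus_commute)
    qed
    ultimately show "\<exists>V. openin (lcs_topology E) V \<and> f \<in> V \<and> V \<subseteq> {f \<in> elems E. u f \<in> U}"
      by blast
  qed
qed auto

end

section \<open>Smooth functions\<close>

abbreviation vd :: "(real \<Rightarrow> complex) \<Rightarrow> real \<Rightarrow> complex" where
  "vd f \<equiv> (\<lambda>x. vector_derivative f (at x))"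

lemma nth_deriv_0 [simp]: "nth_deriv 0 f = f"
  by (simp add: nth_deriv_def)

lemma nth_deriv_Suc: "nth_deriv (Suc i) f = vd (nth_deriv i f)"
  by (simp add: nth_deriv_def)

lemma nth_deriv_Suc': "nth_deriv (Suc i) f = nth_deriv i (vd f)"
  unfolding nth_deriv_def funpow_Suc_right by simp

lemma nth_deriv_nth_deriv: "nth_deriv i (nth_deriv j f) = nth_deriv (i + j) f"
  by (simp add: nth_deriv_def funpow_add)

lemma smooth_nth_deriv: "smooth f \<Longrightarrow> smooth (nth_deriv j f)"
  by (simp add: smooth_def nth_deriv_nth_deriv)

lemma smooth_vd: "smooth f \<Longrightarrow> smooth (vd f)"
  using smooth_nth_deriv[of f "Suc 0"] by (simp add: nth_deriv_Suc)

lemma has_nth_deriv: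
  "smooth f \<Longrightarrow> (nth_deriv i f has_vector_derivative nth_deriv (Suc i) f x) (at x)"
  unfolding nth_deriv_Suc smooth_def by (simp add: vector_derivative_works[symmetric])

lemma has_vd: "smooth f \<Longrightarrow> (f has_vector_derivative vd f x) (at x)"
  using has_nth_deriv[of f 0 x] by (simp add: nth_deriv_Suc)

lemma vdI: "(\<And>x. (f has_vector_derivative f' x) (at x)) \<Longrightarrow> vd f = f'"
  by (auto simp: vector_derivative_at)

text \<open>A class closed under one differentiation contains all iterated derivatives of its
  members. Smoothness is therefore shown below by exhibiting such a class, with no formula for the
  derivative of order \<open>i\<close>.\<close>

lemma smooth_class:
  assumes K: "\<And>f. f \<in> K \<Longrightarrow> \<exists>f'\<in>K. \<forall>x. (f has_vector_derivative f' x) (at x)" and f: "f \<in> K"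
  shows "nth_deriv i f \<in> K" "smooth f"
proof -
  show *: "nth_deriv i f \<in> K" for i
  proof (induction i)
    case (Suc i)
    then show ?case using K[OF Suc] vdI[of "nth_deriv i f"] by (auto simp: nth_deriv_Suc)
  qed (simp add: f)
  show "smooth f"
    unfolding smooth_def
  proof (intro allI)
    fix i x show "nth_deriv i f differentiable at x"
      using K[OF *[of i]] differentiableI_vector by blast
  qed
qed

lemma smooth_add:
  assumes "smooth f" "smooth g" shows "smooth (\<lambda>x. f x + g x)"
proof (rule smooth_class(2)[where K = "{\<lambda>x. f x + g x | f g. smooth f \<and> smooth g}"])
  fix h assume "h \<in> {\<lambda>x. f x + g x | f g. smooth f \<and> smooth g}"
  then obtain f g where *: "h = (\<lambda>x. f x + g x)" "smooth f" "smooth g" by blast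
  then have "\<forall>x. (h has_vector_derivative vd f x + vd g x) (at x)"
    by (auto intro!: derivative_intros has_vd)
  moreover have "(\<lambda>x. vd f x + vd g x) \<in> {\<lambda>x. f x + g x | f g. smooth f \<and> smooth g}"
    by (intro CollectI exI[of _ "vd f"] exI[of _ "vd g"] conjI refl smooth_vd *)
  ultimately show "\<exists>f'\<in>{\<lambda>x. f x + g x | f g. smooth f \<and> smooth g}. \<forall>x. (h has_vector_derivative f' x) (at x)"
    by (rule bexI[of _ "\<lambda>x. vd f x + vd g x"])
next
  show "(\<lambda>x. f x + g x) \<in> {\<lambda>x. f x + g x | f g. smooth f \<and> smooth g}"
    by (intro CollectI exI[of _ f] exI[of _ g] conjI refl assms)
qed

lemma smooth_cmult:
  assumes "smooth f" shows "smooth (\<lambda>x. c * f x)"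
proof (rule smooth_class(2)[where K = "{\<lambda>x. c * f x | f. smooth f}"])
  fix h assume "h \<in> {\<lambda>x. c * f x | f. smooth f}"
  then obtain f where *: "h = (\<lambda>x. c * f x)" "smooth f" by blast
  then have "\<forall>x. (h has_vector_derivative c * vd f x) (at x)"
    by (auto intro!: has_vector_derivative_mult_right has_vd)
  with * show "\<exists>f'\<in>{\<lambda>x. c * f x | f. smooth f}. \<forall>x. (h has_vector_derivative f' x) (at x)"
    by (intro bexI[of _ "\<lambda>x. c * vd f x"]) (auto intro: smooth_vd)
qed (use assms in blast)

text \<open>Products alone are not closed under differentiation, but the derivative of a product is
  a sum of two products, so closing under sums gives a class to which \<open>smooth_class\<close>
  applies.\<close>

inductive_set product_sums :: "(real \<Rightarrow> complex) set" where
  product: "smooth f \<Longrightarrow> smooth g \<Longrightarrow> (\<lambda>x. f x * g x) \<in> product_sums"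
| sum: "f \<in> product_sums \<Longrightarrow> g \<in> product_sums \<Longrightarrow> (\<lambda>x. f x + g x) \<in> product_sums"

lemma has_vd_mult:
  assumes "smooth f" "smooth g"
  shows "((\<lambda>x. f x * g x) has_vector_derivative (vd f x * g x + f x * vd g x)) (at x)"
  by (subst add.commute) (rule has_vector_derivative_mult[OF has_vd[OF assms(1)] has_vd[OF assms(2)]])

lemma smooth_mult:
  assumes "smooth f" "smooth g" shows "smooth (\<lambda>x. f x * g x)"
proof (rule smooth_class(2))
  show "(\<lambda>x. f x * g x) \<in> product_sums" using assms by (rule product)
  show "\<exists>f'\<in>product_sums. \<forall>x. (h has_vector_derivative f' x) (at x)" if "h \<in> product_sums" for h
    using that
  proof induction
    case (product f g)
    then show ?case
      by (intro bexI[of _ "\<lambda>x. vd f x * g x + f x * vd g x"])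
        (auto intro: has_vd_mult intro!: product_sums.intros smooth_vd)
  next
    case (sum f g)
    then obtain f' g' where "f' \<in> product_sums" "g' \<in> product_sums"
      "\<forall>x. (f has_vector_derivative f' x) (at x)" "\<forall>x. (g has_vector_derivative g' x) (at x)" by blast
    then show ?case
      by (intro bexI[of _ "\<lambda>x. f' x + g' x"]) (auto intro!: product_sums.sum derivative_intros)
  qed
qed

section \<open>Derivatives of sums and products, and jets\<close>

lemma vd_add: "smooth f \<Longrightarrow> smooth g \<Longrightarrow> vd (\<lambda>x. f x + g x) = (\<lambda>x. vd f x + vd g x)"
  by (rule vdI) (intro derivative_intros has_vd)

lemma vd_cmult: "smooth f \<Longrightarrow> vd (\<lambda>x. c * f x) = (\<lambda>x. c * vd f x)"
  by (rule vdI) (intro has_vector_derivative_mult_right has_vd)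

lemma vd_mult: "smooth f \<Longrightarrow> smooth g \<Longrightarrow> vd (\<lambda>x. f x * g x) = (\<lambda>x. vd f x * g x + f x * vd g x)"
  by (rule vdI) (rule has_vd_mult)

lemma nth_deriv_add:
  "smooth f \<Longrightarrow> smooth g \<Longrightarrow> nth_deriv i (\<lambda>x. f x + g x) = (\<lambda>x. nth_deriv i f x + nth_deriv i g x)"
  by (induction i) (simp_all add: nth_deriv_Suc vd_add smooth_nth_deriv)

lemma nth_deriv_cmult:
  "smooth f \<Longrightarrow> nth_deriv i (\<lambda>x. c * f x) = (\<lambda>x. c * nth_deriv i f x)"
  by (induction i) (simp_all add: nth_deriv_Suc vd_cmult smooth_nth_deriv)

text \<open>A sum takes the place of the supremum over \<open>i\<close> because it obeys the
  recursion \<open>jet_Suc\<close>, on which the product estimate rests; the two differ by a factor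
  of at most \<open>Suc m\<close>.\<close>

definition jet :: "nat \<Rightarrow> (real \<Rightarrow> complex) \<Rightarrow> real \<Rightarrow> real" where
  "jet m f x = (\<Sum>i\<le>m. cmod (nth_deriv i f x))"

lemma jet_nonneg [simp]: "0 \<le> jet m f x"
  unfolding jet_def by (intro sum_nonneg) simp

lemma jet_Suc: "jet (Suc m) f x = cmod (f x) + jet m (vd f) x"
  unfolding jet_def by (subst sum.atMost_Suc_shift) (simp add: nth_deriv_Suc')

lemma jet_mono: "m \<le> n \<Longrightarrow> jet m f x \<le> jet n f x"
  unfolding jet_def by (intro sum_mono2) auto

lemma jet_ge: "i \<le> m \<Longrightarrow> cmod (nth_deriv i f x) \<le> jet m f x"
  unfolding jet_def by (rule member_le_sum) auto

lemma jet_le: "(\<And>i. i \<le> m \<Longrightarrow> cmod (nth_deriv i f x) \<le> C) \<Longrightarrow> jet m f x \<le> real (Suc m) * C"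
  unfolding jet_def using sum_bounded_above[of "{..m}" "\<lambda>i. cmod (nth_deriv i f x)" C] by auto

lemma jet_add: "smooth f \<Longrightarrow> smooth g \<Longrightarrow> jet m (\<lambda>x. f x + g x) x \<le> jet m f x + jet m g x"
  unfolding jet_def by (simp add: nth_deriv_add sum.distrib[symmetric] sum_mono norm_triangle_ineq)

lemma jet_cmult: "smooth f \<Longrightarrow> jet m (\<lambda>x. c * f x) x = cmod c * jet m f x"
  unfolding jet_def by (simp add: nth_deriv_cmult norm_mult sum_distrib_left)

lemma jet_vd: "jet m (vd f) x \<le> jet (Suc m) f x"
  by (simp add: jet_Suc)

text \<open>Splitting off order 0 leaves the value of the product and the jets of order
  \<open>m\<close> of two products with one factor differentiated. The constants thus obey
  \<open>c (Suc m) = 1 + 2 * c m\<close> with \<open>c 0 = 1\<close>, which \<open>3 ^ m\<close>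
  dominates.\<close>

lemma jet_mult: "smooth f \<Longrightarrow> smooth g \<Longrightarrow> jet m (\<lambda>x. f x * g x) x \<le> 3 ^ m * (jet m f x * jet m g x)"
proof (induction m arbitrary: f g)
  case 0
  then show ?case by (simp add: jet_def norm_mult)
next
  case (Suc m)
  let ?P = "jet (Suc m) f x * jet (Suc m) g x"
  note s = smooth_vd[OF Suc.prems(1)] smooth_vd[OF Suc.prems(2)]
  have P: "0 \<le> ?P" by simp
  have "jet (Suc m) (\<lambda>x. f x * g x) x
    = cmod (f x) * cmod (g x) + jet m (\<lambda>x. vd f x * g x + f x * vd g x) x"
    by (simp add: jet_Suc vd_mult[OF Suc.prems] norm_mult)
  also have "\<dots> \<le> cmod (f x) * cmod (g x) + (jet m (\<lambda>x. vd f x * g x) x + jet m (\<lambda>x. f x * vd g x) x)"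
    by (intro add_left_mono jet_add smooth_mult s Suc.prems)
  also have "\<dots> \<le> ?P + (3 ^ m * ?P + 3 ^ m * ?P)"
  proof (intro add_mono)
    show "cmod (f x) * cmod (g x) \<le> ?P"
      by (intro mult_mono) (auto simp: jet_Suc)
    have "jet m (\<lambda>x. vd f x * g x) x \<le> 3 ^ m * (jet m (vd f) x * jet m g x)"
      by (rule Suc.IH[OF s(1) Suc.prems(2)])
    also have "\<dots> \<le> 3 ^ m * ?P"
      by (intro mult_left_mono mult_mono jet_vd jet_mono) auto
    finally show "jet m (\<lambda>x. vd f x * g x) x \<le> 3 ^ m * ?P" .
    have "jet m (\<lambda>x. f x * vd g x) x \<le> 3 ^ m * (jet m f x * jet m (vd g) x)"
      by (rule Suc.IH[OF Suc.prems(1) s(2)])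
    also have "\<dots> \<le> 3 ^ m * ?P"
      by (intro mult_left_mono mult_mono jet_vd jet_mono) auto
    finally show "jet m (\<lambda>x. f x * vd g x) x \<le> 3 ^ m * ?P" .
  qed
  also have "\<dots> = (1 + 2 * 3 ^ m) * ?P" by (simp add: algebra_simps)
  also have "\<dots> \<le> 3 ^ Suc m * ?P"
    by (intro mult_right_mono P) simp
  finally show ?case .
qed

section \<open>Schwartz functions and multipliers\<close>

lemma weight_ge_1: "1 \<le> (1 + x\<^sup>2) ^ k" for x :: real
  by (rule one_le_power) simp

lemma weight_pos: "0 < (1 + x\<^sup>2) ^ k" for x :: real
  using weight_ge_1[of x k] by linarith

lemma weight_mono: "k \<le> l \<Longrightarrow> (1 + x\<^sup>2) ^ k \<le> (1 + x\<^sup>2) ^ l" for x :: real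
  by (rule power_increasing) simp_all

text \<open>The defining norms couple the power of the weight and the order of differentiation in
  one index; here they vary independently, as estimates of products require. The passage is by
  \<open>max m k\<close>.\<close>

lemma schwartz_iff:
  "f \<in> schwartz_fun \<longleftrightarrow> smooth f \<and> (\<forall>m k. \<exists>C. \<forall>x. (1 + x\<^sup>2) ^ k * jet m f x \<le> C)"
proof (intro iffI conjI allI)
  assume f: "f \<in> schwartz_fun"
  then show "smooth f" by (simp add: schwartz_fun_def)
  fix m k :: nat
  let ?n = "max m k"
  have "bdd_above ((\<lambda>(x, i). (1 + x\<^sup>2) ^ ?n * cmod (nth_deriv i f x)) ` (UNIV \<times> {0..?n}))"
    using f by (simp add: schwartz_fun_def)
  then obtain C where C: "\<And>x i. i \<le> ?n \<Longrightarrow> (1 + x\<^sup>2) ^ ?n * cmod (nth_deriv i f x) \<le> C"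
    by (force simp: bdd_above_def)
  have "(1 + x\<^sup>2) ^ k * jet m f x \<le> real (Suc m) * C" for x
  proof -
    have "jet m f x \<le> real (Suc m) * (C / (1 + x\<^sup>2) ^ k)"
    proof (rule jet_le)
      fix i assume "i \<le> m"
      have "(1 + x\<^sup>2) ^ k * cmod (nth_deriv i f x) \<le> (1 + x\<^sup>2) ^ ?n * cmod (nth_deriv i f x)"
        by (intro mult_right_mono weight_mono) auto
      also have "\<dots> \<le> C" using C \<open>i \<le> m\<close> by simp
      finally show "cmod (nth_deriv i f x) \<le> C / (1 + x\<^sup>2) ^ k"
        by (simp add: pos_le_divide_eq weight_pos mult.commute)
    qed
    then show ?thesis by (simp add: pos_le_divide_eq weight_pos mult.commute)
  qed
  then show "\<exists>C. \<forall>x. (1 + x\<^sup>2) ^ k * jet m f x \<le> C" by blast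
next
  assume *: "smooth f \<and> (\<forall>m k. \<exists>C. \<forall>x. (1 + x\<^sup>2) ^ k * jet m f x \<le> C)"
  show "f \<in> schwartz_fun"
    unfolding schwartz_fun_def
  proof (intro CollectI conjI allI)
    show "smooth f" using * by simp
    fix n
    obtain C where C: "\<And>x. (1 + x\<^sup>2) ^ n * jet n f x \<le> C" using * by meson
    show "bdd_above ((\<lambda>(x, i). (1 + x\<^sup>2) ^ n * cmod (nth_deriv i f x)) ` (UNIV \<times> {0..n}))"
    proof (rule bdd_aboveI2, clarify)
      fix x :: real and i assume "i \<in> {0..n}"
      then have "(1 + x\<^sup>2) ^ n * cmod (nth_deriv i f x) \<le> (1 + x\<^sup>2) ^ n * jet n f x"
        by (intro mult_left_mono jet_ge) auto
      with C show "(1 + x\<^sup>2) ^ n * cmod (nth_deriv i f x) \<le> C" by (meson order_trans)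
    qed
  qed
qed

lemma OM_iff:
  "f \<in> OM_fun \<longleftrightarrow> smooth f \<and> (\<forall>m. \<exists>k C. 0 \<le> C \<and> (\<forall>x. jet m f x \<le> C * (1 + x\<^sup>2) ^ k))"
proof (intro iffI conjI allI)
  assume f: "f \<in> OM_fun"
  then show "smooth f" by (simp add: OM_fun_def)
  fix m
  obtain k where "bdd_above ((\<lambda>(x, i). cmod (nth_deriv i f x) / (1 + x\<^sup>2) ^ k) ` (UNIV \<times> {0..m}))"
    using f unfolding OM_fun_def by blast
  then obtain C where C: "\<And>x i. i \<le> m \<Longrightarrow> cmod (nth_deriv i f x) / (1 + x\<^sup>2) ^ k \<le> C"
    by (force simp: bdd_above_def)
  have "jet m f x \<le> real (Suc m) * (C * (1 + x\<^sup>2) ^ k)" for x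
    using C by (intro jet_le) (simp add: pos_divide_le_eq weight_pos)
  moreover have "0 \<le> C" using order_trans[OF _ C[of 0 0]] by simp
  ultimately show "\<exists>k C. 0 \<le> C \<and> (\<forall>x. jet m f x \<le> C * (1 + x\<^sup>2) ^ k)"
    by (intro exI[of _ k] exI[of _ "real (Suc m) * C"]) (simp add: mult.assoc)
next
  assume *: "smooth f \<and> (\<forall>m. \<exists>k C. 0 \<le> C \<and> (\<forall>x. jet m f x \<le> C * (1 + x\<^sup>2) ^ k))"
  show "f \<in> OM_fun"
    unfolding OM_fun_def
  proof (intro CollectI conjI allI)
    show "smooth f" using * by simp
    fix m
    obtain C k where C: "\<And>x. jet m f x \<le> C * (1 + x\<^sup>2) ^ k" using * by meson
    have "bdd_above ((\<lambda>(x, i). cmod (nth_deriv i f x) / (1 + x\<^sup>2) ^ k) ` (UNIV \<times> {0..m}))"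
    proof (rule bdd_aboveI2, clarify)
      fix x :: real and i assume "i \<in> {0..m}"
      then have "cmod (nth_deriv i f x) \<le> C * (1 + x\<^sup>2) ^ k"
        using jet_ge[of i m f x] C[of x] by simp
      then show "cmod (nth_deriv i f x) / (1 + x\<^sup>2) ^ k \<le> C"
        by (simp add: pos_divide_le_eq weight_pos)
    qed
    then show "\<exists>k. bdd_above ((\<lambda>(x, i). cmod (nth_deriv i f x) / (1 + x\<^sup>2) ^ k) ` (UNIV \<times> {0..m}))" ..
  qed
qed

lemma schwartz_smooth: "f \<in> schwartz_fun \<Longrightarrow> smooth f"
  and OM_smooth: "f \<in> OM_fun \<Longrightarrow> smooth f"
  by (simp_all add: schwartz_iff OM_iff)

lemma schwartzE:
  assumes "f \<in> schwartz_fun"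
  obtains C where "0 \<le> C" "\<And>x. (1 + x\<^sup>2) ^ k * jet m f x \<le> C"
proof -
  obtain C where C: "\<And>x. (1 + x\<^sup>2) ^ k * jet m f x \<le> C"
    using assms unfolding schwartz_iff by meson
  have "0 \<le> (1 + 0\<^sup>2) ^ k * jet m f (0::real)" by simp
  with C show ?thesis using order_trans that by blast
qed

section \<open>Algebraic operations on multipliers and on Schwartz functions\<close>

lemma OM_add: assumes "f \<in> OM_fun" "g \<in> OM_fun" shows "(\<lambda>x. f x + g x) \<in> OM_fun"
  unfolding OM_iff
proof (intro conjI allI)
  show "smooth (\<lambda>x. f x + g x)" using assms by (intro smooth_add OM_smooth)
  fix m
  obtain k C l D where *: "0 \<le> C" "\<And>x. jet m f x \<le> C * (1 + x\<^sup>2) ^ k" "0 \<le> D" "\<And>x. jet m g x \<le> D * (1 + x\<^sup>2) ^ l"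
    using assms unfolding OM_iff by meson
  have "jet m (\<lambda>x. f x + g x) x \<le> (C + D) * (1 + x\<^sup>2) ^ (k + l)" for x
  proof -
    have "jet m (\<lambda>x. f x + g x) x \<le> C * (1 + x\<^sup>2) ^ k + D * (1 + x\<^sup>2) ^ l"
      using jet_add[of f g m x] assms *(2,4)[of x] by (simp add: OM_smooth)
    also have "\<dots> \<le> C * (1 + x\<^sup>2) ^ (k + l) + D * (1 + x\<^sup>2) ^ (k + l)"
      by (intro add_mono mult_left_mono weight_mono *) simp_all
    finally show ?thesis by (simp add: algebra_simps)
  qed
  then show "\<exists>k C. 0 \<le> C \<and> (\<forall>x. jet m (\<lambda>x. f x + g x) x \<le> C * (1 + x\<^sup>2) ^ k)"
    using * by (intro exI[of _ "k + l"] exI[of _ "C + D"]) simp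
qed

lemma OM_mult: assumes "f \<in> OM_fun" "g \<in> OM_fun" shows "(\<lambda>x. f x * g x) \<in> OM_fun"
  unfolding OM_iff
proof (intro conjI allI)
  show "smooth (\<lambda>x. f x * g x)" using assms by (intro smooth_mult OM_smooth)
  fix m
  obtain k C l D where *: "0 \<le> C" "\<And>x. jet m f x \<le> C * (1 + x\<^sup>2) ^ k" "0 \<le> D" "\<And>x. jet m g x \<le> D * (1 + x\<^sup>2) ^ l"
    using assms unfolding OM_iff by meson
  have "jet m (\<lambda>x. f x * g x) x \<le> (3 ^ m * C * D) * (1 + x\<^sup>2) ^ (k + l)" for x
  proof -
    have "jet m (\<lambda>x. f x * g x) x \<le> 3 ^ m * (jet m f x * jet m g x)"
      using assms by (intro jet_mult OM_smooth)
    also have "\<dots> \<le> 3 ^ m * ((C * (1 + x\<^sup>2) ^ k) * (D * (1 + x\<^sup>2) ^ l))"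
      using * by (intro mult_left_mono mult_mono) auto
    finally show ?thesis by (simp add: power_add mult_ac)
  qed
  then show "\<exists>k C. 0 \<le> C \<and> (\<forall>x. jet m (\<lambda>x. f x * g x) x \<le> C * (1 + x\<^sup>2) ^ k)"
    using * by (intro exI[of _ "k + l"] exI[of _ "3 ^ m * C * D"]) simp
qed

lemma OM_jet_mult:
  assumes a: "a \<in> OM_fun"
  obtains k C where "0 \<le> C"
    "\<And>f x. smooth f \<Longrightarrow> jet m (\<lambda>x. a x * f x) x \<le> C * ((1 + x\<^sup>2) ^ k * jet m f x)"
proof -
  obtain k C where *: "0 \<le> C" "\<And>x. jet m a x \<le> C * (1 + x\<^sup>2) ^ k"
    using a unfolding OM_iff by meson
  have "jet m (\<lambda>x. a x * f x) x \<le> (3 ^ m * C) * ((1 + x\<^sup>2) ^ k * jet m f x)" if "smooth f" for f x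
  proof -
    have "jet m (\<lambda>x. a x * f x) x \<le> 3 ^ m * (jet m a x * jet m f x)"
      by (intro jet_mult OM_smooth[OF a] that)
    also have "\<dots> \<le> 3 ^ m * ((C * (1 + x\<^sup>2) ^ k) * jet m f x)"
      using * by (intro mult_left_mono mult_right_mono) auto
    finally show ?thesis by (simp add: mult_ac)
  qed
  with *(1) that[of "3 ^ m * C" k] show ?thesis by simp
qed

lemma schwartz_mult: assumes a: "a \<in> OM_fun" and f: "f \<in> schwartz_fun" shows "(\<lambda>x. a x * f x) \<in> schwartz_fun"
  unfolding schwartz_iff
proof (intro conjI allI)
  show "smooth (\<lambda>x. a x * f x)" using assms by (intro smooth_mult OM_smooth schwartz_smooth)
  fix m k
  obtain l C where C: "0 \<le> C" "\<And>x. jet m (\<lambda>x. a x * f x) x \<le> C * ((1 + x\<^sup>2) ^ l * jet m f x)"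
    using OM_jet_mult[OF a] schwartz_smooth[OF f] by metis
  obtain D where D: "\<And>x. (1 + x\<^sup>2) ^ (k + l) * jet m f x \<le> D" using schwartzE[OF f] by metis
  have "(1 + x\<^sup>2) ^ k * jet m (\<lambda>x. a x * f x) x \<le> C * D" for x
  proof -
    have "(1 + x\<^sup>2) ^ k * jet m (\<lambda>x. a x * f x) x \<le> (1 + x\<^sup>2) ^ k * (C * ((1 + x\<^sup>2) ^ l * jet m f x))"
      by (intro mult_left_mono C) simp
    also have "\<dots> = C * ((1 + x\<^sup>2) ^ (k + l) * jet m f x)" by (simp add: power_add mult_ac)
    also have "\<dots> \<le> C * D" by (intro mult_left_mono C D)
    finally show ?thesis .
  qed
  then show "\<exists>C. \<forall>x. (1 + x\<^sup>2) ^ k * jet m (\<lambda>x. a x * f x) x \<le> C" by blast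
qed

lemma schwartz_add: assumes f: "f \<in> schwartz_fun" and g: "g \<in> schwartz_fun" shows "(\<lambda>x. f x + g x) \<in> schwartz_fun"
  unfolding schwartz_iff
proof (intro conjI allI)
  show "smooth (\<lambda>x. f x + g x)" using assms by (intro smooth_add schwartz_smooth)
  fix m k
  obtain C where C: "\<And>x. (1 + x\<^sup>2) ^ k * jet m f x \<le> C" using schwartzE[OF f] by metis
  obtain D where D: "\<And>x. (1 + x\<^sup>2) ^ k * jet m g x \<le> D" using schwartzE[OF g] by metis
  have "(1 + x\<^sup>2) ^ k * jet m (\<lambda>x. f x + g x) x \<le> C + D" for x
  proof -
    have "(1 + x\<^sup>2) ^ k * jet m (\<lambda>x. f x + g x) x \<le> (1 + x\<^sup>2) ^ k * (jet m f x + jet m g x)"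
      using assms by (intro mult_left_mono jet_add schwartz_smooth) simp_all
    also have "\<dots> \<le> C + D" using C[of x] D[of x] by (simp add: distrib_left)
    finally show ?thesis .
  qed
  then show "\<exists>C. \<forall>x. (1 + x\<^sup>2) ^ k * jet m (\<lambda>x. f x + g x) x \<le> C" by blast
qed

lemma schwartz_vd: assumes f: "f \<in> schwartz_fun" shows "vd f \<in> schwartz_fun"
  unfolding schwartz_iff
proof (intro conjI allI)
  show "smooth (vd f)" using f by (intro smooth_vd schwartz_smooth)
  fix m k
  obtain C where C: "\<And>x. (1 + x\<^sup>2) ^ k * jet (Suc m) f x \<le> C" using schwartzE[OF f] by metis
  have "(1 + x\<^sup>2) ^ k * jet m (vd f) x \<le> C" for x
    by (rule order_trans[OF mult_left_mono[OF jet_vd] C]) simp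
  then show "\<exists>C. \<forall>x. (1 + x\<^sup>2) ^ k * jet m (vd f) x \<le> C" by blast
qed

text \<open>The polynomials of degree at most 2 form a class closed under differentiation with the
  common growth \<open>1 + x\<^sup>2\<close>. They supply the constants and, after multiplication,
  all the weights.\<close>

lemma quadratic_OM: "(\<lambda>x. a + b * of_real x + c * of_real x ^ 2) \<in> OM_fun"
proof -
  let ?K = "{\<lambda>x::real. a + b * of_real x + c * of_real x ^ 2 | a b c :: complex. True}"
  have K: "\<exists>f'\<in>?K. \<forall>x. (f has_vector_derivative f' x) (at x)" if fK: "f \<in> ?K" for f
  proof -
    obtain a b c :: complex where f: "f = (\<lambda>x. a + b * of_real x + c * of_real x ^ 2)" using fK by blast
    have "(f has_vector_derivative b + 2 * c * of_real x + 0 * of_real x ^ 2) (at x)" for x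
    proof -
      have "((\<lambda>z. a + b * z + c * z ^ 2) has_field_derivative b + 2 * c * of_real x) (at (of_real x))"
        by (auto intro!: derivative_eq_intros)
      from has_vector_derivative_real_field[OF this] show ?thesis by (simp add: f)
    qed
    then have "\<forall>x. (f has_vector_derivative b + 2 * c * of_real x + 0 * of_real x ^ 2) (at x)" ..
    moreover have "(\<lambda>x. b + 2 * c * of_real x + 0 * of_real x ^ 2) \<in> ?K" by blast
    ultimately show ?thesis by (rule bexI)
  qed
  have f: "(\<lambda>x. a + b * of_real x + c * of_real x ^ 2) \<in> ?K" by blast
  have bd: "\<exists>C\<ge>0. \<forall>x. cmod (f x) \<le> C * (1 + x\<^sup>2)" if fK: "f \<in> ?K" for f
  proof -
    obtain a b c :: complex where f: "f = (\<lambda>x. a + b * of_real x + c * of_real x ^ 2)" using fK by blast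
    have "cmod (f x) \<le> (cmod a + cmod b + cmod c) * (1 + x\<^sup>2)" for x
    proof -
      have "\<bar>x\<bar> \<le> 1 + x\<^sup>2" 
        using zero_le_power2[of "\<bar>x\<bar> - 1"] by (simp add: power2_diff)
      then have "cmod a * 1 + cmod b * \<bar>x\<bar> + cmod c * x\<^sup>2 \<le> cmod a * (1 + x\<^sup>2) + cmod b * (1 + x\<^sup>2) + cmod c * (1 + x\<^sup>2)"
        by (intro add_mono mult_left_mono) auto
      moreover have "cmod (f x) \<le> cmod a + cmod b * \<bar>x\<bar> + cmod c * x\<^sup>2"
        unfolding f by (intro order_trans[OF norm_triangle_ineq] add_mono) (auto simp: norm_mult norm_power)
      ultimately show ?thesis by (simp add: algebra_simps)
    qed
    then show ?thesis by (intro exI[of _ "cmod a + cmod b + cmod c"]) auto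
  qed
  show ?thesis unfolding OM_iff
  proof (intro conjI allI)
    show "smooth (\<lambda>x. a + b * of_real x + c * of_real x ^ 2)" by (rule smooth_class(2)[OF K f])
    fix m
    obtain C where C: "\<And>i. 0 \<le> C i" "\<And>i x. cmod (nth_deriv i (\<lambda>x. a + b * of_real x + c * of_real x ^ 2) x) \<le> C i * (1 + x\<^sup>2)"
      using bd[OF smooth_class(1)[OF K f]] by metis
    have "jet m (\<lambda>x. a + b * of_real x + c * of_real x ^ 2) x \<le> (\<Sum>i\<le>m. C i) * (1 + x\<^sup>2) ^ 1" for x
      unfolding jet_def sum_distrib_right power_one_right by (intro sum_mono C)
    then show "\<exists>k C. 0 \<le> C \<and> (\<forall>x. jet m (\<lambda>x. a + b * of_real x + c * of_real x ^ 2) x \<le> C * (1 + x\<^sup>2) ^ k)"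
      by (intro exI[of _ 1] exI[of _ "\<Sum>i\<le>m. C i"]) (auto intro: sum_nonneg C)
  qed
qed

lemma const_OM: "(\<lambda>x. c) \<in> OM_fun"
  using quadratic_OM[of c 0 0] by simp

text \<open>It follows that a factor \<open>(1 + x\<^sup>2) ^ k\<close> may be moved into the
  Schwartz weight \<open>v\<close> of an \<open>OM_norm\<close>, a device used repeatedly
  below.\<close>

lemma weight_OM: "(\<lambda>x. of_real ((1 + x\<^sup>2) ^ k)) \<in> OM_fun"
proof (induction k)
  case (Suc k)
  have "(\<lambda>x. of_real (1 + x\<^sup>2)) \<in> OM_fun" using quadratic_OM[of 1 0 1] by simp
  from OM_mult[OF this Suc] show ?case by simp
qed (simp add: const_OM)

lemma OM_cmult: "f \<in> OM_fun \<Longrightarrow> (\<lambda>x. c * f x) \<in> OM_fun"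
  by (rule OM_mult[OF const_OM])

lemma OM_sum: "(\<And>i. i \<in> I \<Longrightarrow> f i \<in> OM_fun) \<Longrightarrow> (\<lambda>x. \<Sum>i\<in>I. f i x) \<in> OM_fun"
  by (induction I rule: infinite_finite_induct) (auto intro: OM_add const_OM)

lemma OM_power: "f \<in> OM_fun \<Longrightarrow> (\<lambda>x. f x ^ k) \<in> OM_fun"
  by (induction k) (auto intro: OM_mult const_OM)

lemma mean_power_OM: "h \<in> OM_fun \<Longrightarrow> mean_power h n \<in> OM_fun"
  unfolding mean_power_def by (intro OM_cmult OM_sum OM_power)

lemma schwartz_cmult: "f \<in> schwartz_fun \<Longrightarrow> (\<lambda>x. c * f x) \<in> schwartz_fun"
  by (rule schwartz_mult[OF const_OM])

section \<open>Seminorms and bounded sets of the Schwartz space and of the multipliers\<close>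

lemma schwartz_norm_ge:
  assumes f: "f \<in> schwartz_fun" and i: "i \<le> n"
  shows "(1 + x\<^sup>2) ^ n * cmod (nth_deriv i f x) \<le> schwartz_norm n f"
proof -
  have b: "bdd_above ((\<lambda>(x, i). (1 + x\<^sup>2) ^ n * cmod (nth_deriv i f x)) ` (UNIV \<times> {0..n}))"
    using f by (simp add: schwartz_fun_def)
  show ?thesis unfolding schwartz_norm_def
    using cSUP_upper[OF _ b, of "(x, i)"] i by simp
qed

lemma schwartz_norm_le:
  assumes "\<And>x i. i \<le> n \<Longrightarrow> (1 + x\<^sup>2) ^ n * cmod (nth_deriv i f x) \<le> C"
  shows "schwartz_norm n f \<le> C"
  unfolding schwartz_norm_def using assms by (intro cSUP_least) auto

lemma schwartz_norm_le_jet: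
  assumes "\<And>x. (1 + x\<^sup>2) ^ n * jet n f x \<le> C"
  shows "schwartz_norm n f \<le> C"
proof (rule schwartz_norm_le)
  fix x :: real and i assume "i \<le> n"
  then have "(1 + x\<^sup>2) ^ n * cmod (nth_deriv i f x) \<le> (1 + x\<^sup>2) ^ n * jet n f x"
    by (intro mult_left_mono jet_ge) auto
  with assms show "(1 + x\<^sup>2) ^ n * cmod (nth_deriv i f x) \<le> C" by (meson order_trans)
qed

lemma jet_le_schwartz_norm:
  assumes f: "f \<in> schwartz_fun" and "k \<le> n" "m \<le> n"
  shows "(1 + x\<^sup>2) ^ k * jet m f x \<le> real (Suc n) * schwartz_norm n f"
proof -
  have "jet n f x \<le> real (Suc n) * (schwartz_norm n f / (1 + x\<^sup>2) ^ n)"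
    using schwartz_norm_ge[OF f] by (intro jet_le) (simp add: pos_le_divide_eq weight_pos mult.commute)
  then have "(1 + x\<^sup>2) ^ n * jet n f x \<le> real (Suc n) * schwartz_norm n f"
    by (simp add: pos_le_divide_eq weight_pos mult.commute del: of_nat_Suc)
  moreover have "(1 + x\<^sup>2) ^ k * jet m f x \<le> (1 + x\<^sup>2) ^ n * jet n f x"
    using assms by (intro mult_mono weight_mono jet_mono) auto
  ultimately show ?thesis by linarith
qed

lemma OM_norm_bdd:
  assumes v: "v \<in> schwartz_fun" and f: "f \<in> OM_fun"
  obtains C where "0 \<le> C" "\<And>x. cmod (v x) * jet m f x \<le> C"
proof -
  obtain k C where C: "0 \<le> C" "\<And>x. jet m f x \<le> C * (1 + x\<^sup>2) ^ k"
    using f unfolding OM_iff by meson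
  obtain D where D: "0 \<le> D" "\<And>x. (1 + x\<^sup>2) ^ k * jet 0 v x \<le> D"
    by (rule schwartzE[OF v, of k 0]) blast
  have "cmod (v x) * jet m f x \<le> C * D" for x
  proof -
    have "cmod (v x) * jet m f x \<le> cmod (v x) * (C * (1 + x\<^sup>2) ^ k)"
      by (intro mult_left_mono C) simp
    also have "\<dots> = C * ((1 + x\<^sup>2) ^ k * jet 0 v x)" by (simp add: jet_def)
    also have "\<dots> \<le> C * D" by (intro mult_left_mono C D)
    finally show ?thesis .
  qed
  with C D show ?thesis by (intro that[of "C * D"]) simp_all
qed

lemma OM_norm_ge:
  assumes v: "v \<in> schwartz_fun" and f: "f \<in> OM_fun" and i: "i \<le> m"
  shows "cmod (v x) * cmod (nth_deriv i f x) \<le> OM_norm m v f"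
proof -
  obtain C where C: "\<And>x. cmod (v x) * jet m f x \<le> C" using OM_norm_bdd[OF v f] by metis
  have "bdd_above ((\<lambda>(x, i). cmod (v x) * cmod (nth_deriv i f x)) ` (UNIV \<times> {0..m}))"
  proof (rule bdd_aboveI2, clarify)
    fix x i assume "i \<in> {0..m}"
    then have "cmod (v x) * cmod (nth_deriv i f x) \<le> cmod (v x) * jet m f x"
      by (intro mult_left_mono jet_ge) auto
    with C show "cmod (v x) * cmod (nth_deriv i f x) \<le> C" by (meson order_trans)
  qed
  from cSUP_upper[OF _ this, of "(x, i)"] i show ?thesis unfolding OM_norm_def by simp
qed

lemma OM_norm_le:
  assumes "\<And>x i. i \<le> m \<Longrightarrow> cmod (v x) * cmod (nth_deriv i f x) \<le> C"
  shows "OM_norm m v f \<le> C"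
  unfolding OM_norm_def using assms by (intro cSUP_least) auto

lemma OM_norm_le_jet:
  assumes "\<And>x. cmod (v x) * jet m f x \<le> C"
  shows "OM_norm m v f \<le> C"
proof (rule OM_norm_le)
  fix x i assume "i \<le> m"
  then have "cmod (v x) * cmod (nth_deriv i f x) \<le> cmod (v x) * jet m f x"
    by (intro mult_left_mono jet_ge) auto
  with assms show "cmod (v x) * cmod (nth_deriv i f x) \<le> C" by (meson order_trans)
qed

lemma jet_le_OM_norm:
  assumes v: "v \<in> schwartz_fun" and f: "f \<in> OM_fun"
  shows "cmod (v x) * jet m f x \<le> real (Suc m) * OM_norm m v f"
proof -
  have "cmod (v x) * jet m f x = (\<Sum>i\<le>m. cmod (v x) * cmod (nth_deriv i f x))"
    by (simp add: jet_def sum_distrib_left)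
  also have "\<dots> \<le> (\<Sum>i\<le>m. OM_norm m v f)" by (intro sum_mono OM_norm_ge v f) simp
  finally show ?thesis by simp
qed

text \<open>The reverse inequality is the given one for the scalar \<open>inverse c\<close>. A
  seminorm defined as a supremum yields the inequality directly, and this upgrades it to the
  equality asked for by \<open>sem_scale\<close>.\<close>

lemma homogeneous_if_subhomogeneous:
  fixes p :: "('x \<Rightarrow> complex) \<Rightarrow> real"
  assumes le: "\<And>c f. f \<in> X \<Longrightarrow> p (\<lambda>x. c * f x) \<le> cmod c * p f"
    and X: "\<And>c f. f \<in> X \<Longrightarrow> (\<lambda>x. c * f x) \<in> X"
    and nonneg: "\<And>f. f \<in> X \<Longrightarrow> 0 \<le> p f" and f: "f \<in> X"
  shows "p (\<lambda>x. c * f x) = cmod c * p f"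
proof (cases "c = 0")
  case True
  then show ?thesis using le[OF f, of 0] nonneg[OF X[OF f, of 0]] by simp
next
  case False
  have "p (\<lambda>x. inverse c * (c * f x)) \<le> cmod (inverse c) * p (\<lambda>x. c * f x)"
    by (rule le[OF X[OF f]])
  also have "(\<lambda>x. inverse c * (c * f x)) = f" using False by (simp add: fun_eq_iff)
  finally have "p f \<le> cmod (inverse c) * p (\<lambda>x. c * f x)" .
  then have "cmod c * p f \<le> cmod c * (cmod (inverse c) * p (\<lambda>x. c * f x))"
    by (rule mult_left_mono) simp
  also have "\<dots> = p (\<lambda>x. c * f x)"
    using False by (simp only: mult.assoc[symmetric] norm_mult[symmetric] right_inverse) simp
  finally have "cmod c * p f \<le> p (\<lambda>x. c * f x)" .
  with le[OF f, of c] show ?thesis by simp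
qed

interpretation S: fn_lcs schwartz_space
proof
  fix f g :: "real \<Rightarrow> complex" and c p
  show "f + g \<in> elems schwartz_space" if "f \<in> elems schwartz_space" "g \<in> elems schwartz_space"
    using that by (simp add: schwartz_space_def plus_fun_def schwartz_add)
  show "(\<lambda>x. c * f x) \<in> elems schwartz_space" if "f \<in> elems schwartz_space"
    using that by (simp add: schwartz_space_def schwartz_cmult)
  show "0 \<in> elems schwartz_space"
  proof -
    have z: "nth_deriv i 0 = 0" for i
      by (induction i) (simp_all add: nth_deriv_Suc zero_fun_def)
    then have "smooth 0" unfolding smooth_def by (simp add: zero_fun_def)
    moreover have "jet m 0 x = 0" for m x by (simp add: jet_def z)
    ultimately show ?thesis by (auto simp: schwartz_space_def schwartz_iff)
  qed
  show "seminorms schwartz_space \<noteq> {}" by (simp add: schwartz_space_def)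
  assume "p \<in> seminorms schwartz_space"
  then obtain n where p: "p = schwartz_norm n" by (auto simp: schwartz_space_def)
  show "p (f + g) \<le> p f + p g" if "f \<in> elems schwartz_space" "g \<in> elems schwartz_space"
  proof -
    have f: "f \<in> schwartz_fun" and g: "g \<in> schwartz_fun" using that by (auto simp: schwartz_space_def)
    show ?thesis unfolding p
    proof (rule schwartz_norm_le)
      fix x :: real and i assume i: "i \<le> n"
      have "(1 + x\<^sup>2) ^ n * cmod (nth_deriv i (f + g) x)
        \<le> (1 + x\<^sup>2) ^ n * (cmod (nth_deriv i f x) + cmod (nth_deriv i g x))"
        using f g by (auto simp: plus_fun_def nth_deriv_add schwartz_smooth intro!: mult_left_mono norm_triangle_ineq)
      also have "\<dots> \<le> schwartz_norm n f + schwartz_norm n g"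
        unfolding distrib_left by (intro add_mono schwartz_norm_ge f g i)
      finally show "(1 + x\<^sup>2) ^ n * cmod (nth_deriv i (f + g) x) \<le> schwartz_norm n f + schwartz_norm n g" .
    qed
  qed
  show "p (\<lambda>x. c * f x) = cmod c * p f" if "f \<in> elems schwartz_space"
  proof (rule homogeneous_if_subhomogeneous[where X = schwartz_fun])
    show "f \<in> schwartz_fun" using that by (simp add: schwartz_space_def)
    fix c and f :: "real \<Rightarrow> complex" assume f: "f \<in> schwartz_fun"
    show "(\<lambda>x. c * f x) \<in> schwartz_fun" by (rule schwartz_cmult[OF f])
    show "0 \<le> p f" unfolding p by (rule order_trans[OF _ schwartz_norm_ge[OF f, of 0 n 0]]) simp_all
    show "p (\<lambda>x. c * f x) \<le> cmod c * p f" unfolding p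
    proof (rule schwartz_norm_le)
      fix x :: real and i assume i: "i \<le> n"
      have "(1 + x\<^sup>2) ^ n * cmod (nth_deriv i (\<lambda>x. c * f x) x)
        = cmod c * ((1 + x\<^sup>2) ^ n * cmod (nth_deriv i f x))"
        using f by (simp add: nth_deriv_cmult schwartz_smooth norm_mult)
      also have "\<dots> \<le> cmod c * schwartz_norm n f"
        by (intro mult_left_mono schwartz_norm_ge f i) simp
      finally show "(1 + x\<^sup>2) ^ n * cmod (nth_deriv i (\<lambda>x. c * f x) x) \<le> cmod c * schwartz_norm n f" .
    qed
  qed
qed

lemma zero_schwartz: "(\<lambda>x. 0) \<in> schwartz_fun"
  using S.zero by (simp add: schwartz_space_def zero_fun_def)

interpretation OM: fn_lcs OM_space
proof
  fix f g :: "real \<Rightarrow> complex" and c p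
  show "f + g \<in> elems OM_space" if "f \<in> elems OM_space" "g \<in> elems OM_space"
    using that by (simp add: OM_space_def plus_fun_def OM_add)
  show "(\<lambda>x. c * f x) \<in> elems OM_space" if "f \<in> elems OM_space"
    using that by (simp add: OM_space_def OM_cmult)
  show "0 \<in> elems OM_space"
    using const_OM[of 0] by (simp add: OM_space_def zero_fun_def)
  show "seminorms OM_space \<noteq> {}" using zero_schwartz by (auto simp: OM_space_def)
  assume "p \<in> seminorms OM_space"
  then obtain m v where p: "p = OM_norm m v" and v: "v \<in> schwartz_fun" by (auto simp: OM_space_def)
  show "p (f + g) \<le> p f + p g" if "f \<in> elems OM_space" "g \<in> elems OM_space"
  proof -
    have f: "f \<in> OM_fun" and g: "g \<in> OM_fun" using that by (auto simp: OM_space_def)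
    show ?thesis unfolding p
    proof (rule OM_norm_le)
      fix x i assume i: "i \<le> m"
      have "cmod (v x) * cmod (nth_deriv i (f + g) x)
        \<le> cmod (v x) * (cmod (nth_deriv i f x) + cmod (nth_deriv i g x))"
        using f g by (auto simp: plus_fun_def nth_deriv_add OM_smooth intro!: mult_left_mono norm_triangle_ineq)
      also have "\<dots> \<le> OM_norm m v f + OM_norm m v g"
        unfolding distrib_left by (intro add_mono OM_norm_ge v f g i)
      finally show "cmod (v x) * cmod (nth_deriv i (f + g) x) \<le> OM_norm m v f + OM_norm m v g" .
    qed
  qed
  show "p (\<lambda>x. c * f x) = cmod c * p f" if "f \<in> elems OM_space"
  proof (rule homogeneous_if_subhomogeneous[where X = OM_fun])
    show "f \<in> OM_fun" using that by (simp add: OM_space_def)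
    fix c and f :: "real \<Rightarrow> complex" assume f: "f \<in> OM_fun"
    show "(\<lambda>x. c * f x) \<in> OM_fun" by (rule OM_cmult[OF f])
    show "0 \<le> p f" unfolding p by (rule order_trans[OF _ OM_norm_ge[OF v f, of 0 m 0]]) simp_all
    show "p (\<lambda>x. c * f x) \<le> cmod c * p f" unfolding p
    proof (rule OM_norm_le)
      fix x i assume i: "i \<le> m"
      have "cmod (v x) * cmod (nth_deriv i (\<lambda>x. c * f x) x)
        = cmod c * (cmod (v x) * cmod (nth_deriv i f x))"
        using f by (simp add: nth_deriv_cmult OM_smooth norm_mult)
      also have "\<dots> \<le> cmod c * OM_norm m v f"
        by (intro mult_left_mono OM_norm_ge v f i) simp
      finally show "cmod (v x) * cmod (nth_deriv i (\<lambda>x. c * f x) x) \<le> cmod c * OM_norm m v f" .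
    qed
  qed
qed

text \<open>Pointwise bounds for jets replace bounds for suprema, because \<open>jet_mult\<close>
  estimates products point by point; \<open>bounded_in_OM\<close> has the same purpose.\<close>

lemma bounded_in_schwartz:
  "bounded_in schwartz_space B \<longleftrightarrow>
    B \<subseteq> schwartz_fun \<and> (\<forall>m k. \<exists>C. \<forall>f\<in>B. \<forall>x. (1 + x\<^sup>2) ^ k * jet m f x \<le> C)"
proof (intro iffI conjI allI)
  assume B: "bounded_in schwartz_space B"
  then show S: "B \<subseteq> schwartz_fun" by (simp add: bounded_in_def schwartz_space_def)
  fix m k :: nat
  let ?n = "max m k"
  have "bdd_above (schwartz_norm ?n ` B)" using B by (simp add: bounded_in_def schwartz_space_def)
  then obtain C where C: "\<And>f. f \<in> B \<Longrightarrow> schwartz_norm ?n f \<le> C"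
    by (meson bdd_above.E image_eqI)
  have "(1 + x\<^sup>2) ^ k * jet m f x \<le> real (Suc ?n) * C" if f: "f \<in> B" for f x
  proof -
    have "(1 + x\<^sup>2) ^ k * jet m f x \<le> real (Suc ?n) * schwartz_norm ?n f"
      using S f by (intro jet_le_schwartz_norm) auto
    also have "\<dots> \<le> real (Suc ?n) * C" by (intro mult_left_mono C f) simp
    finally show ?thesis .
  qed
  then show "\<exists>C. \<forall>f\<in>B. \<forall>x. (1 + x\<^sup>2) ^ k * jet m f x \<le> C" by blast
next
  assume *: "B \<subseteq> schwartz_fun \<and> (\<forall>m k. \<exists>C. \<forall>f\<in>B. \<forall>x. (1 + x\<^sup>2) ^ k * jet m f x \<le> C)"
  show "bounded_in schwartz_space B"
    unfolding bounded_in_def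
  proof (intro conjI ballI)
    show "B \<subseteq> elems schwartz_space" using * by (simp add: schwartz_space_def)
    fix p assume "p \<in> seminorms schwartz_space"
    then obtain n where p: "p = schwartz_norm n" by (auto simp: schwartz_space_def)
    obtain C where "\<forall>f\<in>B. \<forall>x. (1 + x\<^sup>2) ^ n * jet n f x \<le> C" using * by meson
    then show "bdd_above (p ` B)"
      unfolding p by (intro bdd_aboveI2[where M = C] schwartz_norm_le_jet) blast
  qed
qed

lemma bounded_in_OM:
  "bounded_in OM_space B \<longleftrightarrow>
    B \<subseteq> OM_fun \<and> (\<forall>m. \<forall>v\<in>schwartz_fun. \<exists>C. \<forall>f\<in>B. \<forall>x. cmod (v x) * jet m f x \<le> C)"
proof (intro iffI conjI allI ballI)
  assume B: "bounded_in OM_space B"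
  then show S: "B \<subseteq> OM_fun" by (simp add: bounded_in_def OM_space_def)
  fix m v assume v: "v \<in> schwartz_fun"
  have "OM_norm m v \<in> seminorms OM_space" using v by (auto simp: OM_space_def)
  then have "bdd_above (OM_norm m v ` B)" using B by (simp add: bounded_in_def)
  then obtain C where C: "\<And>f. f \<in> B \<Longrightarrow> OM_norm m v f \<le> C"
    by (meson bdd_above.E image_eqI)
  have "cmod (v x) * jet m f x \<le> real (Suc m) * C" if f: "f \<in> B" for f x
  proof -
    have "cmod (v x) * jet m f x \<le> real (Suc m) * OM_norm m v f"
      using S f v by (intro jet_le_OM_norm) auto
    also have "\<dots> \<le> real (Suc m) * C" by (intro mult_left_mono C f) simp
    finally show ?thesis .
  qed
  then show "\<exists>C. \<forall>f\<in>B. \<forall>x. cmod (v x) * jet m f x \<le> C" by blast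
next
  assume *: "B \<subseteq> OM_fun \<and> (\<forall>m. \<forall>v\<in>schwartz_fun. \<exists>C. \<forall>f\<in>B. \<forall>x. cmod (v x) * jet m f x \<le> C)"
  show "bounded_in OM_space B"
    unfolding bounded_in_def
  proof (intro conjI ballI)
    show "B \<subseteq> elems OM_space" using * by (simp add: OM_space_def)
    fix p assume "p \<in> seminorms OM_space"
    then obtain m v where p: "p = OM_norm m v" and v: "v \<in> schwartz_fun" by (auto simp: OM_space_def)
    obtain C where "\<forall>f\<in>B. \<forall>x. cmod (v x) * jet m f x \<le> C" using * v by meson
    then show "bdd_above (p ` B)"
      unfolding p by (intro bdd_aboveI2[where M = C] OM_norm_le_jet) blast
  qed
qed

section \<open>Schwartz functions dominating rapidly decreasing ones\<close>

lemma bex_vector_derivativeI: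
  "(\<And>x. (f has_vector_derivative f' x) (at x)) \<Longrightarrow> f' \<in> X
    \<Longrightarrow> \<exists>f'\<in>X. \<forall>x. (f has_vector_derivative f' x) (at x)"
  by (rule bexI[of _ f']) auto

locale superdecreasing =
  fixes c :: "nat \<Rightarrow> real"
  assumes c_pos: "0 < c n" and c_Suc: "real (Suc n) * c (Suc n) \<le> c n"
begin

text \<open>\<open>diffs\<close> passes to the coefficients of the differentiated power series. The
  axiom \<open>c_Suc\<close> says \<open>diffs c n \<le> c n\<close>, and \<open>diffs\<close> is
  monotone on sequences, so the bound survives iteration.\<close>

lemma diffs_bounds: "0 \<le> (diffs ^^ i) c n" "(diffs ^^ i) c n \<le> c n"
proof -
  have "0 \<le> (diffs ^^ i) c n \<and> (diffs ^^ i) c n \<le> c n"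
  proof (induction i arbitrary: n)
    case 0
    then show ?case using c_pos[of n] by simp
  next
    case (Suc i)
    have eq: "(diffs ^^ Suc i) c n = real (Suc n) * (diffs ^^ i) c (Suc n)"
      by (simp add: diffs_def)
    have "real (Suc n) * (diffs ^^ i) c (Suc n) \<le> real (Suc n) * c (Suc n)"
      using Suc[of "Suc n"] by (intro mult_left_mono) simp_all
    then have "real (Suc n) * (diffs ^^ i) c (Suc n) \<le> c n"
      using c_Suc[of n] by linarith
    moreover have "0 \<le> real (Suc n) * (diffs ^^ i) c (Suc n)"
      using Suc[of "Suc n"] by (intro mult_nonneg_nonneg) simp_all
    ultimately show ?case unfolding eq by blast
  qed
  then show "0 \<le> (diffs ^^ i) c n" "(diffs ^^ i) c n \<le> c n" by auto
qed

lemma c_le: "c n \<le> c 0 * inverse (fact n)"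
proof (induction n)
  case (Suc n)
  have "real (Suc n) * c (Suc n) \<le> c 0 * inverse (fact n)" using c_Suc[of n] Suc by linarith
  then have "c (Suc n) \<le> c 0 * inverse (fact n) / real (Suc n)"
    by (simp add: pos_le_divide_eq mult.commute del: of_nat_Suc)
  then show ?case by (simp add: field_simps)
qed simp

lemma summable_diffs: "summable (\<lambda>n. (diffs ^^ i) c n * y ^ n)"
proof (rule summable_comparison_test)
  show "summable (\<lambda>n. c 0 * (inverse (fact n) * \<bar>y\<bar> ^ n))"
    by (intro summable_mult summable_exp)
  have "norm ((diffs ^^ i) c n * y ^ n) \<le> c 0 * (inverse (fact n) * \<bar>y\<bar> ^ n)" for n
  proof -
    have "norm ((diffs ^^ i) c n * y ^ n) = (diffs ^^ i) c n * \<bar>y\<bar> ^ n"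
      using diffs_bounds(1)[of i n] by (simp add: abs_mult power_abs)
    also have "\<dots> \<le> c 0 * inverse (fact n) * \<bar>y\<bar> ^ n"
      using diffs_bounds(2)[of i n] c_le[of n] by (intro mult_right_mono) auto
    finally show ?thesis by (simp add: mult.assoc)
  qed
  then show "\<exists>N. \<forall>n\<ge>N. norm ((diffs ^^ i) c n * y ^ n) \<le> c 0 * (inverse (fact n) * \<bar>y\<bar> ^ n)" by blast
qed

definition F :: "nat \<Rightarrow> real \<Rightarrow> real" where
  "F i y = (\<Sum>n. (diffs ^^ i) c n * y ^ n)"

lemma F_deriv: "(F i has_real_derivative F (Suc i) y) (at y)"
  using termdiffs_strong_converges_everywhere[OF summable_diffs, of i y]
  by (simp add: F_def[abs_def])

lemma F_nonneg: "0 \<le> y \<Longrightarrow> 0 \<le> F i y"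
  unfolding F_def by (intro suminf_nonneg summable_diffs) (simp add: diffs_bounds)

lemma F_le: "0 \<le> y \<Longrightarrow> F i y \<le> F 0 y"
  unfolding F_def
  by (intro suminf_le summable_diffs) (simp_all add: diffs_bounds mult_right_mono)

lemma F_ge_term: "0 \<le> y \<Longrightarrow> c n * y ^ n \<le> F 0 y"
  using sum_le_suminf[OF summable_diffs[of 0 y], of "{n}"] c_pos
  by (auto simp: F_def less_imp_le)

lemma F_pos: "0 \<le> y \<Longrightarrow> 0 < F 0 y"
  using F_ge_term[of y 0] c_pos[of 0] by simp

definition V :: "real \<Rightarrow> real" where "V x = 1 / F 0 (1 + x\<^sup>2)"

text \<open>These quotients appear when \<open>V\<close> is differentiated. On the half line they
  lie between 0 and 1 by \<open>F_le\<close>, so differentiating costs only polynomial factors in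
  \<open>x\<close>.\<close>

definition R :: "nat \<Rightarrow> real \<Rightarrow> real" where "R i x = F i (1 + x\<^sup>2) / F 0 (1 + x\<^sup>2)"

lemma weight_nonneg: "0 \<le> 1 + x\<^sup>2" for x :: real
  by simp

lemma F_weight_deriv: "((\<lambda>x. F i (1 + x\<^sup>2)) has_real_derivative F (Suc i) (1 + x\<^sup>2) * (2 * x)) (at x)"
  by (rule DERIV_chain2[OF F_deriv]) (auto intro!: derivative_eq_intros)

lemma V_pos: "0 < V x"
  unfolding V_def using F_pos[OF weight_nonneg] by simp

lemma R_bounds: "0 \<le> R i x" "R i x \<le> 1"
  unfolding R_def using F_pos[OF weight_nonneg, of x] F_nonneg[OF weight_nonneg, of i x] F_le[OF weight_nonneg, of i x]
  by auto

lemma V_deriv: "(V has_real_derivative - 2 * x * R 1 x * V x) (at x)"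
proof -
  have "F 0 (1 + x\<^sup>2) \<noteq> 0" using F_pos[OF weight_nonneg, of x] by simp
  from DERIV_inverse_fun[OF F_weight_deriv this]
  show ?thesis by (simp add: V_def[abs_def] R_def divide_inverse power2_eq_square mult_ac)
qed

lemma R_deriv: "(R i has_real_derivative 2 * x * (R (Suc i) x - R i x * R 1 x)) (at x)"
proof -
  have nz: "F 0 (1 + x\<^sup>2) \<noteq> 0" using F_pos[OF weight_nonneg, of x] by simp
  have "2 * x * (R (Suc i) x - R i x * R 1 x) =
    (F (Suc i) (1 + x\<^sup>2) * (2 * x) * F 0 (1 + x\<^sup>2) - F i (1 + x\<^sup>2) * (F (Suc 0) (1 + x\<^sup>2) * (2 * x)))
      / (F 0 (1 + x\<^sup>2) * F 0 (1 + x\<^sup>2))"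
    using nz by (simp add: R_def field_simps)
  with DERIV_divide[OF F_weight_deriv F_weight_deriv nz, of i] show ?thesis
    by (simp add: R_def[abs_def])
qed

text \<open>The span of \<open>V\<close> times monomials in \<open>x\<close> and the
  \<open>R i\<close>. It is closed under differentiation because
  \<open>V' = - 2 x R\<^sub>1 V\<close> and \<open>R\<^sub>i' = 2 x (R\<^sub>i\<^sub>+\<^sub>1 -
  R\<^sub>i R\<^sub>1)\<close>.\<close>

inductive_set K :: "(real \<Rightarrow> complex) set" where
  base: "(\<lambda>x. of_real (V x)) \<in> K"
| var: "f \<in> K \<Longrightarrow> (\<lambda>x. of_real x * f x) \<in> K"
| quot: "f \<in> K \<Longrightarrow> (\<lambda>x. of_real (R i x) * f x) \<in> K"
| sum: "f \<in> K \<Longrightarrow> g \<in> K \<Longrightarrow> (\<lambda>x. f x + g x) \<in> K"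
| scale: "f \<in> K \<Longrightarrow> (\<lambda>x. a * f x) \<in> K"

lemma K_deriv: "f \<in> K \<Longrightarrow> \<exists>f'\<in>K. \<forall>x. (f has_vector_derivative f' x) (at x)"
proof (induction rule: K.induct)
  case base
  let ?d = "\<lambda>x. (-2) * (of_real x * (of_real (R 1 x) * of_real (V x)))"
  have "((\<lambda>x. complex_of_real (V x)) has_vector_derivative ?d x) (at x)" for x
    using has_vector_derivative_of_real[OF V_deriv[of x], where ?'a = complex]
    by (simp add: mult_ac)
  moreover have "?d \<in> K" by (intro K.scale K.var K.quot K.base)
  ultimately show ?case by (rule bex_vector_derivativeI)
next
  case (var f)
  then obtain f' where f: "f' \<in> K" "\<And>x. (f has_vector_derivative f' x) (at x)" by blast
  have "((\<lambda>x. of_real x * f x) has_vector_derivative of_real x * f' x + 1 * f x) (at x)" for x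
    by (rule has_vector_derivative_mult[OF _ f(2)])
      (use has_vector_derivative_of_real[OF DERIV_ident, where ?'a = complex] in simp)
  moreover have "(\<lambda>x. of_real x * f' x + 1 * f x) \<in> K" by (intro K.sum K.scale K.var f var)
  ultimately show ?case by (rule bex_vector_derivativeI)
next
  case (quot f i)
  then obtain f' where f: "f' \<in> K" "\<And>x. (f has_vector_derivative f' x) (at x)" by blast
  let ?r = "\<lambda>x. of_real (R i x) * f' x + (2 * (of_real x * (of_real (R (Suc i) x) * f x))
    + (-2) * (of_real x * (of_real (R i x) * (of_real (R 1 x) * f x))))"
  have "((\<lambda>x. of_real (R i x) * f x) has_vector_derivative ?r x) (at x)" for x
  proof -
    have "((\<lambda>x. complex_of_real (R i x)) has_vector_derivative of_real (2 * x * (R (Suc i) x - R i x * R 1 x))) (at x)"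
      by (rule has_vector_derivative_of_real[OF R_deriv])
    from has_vector_derivative_mult[OF this f(2)] show ?thesis by (simp add: algebra_simps)
  qed
  moreover have "?r \<in> K" by (intro K.sum K.scale K.quot K.var f quot)
  ultimately show ?case by (rule bex_vector_derivativeI)
next
  case (sum f g)
  then obtain f' g' where *: "f' \<in> K" "g' \<in> K"
    "\<And>x. (f has_vector_derivative f' x) (at x)" "\<And>x. (g has_vector_derivative g' x) (at x)" by blast
  have "((\<lambda>x. f x + g x) has_vector_derivative f' x + g' x) (at x)" for x
    by (intro derivative_intros *)
  moreover have "(\<lambda>x. f' x + g' x) \<in> K" by (intro K.sum *)
  ultimately show ?case by (rule bex_vector_derivativeI)
next
  case (scale f a)
  then obtain f' where *: "f' \<in> K" "\<And>x. (f has_vector_derivative f' x) (at x)" by blast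
  have "((\<lambda>x. a * f x) has_vector_derivative a * f' x) (at x)" for x
    by (intro has_vector_derivative_mult_right *)
  moreover have "(\<lambda>x. a * f' x) \<in> K" by (intro K.scale *)
  ultimately show ?case by (rule bex_vector_derivativeI)
qed

lemma K_bound: "f \<in> K \<Longrightarrow> \<exists>k C. 0 \<le> C \<and> (\<forall>x. cmod (f x) \<le> C * (1 + x\<^sup>2) ^ k * V x)"
proof (induction rule: K.induct)
  case base
  show ?case using V_pos by (intro exI[of _ 0] exI[of _ 1]) (simp add: less_imp_le)
next
  case (var f)
  then obtain k C where C: "0 \<le> C" "\<And>x. cmod (f x) \<le> C * (1 + x\<^sup>2) ^ k * V x" by blast
  have "cmod (of_real x * f x) \<le> C * (1 + x\<^sup>2) ^ Suc k * V x" for x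
  proof -
    have "\<bar>x\<bar> \<le> 1 + x\<^sup>2"
      using zero_le_power2[of "\<bar>x\<bar> - 1"] by (simp add: power2_diff)
    then have "\<bar>x\<bar> * cmod (f x) \<le> (1 + x\<^sup>2) * (C * (1 + x\<^sup>2) ^ k * V x)"
      by (intro mult_mono C) auto
    then show ?thesis by (simp add: norm_mult mult_ac)
  qed
  with C(1) show ?case by blast
next
  case (quot f i)
  then obtain k C where C: "0 \<le> C" "\<And>x. cmod (f x) \<le> C * (1 + x\<^sup>2) ^ k * V x" by blast
  have "cmod (of_real (R i x) * f x) \<le> C * (1 + x\<^sup>2) ^ k * V x" for x
  proof -
    have "\<bar>R i x\<bar> * cmod (f x) \<le> 1 * (C * (1 + x\<^sup>2) ^ k * V x)"
      using R_bounds[of i x] by (intro mult_mono C) auto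
    then show ?thesis by (simp add: norm_mult)
  qed
  with C(1) show ?case by blast
next
  case (sum f g)
  then obtain k C l D where *: "0 \<le> C" "\<And>x. cmod (f x) \<le> C * (1 + x\<^sup>2) ^ k * V x"
    "0 \<le> D" "\<And>x. cmod (g x) \<le> D * (1 + x\<^sup>2) ^ l * V x" by blast
  have "cmod (f x + g x) \<le> (C + D) * (1 + x\<^sup>2) ^ (k + l) * V x" for x
  proof -
    have "cmod (f x + g x) \<le> C * (1 + x\<^sup>2) ^ k * V x + D * (1 + x\<^sup>2) ^ l * V x"
      using norm_triangle_ineq[of "f x" "g x"] *(2,4)[of x] by linarith
    also have "\<dots> \<le> C * (1 + x\<^sup>2) ^ (k + l) * V x + D * (1 + x\<^sup>2) ^ (k + l) * V x"
      using V_pos[of x] * by (intro add_mono mult_left_mono mult_right_mono weight_mono) auto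
    finally show ?thesis by (simp add: algebra_simps)
  qed
  with * show ?case by (intro exI[of _ "k + l"] exI[of _ "C + D"]) simp
next
  case (scale f a)
  then obtain k C where C: "0 \<le> C" "\<And>x. cmod (f x) \<le> C * (1 + x\<^sup>2) ^ k * V x" by blast
  have "cmod (a * f x) \<le> (cmod a * C) * (1 + x\<^sup>2) ^ k * V x" for x
    using mult_left_mono[OF C(2)[of x], of "cmod a"] by (simp add: norm_mult mult_ac)
  with C(1) show ?case by (intro exI[of _ k] exI[of _ "cmod a * C"]) simp
qed

text \<open>A series with nonnegative terms is at least its term of index \<open>k\<close>;
  positivity of every coefficient thus beats every power of the weight.\<close>

lemma V_decay: "(1 + x\<^sup>2) ^ k * V x \<le> 1 / c k"
proof -
  have "c k * (1 + x\<^sup>2) ^ k \<le> F 0 (1 + x\<^sup>2)" by (rule F_ge_term) simp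
  then show ?thesis
    using F_pos[OF weight_nonneg, of x] c_pos[of k] by (simp add: V_def field_simps)
qed

lemma V_schwartz: "(\<lambda>x. of_real (V x)) \<in> schwartz_fun"
  unfolding schwartz_iff
proof (intro conjI allI)
  let ?f = "\<lambda>x. complex_of_real (V x)"
  show "smooth ?f" by (rule smooth_class(2)[OF K_deriv K.base])
  fix m k
  have "\<exists>C. \<forall>x. (1 + x\<^sup>2) ^ k * cmod (nth_deriv i ?f x) \<le> C" for i
  proof -
    have "nth_deriv i ?f \<in> K" by (rule smooth_class(1)[OF K_deriv K.base])
    from K_bound[OF this] obtain l C
      where C: "0 \<le> C" "\<And>x. cmod (nth_deriv i ?f x) \<le> C * (1 + x\<^sup>2) ^ l * V x" by blast
    have "(1 + x\<^sup>2) ^ k * cmod (nth_deriv i ?f x) \<le> C * (1 / c (k + l))" for x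
    proof -
      have "(1 + x\<^sup>2) ^ k * cmod (nth_deriv i ?f x) \<le> (1 + x\<^sup>2) ^ k * (C * (1 + x\<^sup>2) ^ l * V x)"
        by (intro mult_left_mono C) simp
      also have "\<dots> = C * ((1 + x\<^sup>2) ^ (k + l) * V x)" by (simp add: power_add mult_ac)
      also have "\<dots> \<le> C * (1 / c (k + l))" by (intro mult_left_mono V_decay C)
      finally show ?thesis .
    qed
    then show ?thesis by blast
  qed
  then obtain C where C: "\<And>i x. (1 + x\<^sup>2) ^ k * cmod (nth_deriv i ?f x) \<le> C i" by metis
  have "(1 + x\<^sup>2) ^ k * jet m ?f x \<le> (\<Sum>i\<le>m. C i)" for x
    unfolding jet_def sum_distrib_left by (intro sum_mono C)
  then show "\<exists>C. \<forall>x. (1 + x\<^sup>2) ^ k * jet m ?f x \<le> C" by blast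
qed

end

text \<open>The dominating function is the reciprocal of the series of \<open>c\<^sub>k (1 + x\<^sup>2)\<^sup>k\<close>;
  coefficients with \<open>(k + 1) c\<^sub>k\<^sub>+\<^sub>1 \<le> c\<^sub>k\<close> make all derivatives of the series bounded by the series itself.\<close>
lemma schwartz_dominating:
  fixes \<Phi> :: "(real \<Rightarrow> real) set"
  assumes "\<And>k. \<exists>C. \<forall>\<phi>\<in>\<Phi>. \<forall>x. (1 + x\<^sup>2) ^ k * \<phi> x \<le> C"
  shows "\<exists>v\<in>schwartz_fun. (\<forall>x. v x \<noteq> 0) \<and> (\<forall>\<phi>\<in>\<Phi>. \<forall>x. \<phi> x \<le> cmod (v x))"
proof -
  obtain C where C: "\<And>k \<phi> x. \<phi> \<in> \<Phi> \<Longrightarrow> (1 + x\<^sup>2) ^ k * \<phi> x \<le> C k" using assms by metis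
  define M where "M = (\<lambda>k. max 1 (C k))"
  have M: "1 \<le> M k" "C k \<le> M k" for k by (auto simp: M_def)
  \<comment> \<open>The factorial produces \<open>c_Suc\<close>, and the power of 2 makes the series
    in the final estimate sum to 1. The whole product of the \<open>M j\<close>, each at least 1, is
    divided out instead of \<open>M k\<close> alone, so that \<open>c_Suc\<close> holds without
    monotonicity of \<open>M\<close>.\<close>
  define c where "c = (\<lambda>k. 1 / (fact k * 2 ^ Suc k * (\<Prod>j\<le>k. M j)))"
  have P: "0 < (\<Prod>j\<le>k. M j)" for k
    using M(1) by (intro prod_pos) (auto intro: less_le_trans[OF zero_less_one])
  have c_pos: "0 < c k" for k using P[of k] by (simp add: c_def)
  have c_half: "c k * M k \<le> (1 / 2) ^ Suc k" for k
  proof -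
    have "(\<Prod>j\<le>k. M j) = (\<Prod>j<k. M j) * M k" by (metis lessThan_Suc_atMost prod.lessThan_Suc)
    moreover have "1 \<le> (\<Prod>j<k. M j)" by (intro prod_ge_1 M)
    moreover have "0 < M k" using M(1)[of k] by linarith
    ultimately have "c k * M k = 1 / (fact k * (\<Prod>j<k. M j)) * (1 / 2) ^ Suc k"
      by (simp add: c_def field_simps)
    also have "\<dots> \<le> 1 * (1 / 2) ^ Suc k"
    proof (rule mult_right_mono)
      have "1 * 1 \<le> fact k * (\<Prod>j<k. M j)"
        using \<open>1 \<le> (\<Prod>j<k. M j)\<close> by (intro mult_mono) auto
      then show "1 / (fact k * (\<Prod>j<k. M j)) \<le> 1" by simp
    qed simp
    finally show ?thesis by simp
  qed
  interpret superdecreasing c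
  proof
    fix n show "0 < c n" by (rule c_pos)
    have "real (Suc n) * c (Suc n) = c n * (1 / (2 * M (Suc n)))"
      using M(1)[of "Suc n"] P[of n] by (simp add: c_def divide_simps del: of_nat_Suc)
    also have "\<dots> \<le> c n * 1"
      using M(1)[of "Suc n"] c_pos[of n] by (intro mult_left_mono) (auto simp: divide_simps)
    finally show "real (Suc n) * c (Suc n) \<le> c n" by simp
  qed
  show ?thesis
  proof (intro bexI[of _ "\<lambda>x. complex_of_real (V x)"] conjI allI ballI)
    show "(\<lambda>x. complex_of_real (V x)) \<in> schwartz_fun" by (rule V_schwartz)
    show "complex_of_real (V x) \<noteq> 0" for x using V_pos[of x] by simp
    fix \<phi> x assume \<phi>: "\<phi> \<in> \<Phi>"
    \<comment> \<open>Domination is checked after multiplication by the denominator of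
      \<open>V\<close>: the term of index \<open>n\<close> is at most \<open>c n * M n\<close>, and
      these numbers add up to at most 1.\<close>
    have "F 0 (1 + x\<^sup>2) * \<phi> x = (\<Sum>n. c n * (1 + x\<^sup>2) ^ n * \<phi> x)"
      unfolding F_def using summable_diffs[of 0 "1 + x\<^sup>2"] by (simp add: suminf_mult2)
    also have "\<dots> \<le> (\<Sum>n. (1 / 2) ^ Suc n)"
    proof (rule suminf_le)
      show "c n * (1 + x\<^sup>2) ^ n * \<phi> x \<le> (1 / 2) ^ Suc n" for n
      proof -
        have "c n * ((1 + x\<^sup>2) ^ n * \<phi> x) \<le> c n * M n"
          using C[OF \<phi>, of x n] M(2)[of n] c_pos[of n] by (intro mult_left_mono) auto
        with c_half[of n] show ?thesis by (simp add: mult.assoc)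
      qed
      show "summable (\<lambda>n. c n * (1 + x\<^sup>2) ^ n * \<phi> x)"
        using summable_mult2[OF summable_diffs[of 0 "1 + x\<^sup>2"], of "\<phi> x"] by simp
      show "summable (\<lambda>n. (1 / 2 :: real) ^ Suc n)"
        using power_half_series by (rule sums_summable)
    qed
    also have "\<dots> = 1" using power_half_series by (rule sums_unique[symmetric])
    finally have "\<phi> x \<le> V x"
      using F_pos[OF weight_nonneg, of x] by (simp add: V_def field_simps)
    then show "\<phi> x \<le> cmod (complex_of_real (V x))" using V_pos[of x] by simp
  qed
qed

section \<open>Products of bounded sets and uniform boundedness\<close>

text \<open>The weighted jets of all members of \<open>B\<close> decrease rapidly in a uniform way,
  hence one Schwartz function \<open>v\<close> majorizes them. The product is then controlled by
  testing \<open>W\<close> with the single weight \<open>v\<close>.\<close>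

lemma bounded_OM_mult_schwartz:
  assumes W: "bounded_in OM_space W" and B: "bounded_in schwartz_space B"
  shows "bounded_in schwartz_space ((\<lambda>(a, f) x. a x * f x) ` (W \<times> B))"
  unfolding bounded_in_schwartz
proof (intro conjI allI)
  have WO: "W \<subseteq> OM_fun" and BS: "B \<subseteq> schwartz_fun"
    using W B unfolding bounded_in_OM bounded_in_schwartz by auto
  show "(\<lambda>(a, f) x. a x * f x) ` (W \<times> B) \<subseteq> schwartz_fun"
    using WO BS by (auto intro!: schwartz_mult)
  fix m k
  let ?\<Phi> = "(\<lambda>f x. (1 + x\<^sup>2) ^ k * jet m f x) ` B"
  have "\<exists>C. \<forall>\<phi>\<in>?\<Phi>. \<forall>x. (1 + x\<^sup>2) ^ l * \<phi> x \<le> C" for l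
  proof -
    obtain C where "\<forall>f\<in>B. \<forall>x. (1 + x\<^sup>2) ^ (l + k) * jet m f x \<le> C"
      using B unfolding bounded_in_schwartz by meson
    then show ?thesis by (intro exI[of _ C]) (simp add: power_add mult.assoc)
  qed
  from schwartz_dominating[OF this] obtain v
    where v: "v \<in> schwartz_fun" "\<forall>\<phi>\<in>?\<Phi>. \<forall>x. \<phi> x \<le> cmod (v x)" by blast
  obtain C where C: "\<And>a x. a \<in> W \<Longrightarrow> cmod (v x) * jet m a x \<le> C"
    using W v(1) unfolding bounded_in_OM by meson
  have "(1 + x\<^sup>2) ^ k * jet m (\<lambda>x. a x * f x) x \<le> 3 ^ m * C" if a: "a \<in> W" and f: "f \<in> B" for a f x
  proof -
    have "jet m (\<lambda>x. a x * f x) x \<le> 3 ^ m * (jet m a x * jet m f x)"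
      using a f WO BS by (intro jet_mult OM_smooth schwartz_smooth) auto
    then have "(1 + x\<^sup>2) ^ k * jet m (\<lambda>x. a x * f x) x \<le> (1 + x\<^sup>2) ^ k * (3 ^ m * (jet m a x * jet m f x))"
      by (rule mult_left_mono) simp
    also have "\<dots> = 3 ^ m * (((1 + x\<^sup>2) ^ k * jet m f x) * jet m a x)" by (simp add: mult_ac)
    also have "\<dots> \<le> 3 ^ m * (cmod (v x) * jet m a x)"
      using v(2) f by (intro mult_left_mono mult_right_mono) auto
    also have "\<dots> \<le> 3 ^ m * C" by (intro mult_left_mono C a) simp
    finally show ?thesis .
  qed
  then show "\<exists>C. \<forall>g\<in>(\<lambda>(a, f) x. a x * f x) ` (W \<times> B). \<forall>x. (1 + x\<^sup>2) ^ k * jet m g x \<le> C"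
    by (intro exI[of _ "3 ^ m * C"]) auto
qed

lemma bounded_OM_mult_OM:
  assumes W: "bounded_in OM_space W" and B: "bounded_in OM_space B"
  shows "bounded_in OM_space ((\<lambda>(a, f) x. a x * f x) ` (W \<times> B))"
  unfolding bounded_in_OM
proof (intro conjI allI ballI)
  have WO: "W \<subseteq> OM_fun" and BO: "B \<subseteq> OM_fun"
    using W B unfolding bounded_in_OM by auto
  show "(\<lambda>(a, f) x. a x * f x) ` (W \<times> B) \<subseteq> OM_fun"
    using WO BO by (auto intro!: OM_mult)
  fix m v assume v: "v \<in> schwartz_fun"
  let ?\<Phi> = "(\<lambda>f x. cmod (v x) * jet m f x) ` B"
  have "\<exists>C. \<forall>\<phi>\<in>?\<Phi>. \<forall>x. (1 + x\<^sup>2) ^ l * \<phi> x \<le> C" for l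
  proof -
    \<comment> \<open>Multiplied by powers of \<open>1 + x\<^sup>2\<close>, \<open>v\<close> is
      still an admissible weight for \<open>B\<close>; so the weighted jets of \<open>B\<close>
      decrease rapidly and are majorized by a new Schwartz weight \<open>w\<close>.\<close>
    have "(\<lambda>x. of_real ((1 + x\<^sup>2) ^ l) * v x) \<in> schwartz_fun" by (rule schwartz_mult[OF weight_OM v])
    then obtain C where C: "\<forall>f\<in>B. \<forall>x. cmod (of_real ((1 + x\<^sup>2) ^ l) * v x) * jet m f x \<le> C"
      using B unfolding bounded_in_OM by meson
    have n: "cmod (of_real ((1 + x\<^sup>2) ^ l) * v x) = (1 + x\<^sup>2) ^ l * cmod (v x)" for x
      by (simp only: norm_mult norm_of_real abs_of_pos[OF weight_pos])
    from C show ?thesis unfolding n by (intro exI[of _ C]) (simp add: mult.assoc)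
  qed
  from schwartz_dominating[OF this] obtain w
    where w: "w \<in> schwartz_fun" "\<forall>\<phi>\<in>?\<Phi>. \<forall>x. \<phi> x \<le> cmod (w x)" by blast
  obtain C where C: "\<And>a x. a \<in> W \<Longrightarrow> cmod (w x) * jet m a x \<le> C"
    using W w(1) unfolding bounded_in_OM by meson
  have "cmod (v x) * jet m (\<lambda>x. a x * f x) x \<le> 3 ^ m * C" if a: "a \<in> W" and f: "f \<in> B" for a f x
  proof -
    have "jet m (\<lambda>x. a x * f x) x \<le> 3 ^ m * (jet m a x * jet m f x)"
      using a f WO BO by (intro jet_mult OM_smooth) auto
    then have "cmod (v x) * jet m (\<lambda>x. a x * f x) x \<le> cmod (v x) * (3 ^ m * (jet m a x * jet m f x))"
      by (rule mult_left_mono) simp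
    also have "\<dots> = 3 ^ m * ((cmod (v x) * jet m f x) * jet m a x)" by (simp add: mult_ac)
    also have "\<dots> \<le> 3 ^ m * (cmod (w x) * jet m a x)"
      using w(2) f by (intro mult_left_mono mult_right_mono) auto
    also have "\<dots> \<le> 3 ^ m * C" by (intro mult_left_mono C a) simp
    finally show ?thesis .
  qed
  then show "\<exists>C. \<forall>g\<in>(\<lambda>(a, f) x. a x * f x) ` (W \<times> B). \<forall>x. cmod (v x) * jet m g x \<le> C"
    by (intro exI[of _ "3 ^ m * C"]) auto
qed

text \<open>Majorizing the empty family already yields such a function. It is used to turn weighted
  bounds into local ones and, by division, convergence of products into convergence of a
  factor.\<close>

lemma nonvanishing_schwartz: "\<exists>v\<in>schwartz_fun. \<forall>x. v x \<noteq> 0"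
  using schwartz_dominating[of "{}"] by auto

text \<open>Uniform boundedness by a gliding hump; \<open>\<phi> j\<close> below is the j-th partial sum of the
  series whose signs are chosen so that it is large at the j-th term.\<close>
lemma uniform_boundedness_series:
  fixes A :: "nat \<Rightarrow> 's \<Rightarrow> complex"
  assumes bdd: "\<And>n. \<exists>K. \<forall>s\<in>I. cmod (A n s) \<le> K" and I: "I \<noteq> {}"
    and ser: "\<And>s c. range s \<subseteq> I \<Longrightarrow> (\<And>j. \<bar>c j\<bar> = (1 / 3) ^ j) \<Longrightarrow>
       \<exists>K. \<forall>n. cmod (\<Sum>j. of_real (c j) * A n (s j)) \<le> K"
  shows "\<exists>K. \<forall>n. \<forall>s\<in>I. cmod (A n s) \<le> K"
proof (rule ccontr)
  assume unb: "\<not> ?thesis"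
  define N where "N = (\<lambda>n. SUP s\<in>I. cmod (A n s))"
  have bd: "bdd_above ((\<lambda>s. cmod (A n s)) ` I)" for n
    using bdd[of n] by (auto simp: bdd_above_def)
  have N_ge: "cmod (A n s) \<le> N n" if "s \<in> I" for n s
    unfolding N_def using that bd by (rule cSUP_upper)
  have "\<exists>n. 4 ^ j < N n" for j :: nat
  proof (rule ccontr)
    assume "\<nexists>n. 4 ^ j < N n"
    then have "cmod (A n s) \<le> 4 ^ j" if "s \<in> I" for n s
      using order_trans[OF N_ge[OF that, of n], of "4 ^ j"] by (simp add: not_less)
    then show False using unb by blast
  qed
  then obtain n where n: "\<And>j. 4 ^ j < N (n j)" by metis
  have "\<exists>s\<in>I. 3 / 4 * N (n j) < cmod (A (n j) s)" for j
  proof -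
    have "0 < N (n j)" by (rule less_trans[OF _ n]) simp
    then have "3 / 4 * N (n j) < N (n j)" by simp
    then show ?thesis unfolding N_def less_cSUP_iff[OF I bd] .
  qed
  then obtain s where s: "\<And>j. s j \<in> I" "\<And>j. 3 / 4 * N (n j) < cmod (A (n j) (s j))" by metis
  \<comment> \<open>A stage carries the partial sums for all indices \<open>i\<close> at once, but
    its sign is chosen by looking at \<open>n j\<close> only. The two candidates differ by twice the
    new term, so one of them has at least the modulus of that term.\<close>
  define step where "step = (\<lambda>j (\<phi> :: nat \<Rightarrow> complex) (e::real). \<lambda>i. \<phi> i + of_real (e * (1 / 3) ^ j) * A i (s j))"
  define sgn where "sgn = (\<lambda>j \<phi>. if 3 / 4 * (1 / 3) ^ j * N (n j) \<le> cmod (step j \<phi> 1 (n j)) then 1 else (-1::real))"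
  define \<phi> where "\<phi> = rec_nat (\<lambda>i. 0) (\<lambda>j \<phi>. step j \<phi> (sgn j \<phi>))"
  have \<phi>_Suc: "\<phi> (Suc j) = step j (\<phi> j) (sgn j (\<phi> j))" and \<phi>_0: "\<phi> 0 = (\<lambda>i. 0)" for j
    by (simp_all add: \<phi>_def)
  define c where "c = (\<lambda>j. sgn j (\<phi> j) * (1 / 3) ^ j)"
  have c: "\<bar>c j\<bar> = (1 / 3) ^ j" for j by (simp add: c_def sgn_def abs_mult)
  have \<phi>_sum: "\<phi> j i = (\<Sum>l<j. of_real (c l) * A i (s l))" for j i
    by (induction j) (simp_all add: \<phi>_0 \<phi>_Suc step_def c_def)
  have large: "3 / 4 * (1 / 3) ^ j * N (n j) \<le> cmod (\<phi> (Suc j) (n j))" for j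
  proof -
    let ?a = "step j (\<phi> j) 1 (n j)" and ?b = "step j (\<phi> j) (-1) (n j)"
    have "?a - ?b = of_real (2 * (1 / 3) ^ j) * A (n j) (s j)"
      by (simp add: step_def algebra_simps)
    then have "cmod (?a - ?b) = 2 * (1 / 3) ^ j * cmod (A (n j) (s j))"
      by (simp only: norm_mult norm_of_real) simp
    moreover have "2 * (1 / 3) ^ j * (3 / 4 * N (n j)) \<le> 2 * (1 / 3) ^ j * cmod (A (n j) (s j))"
      using s(2)[of j] by (intro mult_left_mono) auto
    moreover have "cmod (?a - ?b) \<le> cmod ?a + cmod ?b" by (rule norm_triangle_ineq4)
    ultimately have le: "2 * (3 / 4 * (1 / 3) ^ j * N (n j)) \<le> cmod ?a + cmod ?b" by linarith
    show ?thesis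
    proof (cases "3 / 4 * (1 / 3) ^ j * N (n j) \<le> cmod ?a")
      case True
      then show ?thesis by (simp only: \<phi>_Suc sgn_def if_True)
    next
      case False
      then have "3 / 4 * (1 / 3) ^ j * N (n j) \<le> cmod ?b" using le by linarith
      with False show ?thesis by (simp only: \<phi>_Suc sgn_def if_False)
    qed
  qed
  obtain K where K: "\<And>i. cmod (\<Sum>j. of_real (c j) * A i (s j)) \<le> K"
    using ser[of s c] s(1) c by blast
  \<comment> \<open>The terms beyond \<open>j\<close> add up to at most half of
    \<open>(1 / 3) ^ j * N (n j)\<close>, whereas the partial sum has at least three quarters of it.
    The remaining quarter exceeds \<open>(4 / 3) ^ j / 4\<close> by the choice of
    \<open>n j\<close>, which is unbounded.\<close>
  have lower: "1 / 4 * (1 / 3) ^ j * N (n j) \<le> K" for j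
  proof -
    let ?f = "\<lambda>l. of_real (c l) * A (n j) (s l)"
    have le: "norm (?f l) \<le> (1 / 3) ^ l * N (n j)" for l
      using N_ge[OF s(1), of "n j" l] by (simp add: norm_mult c mult_left_mono)
    have sg: "summable (\<lambda>l. (1 / 3) ^ l * N (n j))"
      by (intro summable_mult2 summable_geometric) simp
    have sf: "summable ?f" by (rule summable_comparison_test[OF _ sg]) (use le in blast)
    have "(\<Sum>l. ?f l) = (\<Sum>l. ?f (l + Suc j)) + \<phi> (Suc j) (n j)"
      unfolding \<phi>_sum by (rule suminf_split_initial_segment[OF sf])
    then have "\<phi> (Suc j) (n j) = (\<Sum>l. ?f l) - (\<Sum>l. ?f (l + Suc j))" by (rule eq_diff_eq[THEN iffD2, OF sym[OF trans[OF _ add.commute]]])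
    then have "cmod (\<phi> (Suc j) (n j)) \<le> cmod (\<Sum>l. ?f l) + cmod (\<Sum>l. ?f (l + Suc j))"
      by (simp only: norm_triangle_ineq4)
    moreover have "cmod (\<Sum>l. ?f (l + Suc j)) \<le> (\<Sum>l. (1 / 3) ^ (l + Suc j) * N (n j))"
    proof (rule norm_suminf_le)
      show "cmod (?f (l + Suc j)) \<le> (1 / 3) ^ (l + Suc j) * N (n j)" for l by (rule le)
      show "summable (\<lambda>l. (1 / 3) ^ (l + Suc j) * N (n j))"
        using sg by (rule summable_ignore_initial_segment)
    qed
    moreover have "(\<Sum>l. (1 / 3) ^ (l + Suc j) * N (n j)) = 1 / 2 * (1 / 3) ^ j * N (n j)"
    proof (rule sums_unique[symmetric])
      have "(\<lambda>l. ((1 / 3) ^ Suc j * N (n j)) * (1 / 3) ^ l) sums (((1 / 3) ^ Suc j * N (n j)) * (1 / (1 - 1 / 3)))"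
        by (intro sums_mult geometric_sums) simp
      then show "(\<lambda>l. (1 / 3) ^ (l + Suc j) * N (n j)) sums (1 / 2 * (1 / 3) ^ j * N (n j))"
        by (simp add: power_add mult_ac)
    qed
    ultimately show ?thesis using large[of j] K[of "n j"] by linarith
  qed
  obtain j where j: "4 * K < (4 / 3 :: real) ^ j"
    using real_arch_pow[of "4 / 3" "4 * K"] by auto
  have "1 / 4 * (4 / 3) ^ j \<le> K"
  proof -
    have "(1 / 3) ^ j * 4 ^ j \<le> (1 / 3) ^ j * N (n j)"
      using n[of j] by (intro mult_left_mono) auto
    moreover have "(1 / 3) ^ j * 4 ^ j = (4 / 3 :: real) ^ j" by (simp add: power_mult_distrib[symmetric])
    ultimately show ?thesis using lower[of j] by linarith
  qed
  with j show False by linarith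
qed

section \<open>Mackey convergence of the means\<close>

text \<open>The means satisfy \<open>(n + 1) a\<^sub>n\<^sub>+\<^sub>1 = z + z n a\<^sub>n\<close>;
  dividing by \<open>n + 1\<close> and passing to the limit gives \<open>l = z * l\<close>, which
  forces \<open>l = 0\<close> unless \<open>z = 1\<close>, and in that case the means are 1.\<close>

lemma cesaro_limit_0_or_1:
  fixes z l :: complex
  assumes lim: "(\<lambda>n. (1 / of_nat n) * (\<Sum>m=1..n. z ^ m)) \<longlonglongrightarrow> l"
  shows "l = 0 \<or> l = 1"
proof (cases "z = 1")
  case True
  have "eventually (\<lambda>n. (1 / of_nat n) * (\<Sum>m=1..n. z ^ m) = 1) sequentially"
    using eventually_gt_at_top[of 0] by (rule eventually_mono) (simp add: True)
  then have "(\<lambda>n. (1 / of_nat n) * (\<Sum>m=1..n. z ^ m)) \<longlonglongrightarrow> 1" by (rule tendsto_eventually)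
  with lim show ?thesis by (simp add: LIMSEQ_unique)
next
  case False
  let ?a = "\<lambda>n. (1 / of_nat n) * (\<Sum>m=1..n. z ^ m)"
  have *: "(\<Sum>m=1..Suc n. z ^ m) = z + z * (\<Sum>m=1..n. z ^ m)" for n
  proof (induction n)
    case (Suc n)
    have "(\<Sum>m=1..Suc (Suc n). z ^ m) = (\<Sum>m=1..Suc n. z ^ m) + z * z ^ Suc n" by simp
    also have "\<dots> = z + z * ((\<Sum>m=1..n. z ^ m) + z ^ Suc n)"
      by (simp only: Suc distrib_left add.assoc)
    also have "\<dots> = z + z * (\<Sum>m=1..Suc n. z ^ m)" by simp
    finally show ?case .
  qed simp
  have "?a (Suc n) = z * (1 / of_nat (Suc n)) + z * ?a n * (1 - 1 / of_nat (Suc n))" for n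
  \<comment> \<open>At \<open>n = 0\<close> the dummy value of the mean is multiplied by
    \<open>1 - 1 / 1\<close>.\<close>
  proof (cases "n = 0")
    case False
    have "?a (Suc n) = (z + z * (\<Sum>m=1..n. z ^ m)) / of_nat (Suc n)" unfolding * by simp
    also have "\<dots> = z * (1 / of_nat (Suc n)) + z * ?a n * (1 - 1 / of_nat (Suc n))"
    proof -
      have "1 - 1 / of_nat (Suc n) = (of_nat n / of_nat (Suc n) :: complex)"
        using of_nat_neq_0[of n, where ?'a = complex] by (simp add: field_simps)
      then show ?thesis using False
        by (simp add: add_divide_distrib del: sum.cl_ivl_Suc of_nat_Suc)
    qed
    finally show ?thesis .
  qed simp
  moreover have "(\<lambda>n. z * (1 / of_nat (Suc n)) + z * ?a n * (1 - 1 / of_nat (Suc n)))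
      \<longlonglongrightarrow> z * 0 + z * l * (1 - 0)"
    by (intro tendsto_intros lim LIMSEQ_Suc[OF lim_1_over_n])
  ultimately have "(\<lambda>n. ?a (Suc n)) \<longlonglongrightarrow> z * l" by (simp only:) simp
  with LIMSEQ_Suc[OF lim] have "l = z * l" by (rule LIMSEQ_unique)
  then show ?thesis using False by simp
qed

section \<open>Bounded sequences of multipliers: equicontinuity and small derivatives\<close>

lemma vector_derivative_Lipschitz:
  fixes f :: "real \<Rightarrow> 'b::real_normed_vector"
  assumes "convex S" and f: "\<And>x. x \<in> S \<Longrightarrow> (f has_vector_derivative f' x) (at x within S)"
    and B: "\<And>x. x \<in> S \<Longrightarrow> norm (f' x) \<le> B" and "x \<in> S" "y \<in> S"
  shows "norm (f x - f y) \<le> B * norm (x - y)"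
proof (rule differentiable_bound[OF assms(1) _ _ assms(4,5)])
  fix z assume z: "z \<in> S"
  show "(f has_derivative (\<lambda>h. h *\<^sub>R f' z)) (at z within S)"
    using f[OF z] by (simp add: has_vector_derivative_def)
  show "onorm (\<lambda>h. h *\<^sub>R f' z) \<le> B"
  proof (rule onorm_bound)
    show "0 \<le> B" using order_trans[OF norm_ge_zero B[OF z]] .
    show "norm (h *\<^sub>R f' z) \<le> B * norm h" for h
      using mult_left_mono[OF B[OF z], of "\<bar>h\<bar>"] by (simp add: mult.commute)
  qed
qed

lemma smooth_continuous_on: "smooth f \<Longrightarrow> continuous_on X f"
  by (meson has_vd has_vector_derivative_continuous continuous_at_imp_continuous_on)

text \<open>A Schwartz weight without zeros is bounded away from 0 on a compact interval, so the
  bound weighted by it becomes a uniform local bound.\<close>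

lemma OM_bounded_locally:
  assumes B: "bounded_in OM_space (range u)"
  obtains L where "\<And>n x. \<bar>x\<bar> \<le> r \<Longrightarrow> jet m (u n) x \<le> L"
proof -
  obtain v where v: "v \<in> schwartz_fun" "\<And>x. v x \<noteq> 0" using nonvanishing_schwartz by blast
  obtain C where C: "\<And>n x. cmod (v x) * jet m (u n) x \<le> C"
    using B v(1) unfolding bounded_in_OM by (meson rangeI)
  have "compact ((\<lambda>x. inverse (v x)) ` {-r..r})"
    by (intro compact_Icc compact_continuous_image continuous_intros smooth_continuous_on schwartz_smooth v) (simp add: v)
  from compact_imp_bounded[OF this] obtain D where D: "\<And>x. x \<in> {-r..r} \<Longrightarrow> cmod (inverse (v x)) \<le> D"
    unfolding bounded_iff by (meson imageI)
  have "jet m (u n) x \<le> D * C" if x: "\<bar>x\<bar> \<le> r" for n x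
  proof -
    have "jet m (u n) x = cmod (inverse (v x)) * (cmod (v x) * jet m (u n) x)"
      by (simp only: mult.assoc[symmetric] norm_mult[symmetric] left_inverse[OF v(2)] norm_one mult_1_left)
    also have "\<dots> \<le> D * C"
    proof (rule mult_mono[OF _ C])
      show "cmod (inverse (v x)) \<le> D" using D[of x] x by (simp add: abs_le_iff)
      then show "0 \<le> D" by (rule order_trans[OF norm_ge_zero])
    qed simp
    finally show ?thesis .
  qed
  then show ?thesis by (rule that)
qed

lemma jet_Lipschitz:
  assumes f: "smooth f" and L: "\<And>x. \<bar>x\<bar> \<le> r \<Longrightarrow> jet (Suc i) f x \<le> L" and xy: "\<bar>x\<bar> \<le> r" "\<bar>y\<bar> \<le> r"
  shows "cmod (nth_deriv i f x - nth_deriv i f y) \<le> L * \<bar>x - y\<bar>"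
proof -
  have "norm (nth_deriv i f x - nth_deriv i f y) \<le> L * norm (x - y)"
  proof (rule vector_derivative_Lipschitz[where S = "{-r..r}" and f' = "nth_deriv (Suc i) f"])
    show "(nth_deriv i f has_vector_derivative nth_deriv (Suc i) f z) (at z within {-r..r})" for z
      using has_nth_deriv[OF f] by (rule has_vector_derivative_at_within)
    show "norm (nth_deriv (Suc i) f z) \<le> L" if "z \<in> {-r..r}" for z
      using order_trans[OF jet_ge[of "Suc i" "Suc i" f z] L[of z]] that by auto
  qed (use xy in auto)
  then show ?thesis by simp
qed

text \<open>Local bounds for the first derivatives give a common local Lipschitz constant, which the
  limit inherits. A continuous function on the connected line that takes finitely many values is
  constant.\<close>

lemma pointwise_limit_constant:
  assumes B: "bounded_in OM_space (range a)" and lim: "\<And>x. (\<lambda>n. a n x) \<longlonglongrightarrow> g x"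
    and fin: "finite (range g)"
  shows "\<exists>c. \<forall>x. g x = c"
proof -
  have sm: "smooth (a n)" for n using B by (auto simp: bounded_in_OM intro: OM_smooth)
  have "isCont g x" for x
  proof -
    let ?r = "\<bar>x\<bar> + 1"
    obtain L where L: "\<And>n y. \<bar>y\<bar> \<le> ?r \<Longrightarrow> jet (Suc 0) (a n) y \<le> L"
      using OM_bounded_locally[OF B] by metis
    have Lip: "cmod (g x - g y) \<le> L * \<bar>x - y\<bar>" if y: "\<bar>y\<bar> \<le> ?r" for y
    proof (rule Lim_bounded)
      show "(\<lambda>n. cmod (a n x - a n y)) \<longlonglongrightarrow> cmod (g x - g y)" by (intro tendsto_intros lim)
      show "\<forall>n\<ge>0. cmod (a n x - a n y) \<le> L * \<bar>x - y\<bar>"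
        using jet_Lipschitz[OF sm L, of _ x y] y by simp
    qed
    have "(\<lambda>y. L * \<bar>x - y\<bar>) \<midarrow>x\<rightarrow> L * \<bar>x - x\<bar>" by (intro tendsto_intros)
    then have lim0: "(\<lambda>y. L * \<bar>x - y\<bar>) \<midarrow>x\<rightarrow> 0" by simp
    have "eventually (\<lambda>y. norm (g y - g x) \<le> L * \<bar>x - y\<bar>) (at x)"
      unfolding eventually_at
    proof (intro exI[of _ 1] conjI ballI impI)
      fix y assume "y \<noteq> x \<and> dist y x < 1"
      then have "\<bar>y - x\<bar> < 1" by (simp add: dist_real_def)
      then have "\<bar>y\<bar> \<le> ?r" by linarith
      then show "norm (g y - g x) \<le> L * \<bar>x - y\<bar>" using Lip[of y] by (simp add: norm_minus_commute)
    qed simp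
    then have "((\<lambda>y. g y - g x) \<longlongrightarrow> 0) (at x)" by (rule Lim_null_comparison[OF _ lim0])
    then show ?thesis unfolding isCont_def by (simp add: LIM_zero_iff)
  qed
  then have "continuous_on UNIV g" by (simp add: continuous_at_imp_continuous_on)
  then have "g constant_on UNIV" using fin by (intro continuous_finite_range_constant) auto
  then show ?thesis unfolding constant_on_def by simp
qed

text \<open>An inequality of Landau type: a first-order Taylor expansion with step \<open>t\<close>
  bounds a derivative by its two neighbours in order. After division by \<open>t\<close>, the lower
  order contributes a multiple of \<open>1 / t\<close> and the higher one a multiple of
  \<open>t\<close>.\<close>

lemma derivative_interpolation:
  assumes f: "smooth f" and t: "0 < t"
    and L: "\<And>y. y \<in> {x..x + t} \<Longrightarrow> cmod (nth_deriv (Suc (Suc i)) f y) \<le> L"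
  shows "t * cmod (nth_deriv (Suc i) f x) \<le> cmod (nth_deriv i f (x + t)) + cmod (nth_deriv i f x) + L * t * t"
proof -
  let ?d = "nth_deriv (Suc i) f x"
  \<comment> \<open>Subtracting the linear term leaves a function whose derivative on the interval
    is at most \<open>L * t\<close>. Applying the mean value inequality twice gives
    \<open>L * t * t\<close>.\<close>
  let ?\<phi> = "\<lambda>s. nth_deriv i f s - of_real s * ?d"
  have L0: "0 \<le> L" using order_trans[OF norm_ge_zero L[of x]] t by simp
  have near: "cmod (nth_deriv (Suc i) f s - ?d) \<le> L * t" if s: "s \<in> {x..x + t}" for s
  proof -
    have "norm (nth_deriv (Suc i) f s - nth_deriv (Suc i) f x) \<le> L * norm (s - x)"
    proof (rule vector_derivative_Lipschitz[where S = "{x..x + t}" and f' = "nth_deriv (Suc (Suc i)) f"])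
      show "(nth_deriv (Suc i) f has_vector_derivative nth_deriv (Suc (Suc i)) f z) (at z within {x..x + t})" for z
        using has_nth_deriv[OF f] by (rule has_vector_derivative_at_within)
    qed (use s t L in auto)
    also have "\<dots> \<le> L * t" using s L0 by (intro mult_left_mono) auto
    finally show ?thesis .
  qed
  have "norm (?\<phi> (x + t) - ?\<phi> x) \<le> (L * t) * norm ((x + t) - x)"
  proof (rule vector_derivative_Lipschitz[where S = "{x..x + t}" and f' = "\<lambda>s. nth_deriv (Suc i) f s - ?d"])
    show "(?\<phi> has_vector_derivative nth_deriv (Suc i) f z - ?d) (at z within {x..x + t})" for z
    proof -
      have "((\<lambda>s. of_real s * ?d) has_vector_derivative 1 * ?d) (at z)"
      proof (rule has_vector_derivative_mult_left)
        show "(complex_of_real has_vector_derivative 1) (at z)"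
          using has_vector_derivative_of_real[OF DERIV_ident, where ?'a = complex] by simp
      qed
      then have "(?\<phi> has_vector_derivative nth_deriv (Suc i) f z - 1 * ?d) (at z)"
        by (intro has_vector_derivative_diff has_nth_deriv f)
      then show ?thesis using has_vector_derivative_at_within by fastforce
    qed
  qed (use near t in auto)
  then have "cmod (nth_deriv i f (x + t) - nth_deriv i f x - of_real t * ?d) \<le> L * t * t"
    using t by (simp add: algebra_simps)
  moreover have "cmod (of_real t * ?d) \<le> cmod (nth_deriv i f (x + t) - nth_deriv i f x - of_real t * ?d)
     + cmod (nth_deriv i f (x + t) - nth_deriv i f x)"
    by (metis norm_minus_commute norm_triangle_sub add.commute)
  moreover have "cmod (nth_deriv i f (x + t) - nth_deriv i f x) \<le> cmod (nth_deriv i f (x + t)) + cmod (nth_deriv i f x)"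
    by (rule norm_triangle_ineq4)
  moreover have "cmod (of_real t * ?d) = t * cmod ?d" using t by (simp add: norm_mult)
  ultimately show ?thesis by linarith
qed

lemma derivatives_tendsto_0:
  assumes B: "bounded_in OM_space (range u)" and lim: "\<And>x. (\<lambda>n. u n x) \<longlonglongrightarrow> 0"
  shows "(\<lambda>n. nth_deriv i (u n) x) \<longlonglongrightarrow> 0"
proof (induction i arbitrary: x)
  case 0
  then show ?case using lim by simp
next
  case (Suc i)
  have sm: "smooth (u n)" for n using B by (auto simp: bounded_in_OM intro: OM_smooth)
  obtain L where L: "\<And>n y. \<bar>y\<bar> \<le> \<bar>x\<bar> + 1 \<Longrightarrow> jet (Suc (Suc i)) (u n) y \<le> L"
    using OM_bounded_locally[OF B] by metis
  have L0: "0 \<le> L" using order_trans[OF jet_nonneg L[of 0 0]] by simp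
  show ?case
  proof (rule tendstoI)
    fix e :: real assume e: "0 < e"
    \<comment> \<open>The step is fixed before \<open>n\<close>: it makes the second-order error at
      most \<open>e / 2\<close>, after which the lower derivative has to be small at just the two
      points \<open>x\<close> and \<open>x + t\<close>. The bound 1 keeps \<open>x + t\<close> where
      \<open>L\<close> is valid.\<close>
    define t where "t = min 1 (e / (2 * (L + 1)))"
    have t: "0 < t" "t \<le> 1" "L * t \<le> e / 2"
    proof -
      show "0 < t" using e L0 by (simp add: t_def)
      show "t \<le> 1" by (simp add: t_def)
      have "L * t \<le> (L + 1) * t" using \<open>0 < t\<close> by (simp add: mult_right_mono)
      also have "\<dots> \<le> (L + 1) * (e / (2 * (L + 1)))" using L0 by (intro mult_left_mono) (auto simp: t_def)
      also have "\<dots> = e / 2" using L0 by (simp add: field_simps)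
      finally show "L * t \<le> e / 2" .
    qed
    have "(\<lambda>n. cmod (nth_deriv i (u n) (x + t)) + cmod (nth_deriv i (u n) x)) \<longlonglongrightarrow> cmod 0 + cmod 0"
      by (intro tendsto_intros Suc)
    then have "eventually (\<lambda>n. cmod (nth_deriv i (u n) (x + t)) + cmod (nth_deriv i (u n) x) < t * (e / 2)) sequentially"
      by (rule order_tendstoD) (use t e in simp)
    then show "eventually (\<lambda>n. dist (nth_deriv (Suc i) (u n) x) 0 < e) sequentially"
    proof (rule eventually_mono)
      fix n assume n: "cmod (nth_deriv i (u n) (x + t)) + cmod (nth_deriv i (u n) x) < t * (e / 2)"
      have "t * cmod (nth_deriv (Suc i) (u n) x)
        \<le> cmod (nth_deriv i (u n) (x + t)) + cmod (nth_deriv i (u n) x) + L * t * t"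
      proof (rule derivative_interpolation[OF sm t(1)])
        fix y assume "y \<in> {x..x + t}"
        then have "\<bar>y\<bar> \<le> \<bar>x\<bar> + 1" using t by auto
        from order_trans[OF jet_ge L[OF this]]
        show "cmod (nth_deriv (Suc (Suc i)) (u n) y) \<le> L" by blast
      qed
      also have "\<dots> < t * (e / 2) + L * t * t" using n by simp
      also have "\<dots> \<le> t * (e / 2) + e / 2 * t" using mult_right_mono[OF t(3), of t] t(1) by linarith
      also have "\<dots> = t * e" by (simp add: algebra_simps)
      finally show "dist (nth_deriv (Suc i) (u n) x) 0 < e" using t by simp
    qed
  qed
qed

text \<open>Pointwise smallness on a finite net of mesh \<open>d\<close> spreads to the whole
  interval by the common Lipschitz constant.\<close>

lemma equi_Lipschitz_uniform_limit:
  fixes f :: "nat \<Rightarrow> real \<Rightarrow> complex"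
  assumes Lip: "\<And>n x y. \<bar>x\<bar> \<le> r \<Longrightarrow> \<bar>y\<bar> \<le> r \<Longrightarrow> cmod (f n x - f n y) \<le> L * \<bar>x - y\<bar>"
    and lim: "\<And>x. (\<lambda>n. f n x) \<longlonglongrightarrow> 0" and e: "0 < e"
  shows "eventually (\<lambda>n. \<forall>x. \<bar>x\<bar> \<le> r \<longrightarrow> cmod (f n x) < e) sequentially"
proof -
  define d where "d = e / (2 * (\<bar>L\<bar> + 1))"
  have d: "0 < d" using e by (simp add: d_def)
  obtain K where K: "finite K" "K \<subseteq> {-r..r}" "{-r..r} \<subseteq> (\<Union>k\<in>K. ball k d)"
    using seq_compact_imp_totally_bounded[of "{-r..r}"] d compact_imp_seq_compact[of "{-r..r}"] by auto
  have "eventually (\<lambda>n. \<forall>k\<in>K. cmod (f n k) < e / 2) sequentially"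
  proof (rule eventually_ball_finite[OF K(1)], rule ballI)
    fix k
    show "eventually (\<lambda>n. cmod (f n k) < e / 2) sequentially"
      using order_tendstoD(2)[OF tendsto_norm_zero[OF lim[of k]], of "e / 2"] e by simp
  qed
  then show ?thesis
  proof (rule eventually_mono, intro allI impI)
    fix n x assume n: "\<forall>k\<in>K. cmod (f n k) < e / 2" and x: "\<bar>x\<bar> \<le> r"
    then have "x \<in> {-r..r}" by auto
    with K(3) obtain k where k: "k \<in> K" "dist k x < d" by auto
    have "k \<in> {-r..r}" using k(1) K(2) by blast
    then have kr: "\<bar>k\<bar> \<le> r" by (simp add: abs_le_iff)
    have "cmod (f n x - f n k) \<le> L * \<bar>x - k\<bar>" by (rule Lip[OF x kr])
    also have "\<dots> \<le> (\<bar>L\<bar> + 1) * d"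
      using k(2) by (intro mult_mono) (auto simp: dist_real_def)
    also have "\<dots> = e / 2" by (simp add: d_def field_simps)
    finally have "cmod (f n x - f n k) \<le> e / 2" .
    moreover have "cmod (f n x) \<le> cmod (f n x - f n k) + cmod (f n k)"
      using norm_triangle_ineq[of "f n x - f n k" "f n k"] by simp
    ultimately show "cmod (f n x) < e" using n k(1) by fastforce
  qed
qed

lemma jets_uniformly_small:
  assumes B: "bounded_in OM_space (range u)" and lim: "\<And>x. (\<lambda>n. u n x) \<longlonglongrightarrow> 0" and e: "0 < e"
  shows "eventually (\<lambda>n. \<forall>x. \<bar>x\<bar> \<le> r \<longrightarrow> jet m (u n) x \<le> e) sequentially"
proof -
  have sm: "smooth (u n)" for n using B by (auto simp: bounded_in_OM intro: OM_smooth)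
  have "eventually (\<lambda>n. \<forall>i\<in>{..m}. \<forall>x. \<bar>x\<bar> \<le> r \<longrightarrow> cmod (nth_deriv i (u n) x) < e / real (Suc m)) sequentially"
  proof (rule eventually_ball_finite, simp, rule ballI)
    fix i
    obtain L where L: "\<And>n x. \<bar>x\<bar> \<le> r \<Longrightarrow> jet (Suc i) (u n) x \<le> L"
      using OM_bounded_locally[OF B] by metis
    show "eventually (\<lambda>n. \<forall>x. \<bar>x\<bar> \<le> r \<longrightarrow> cmod (nth_deriv i (u n) x) < e / real (Suc m)) sequentially"
      by (rule equi_Lipschitz_uniform_limit[where L = L])
        (use jet_Lipschitz[OF sm L] derivatives_tendsto_0[OF B lim] e in auto)
  qed
  then show ?thesis
  proof (rule eventually_mono, intro allI impI)
    fix n x assume *: "\<forall>i\<in>{..m}. \<forall>x. \<bar>x\<bar> \<le> r \<longrightarrow> cmod (nth_deriv i (u n) x) < e / real (Suc m)" "\<bar>x\<bar> \<le> r"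
    have "jet m (u n) x \<le> real (Suc m) * (e / real (Suc m))"
      using * by (intro jet_le) (auto intro: less_imp_le)
    then show "jet m (u n) x \<le> e" by simp
  qed
qed

text \<open>For each \<open>k\<close>, the jets of order \<open>k\<close> on \<open>[-k, k]\<close>
  eventually drop below any threshold. Letting \<open>k\<close> grow slowly with \<open>n\<close>
  gives scalars tending to infinity that the sequence can absorb on growing intervals; outside them
  the decay of the weight absorbs the scalars.\<close>

lemma OM_Mackey_convergence:
  assumes B: "bounded_in OM_space (range u)" and lim: "\<And>x. (\<lambda>n. u n x) \<longlonglongrightarrow> 0"
  obtains \<Lambda> :: "nat \<Rightarrow> real"
  where "\<And>n. 1 \<le> \<Lambda> n" "filterlim \<Lambda> at_top sequentially"
    "bounded_in OM_space (range (\<lambda>n x. of_real (\<Lambda> n) * u n x))"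
proof -
  have uO: "u n \<in> OM_fun" for n using B by (auto simp: bounded_in_OM)
  \<comment> \<open>One number \<open>k\<close> is order, radius and gain at the same time. It is
    limited by \<open>n\<close> to make the maximum exist, and \<open>k = 0\<close> always
    qualifies.\<close>
  define P where "P = (\<lambda>k n. \<forall>x. \<bar>x\<bar> \<le> real k \<longrightarrow> real k * jet k (u n) x \<le> 1)"
  define \<kappa> where "\<kappa> = (\<lambda>n. Max {k. k \<le> n \<and> P k n})"
  have fin: "finite {k. k \<le> n \<and> P k n}" for n by simp
  have "0 \<in> {k. k \<le> n \<and> P k n}" for n by (simp add: P_def)
  then have P\<kappa>: "P (\<kappa> n) n" for n
    using Max_in[OF fin, of n] unfolding \<kappa>_def by blast
  have ev: "eventually (\<lambda>n. k \<le> \<kappa> n) sequentially" for k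
  proof -
    \<comment> \<open>The threshold \<open>1 / (real k + 1)\<close> is positive also for
      \<open>k = 0\<close> and still gives \<open>real k * jet k (u n) x \<le> 1\<close>.\<close>
    have "eventually (\<lambda>n. \<forall>x. \<bar>x\<bar> \<le> real k \<longrightarrow> jet k (u n) x \<le> 1 / (real k + 1)) sequentially"
      by (rule jets_uniformly_small[OF B lim]) simp
    then have "eventually (\<lambda>n. (\<forall>x. \<bar>x\<bar> \<le> real k \<longrightarrow> jet k (u n) x \<le> 1 / (real k + 1)) \<and> k \<le> n) sequentially"
      using eventually_ge_at_top by (rule eventually_conj)
    then show ?thesis
    proof (rule eventually_mono, elim conjE)
      fix n assume n: "\<forall>x. \<bar>x\<bar> \<le> real k \<longrightarrow> jet k (u n) x \<le> 1 / (real k + 1)" "k \<le> n"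
      have "P k n"
        unfolding P_def
      proof (intro allI impI)
        fix x assume "\<bar>x\<bar> \<le> real k"
        then have "real k * jet k (u n) x \<le> real k * (1 / (real k + 1))"
          using n by (intro mult_left_mono) auto
        also have "\<dots> \<le> 1" by simp
        finally show "real k * jet k (u n) x \<le> 1" .
      qed
      with n(2) show "k \<le> \<kappa> n" unfolding \<kappa>_def by (intro Max_ge fin) simp
    qed
  qed
  show thesis
  proof
    show "1 \<le> 1 + real (\<kappa> n)" for n by simp
    have "filterlim \<kappa> at_top sequentially" unfolding filterlim_at_top using ev by blast
    then have "filterlim (\<lambda>n. real (\<kappa> n)) at_top sequentially"
      by (rule filterlim_compose[OF filterlim_real_sequentially])
    then show "filterlim (\<lambda>n. 1 + real (\<kappa> n)) at_top sequentially"
      by (rule filterlim_tendsto_add_at_top[OF tendsto_const])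
    show "bounded_in OM_space (range (\<lambda>n x. of_real (1 + real (\<kappa> n)) * u n x))"
      unfolding bounded_in_OM
    proof (intro conjI allI ballI)
      show "range (\<lambda>n x. of_real (1 + real (\<kappa> n)) * u n x) \<subseteq> OM_fun" using OM_cmult[OF uO] by auto
      fix m v assume v: "v \<in> schwartz_fun"
      obtain C where C: "\<And>n x. cmod (v x) * jet m (u n) x \<le> C"
        using B v unfolding bounded_in_OM by (meson rangeI)
      have "(\<lambda>x. of_real ((1 + x\<^sup>2) ^ 1) * v x) \<in> schwartz_fun" by (rule schwartz_mult[OF weight_OM v])
      then obtain D where D': "\<And>n x. cmod (of_real ((1 + x\<^sup>2) ^ 1) * v x) * jet m (u n) x \<le> D"
        using B unfolding bounded_in_OM by (meson rangeI)
      have D: "(1 + x\<^sup>2) * (cmod (v x) * jet m (u n) x) \<le> D" for n x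
      proof -
        have "\<bar>1 + x\<^sup>2\<bar> = 1 + x\<^sup>2" by (rule abs_of_nonneg) simp
        then show ?thesis using D'[of x n]
          by (simp only: norm_mult norm_of_real power_one_right mult.assoc)
      qed
      obtain V where V: "\<And>x. (1 + x\<^sup>2) ^ 0 * jet 0 v x \<le> V" using schwartzE[OF v] by metis
      have C0: "0 \<le> C" and D0: "0 \<le> D" and V0: "0 \<le> V"
        using order_trans[OF _ C[of 0 0]] order_trans[OF _ D[of 0 0]] order_trans[OF _ V[of 0]] by simp_all
      have \<kappa>_bd: "real (\<kappa> n) * (cmod (v x) * jet m (u n) x) \<le> real m * C + D + V" for n x
      proof -
        let ?j = "cmod (v x) * jet m (u n) x"
        \<comment> \<open>If \<open>\<kappa> n\<close> is below the order \<open>m\<close>, the gain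
          is at most \<open>m\<close>. Far out, the gain is at most \<open>\<bar>x\<bar>\<close> and
          is paid by the spare factor of the weight in \<open>D\<close>. In the rest, order and
          point lie in the range governed by \<open>P\<close>.\<close>
        consider "\<kappa> n \<le> m" | "real (\<kappa> n) \<le> \<bar>x\<bar>" | "m \<le> \<kappa> n" "\<bar>x\<bar> \<le> real (\<kappa> n)" by linarith
        then show ?thesis
        proof cases
          case 1
          then have "real (\<kappa> n) * ?j \<le> real m * C" by (intro mult_mono C) auto
          with D0 V0 show ?thesis by simp
        next
          case 2
          have "\<bar>x\<bar> \<le> 1 + x\<^sup>2"
            using zero_le_power2[of "\<bar>x\<bar> - 1"] by (simp add: power2_diff)
          with 2 have "real (\<kappa> n) * ?j \<le> (1 + x\<^sup>2) * ?j" by (intro mult_right_mono) auto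
          with D[of x n] C0 V0 show ?thesis by (smt (verit) mult_nonneg_nonneg of_nat_0_le_iff)
        next
          case 3
          have "real (\<kappa> n) * ?j = cmod (v x) * (real (\<kappa> n) * jet m (u n) x)" by simp
          also have "\<dots> \<le> cmod (v x) * (real (\<kappa> n) * jet (\<kappa> n) (u n) x)"
            using 3 by (intro mult_left_mono jet_mono) auto
          also have "\<dots> \<le> cmod (v x) * 1"
            using P\<kappa>[of n] 3 unfolding P_def by (intro mult_left_mono) auto
          also have "\<dots> \<le> V" using V[of x] by (simp add: jet_def)
          finally show ?thesis using C0 D0 by (smt (verit) mult_nonneg_nonneg of_nat_0_le_iff)
        qed
      qed
      have "cmod (v x) * jet m (\<lambda>x. of_real (1 + real (\<kappa> n)) * u n x) x \<le> C + (real m * C + D + V)" for n x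
      proof -
        have n1: "cmod (of_real (1 + real (\<kappa> n))) = 1 + real (\<kappa> n)"
          by (simp only: norm_of_real)
        have "cmod (v x) * jet m (\<lambda>x. of_real (1 + real (\<kappa> n)) * u n x) x
          = cmod (v x) * jet m (u n) x + real (\<kappa> n) * (cmod (v x) * jet m (u n) x)"
          unfolding jet_cmult[OF OM_smooth[OF uO]] n1 by (simp add: algebra_simps)
        with C[of x n] \<kappa>_bd[of n x] show ?thesis by linarith
      qed
      then show "\<exists>C. \<forall>f\<in>range (\<lambda>n x. of_real (1 + real (\<kappa> n)) * u n x). \<forall>x. cmod (v x) * jet m f x \<le> C"
        by blast
    qed
  qed
qed

section \<open>Strong duals and weakly bounded sequences\<close>

lemma continuous_map_complex:
  fixes u :: "'a \<Rightarrow> complex"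
  shows "continuous_map X euclidean u \<longleftrightarrow> (\<forall>x\<in>topspace X. (u \<longlongrightarrow> u x) (atin X x))"
  by (simp add: continuous_map_atin)

context fn_lcs
begin

lemma dualI:
  assumes add: "\<And>f g. f \<in> elems E \<Longrightarrow> g \<in> elems E \<Longrightarrow> w (f + g) = w f + w g"
    and scl: "\<And>c f. f \<in> elems E \<Longrightarrow> w (\<lambda>x. c * f x) = c * w f"
    and p: "p \<in> seminorms E" and bd: "\<And>f. f \<in> elems E \<Longrightarrow> cmod (w f) \<le> C * p f"
  shows "(\<lambda>f. if f \<in> elems E then w f else 0) \<in> dual E"
proof -
  let ?u = "\<lambda>f. if f \<in> elems E then w f else 0"
  have "continuous_map (lcs_topology E) euclidean ?u"
  proof (rule continuous_functionalI[OF _ p])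
    show "cmod (?u f) \<le> C * p f" if "f \<in> elems E" for f using bd[OF that] that by simp
    show "?u (f - g) = ?u f - ?u g" if f: "f \<in> elems E" and g: "g \<in> elems E" for f g
    proof -
      have "w (f - g) = w f + (-1) * w g"
        unfolding diff_eq using add[OF f fn_lcs.scale[OF fn_lcs_axioms g, of "-1"]] scl[OF g, of "-1"] by simp
      then show ?thesis using f g diff[OF f g] by simp
    qed
  qed
  then show ?thesis
    unfolding dual_def using add scl fn_lcs.add[OF fn_lcs_axioms] fn_lcs.scale[OF fn_lcs_axioms] by simp
qed

lemma dual_add: "u \<in> dual E \<Longrightarrow> f \<in> elems E \<Longrightarrow> g \<in> elems E \<Longrightarrow> u (f + g) = u f + u g"
  and dual_scale: "u \<in> dual E \<Longrightarrow> f \<in> elems E \<Longrightarrow> u (\<lambda>x. c * f x) = c * u f"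
  and dual_continuous: "u \<in> dual E \<Longrightarrow> continuous_map (lcs_topology E) euclidean u"
  by (simp_all add: dual_def)

lemma dual_zero: "u \<in> dual E \<Longrightarrow> u 0 = 0"
  using dual_scale[OF _ zero, of u 0] by (simp add: zero_fun_def)

lemma dual_diff:
  assumes "u \<in> dual E" "f \<in> elems E" "g \<in> elems E"
  shows "u (f - g) = u f - u g"
  unfolding diff_eq using dual_add[OF assms(1,2) scale[OF assms(3), of "-1"]] dual_scale[OF assms(1,3), of "-1"]
  by simp

lemma elems_sum: "finite A \<Longrightarrow> (\<And>m. m \<in> A \<Longrightarrow> f m \<in> elems E) \<Longrightarrow> (\<lambda>x. \<Sum>m\<in>A. f m x) \<in> elems E"
proof (induction A rule: finite_induct)
  case empty
  then show ?case using zero by (simp add: zero_fun_def)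
next
  case (insert a A)
  then have "f a + (\<lambda>x. \<Sum>m\<in>A. f m x) \<in> elems E" by (intro add) auto
  then show ?case using insert by (simp add: plus_fun_def)
qed

lemma dual_sum:
  assumes u: "u \<in> dual E"
  shows "finite A \<Longrightarrow> (\<And>m. m \<in> A \<Longrightarrow> f m \<in> elems E) \<Longrightarrow> u (\<lambda>x. \<Sum>m\<in>A. f m x) = (\<Sum>m\<in>A. u (f m))"
proof (induction A rule: finite_induct)
  case empty
  then show ?case using dual_zero[OF u] by (simp add: zero_fun_def)
next
  case (insert a A)
  have "u (f a + (\<lambda>x. \<Sum>m\<in>A. f m x)) = u (f a) + u (\<lambda>x. \<Sum>m\<in>A. f m x)"
    using insert by (intro dual_add u elems_sum) auto
  then show ?case using insert by (simp add: plus_fun_def)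
qed

section \<open>Seminorms of the strong dual\<close>

definition dual_sem :: "('x \<Rightarrow> complex) set \<Rightarrow> (('x \<Rightarrow> complex) \<Rightarrow> complex) \<Rightarrow> real" where
  "dual_sem B u = (SUP f\<in>B. cmod (u f))"

lemma strong_dual_simps:
  "elems (strong_dual E) = dual E"
  "seminorms (strong_dual E) = {dual_sem B | B. bounded_in E B \<and> B \<noteq> {}}"
  by (simp_all add: strong_dual_def dual_sem_def[abs_def])

lemma dual_sem_ge: "u \<in> dual E \<Longrightarrow> bounded_in E B \<Longrightarrow> f \<in> B \<Longrightarrow> cmod (u f) \<le> dual_sem B u"
  unfolding dual_sem_def by (intro cSUP_upper dual_bounded)

lemma dual_sem_le: "B \<noteq> {} \<Longrightarrow> (\<And>f. f \<in> B \<Longrightarrow> cmod (u f) \<le> C) \<Longrightarrow> dual_sem B u \<le> C"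
  unfolding dual_sem_def by (rule cSUP_least)

lemma bounded_subset: "bounded_in E B \<Longrightarrow> f \<in> B \<Longrightarrow> f \<in> elems E"
  by (auto simp: bounded_in_def)

lemma dual_add_mem: "u \<in> dual E \<Longrightarrow> v \<in> dual E \<Longrightarrow> u + v \<in> dual E"
  unfolding dual_def continuous_map_complex plus_fun_def
  by (auto simp: algebra_simps intro!: tendsto_add)

lemma dual_scale_mem: "u \<in> dual E \<Longrightarrow> (\<lambda>f. c * u f) \<in> dual E"
  unfolding dual_def continuous_map_complex
  by (auto simp: algebra_simps intro!: tendsto_mult)

lemma fn_lcs_strong_dual: "fn_lcs (strong_dual E)"
proof
  fix u v :: "('x \<Rightarrow> complex) \<Rightarrow> complex" and c q
  show "u + v \<in> elems (strong_dual E)" if "u \<in> elems (strong_dual E)" "v \<in> elems (strong_dual E)"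
    using that dual_add_mem by (simp add: strong_dual_simps)
  show "(\<lambda>f. c * u f) \<in> elems (strong_dual E)" if "u \<in> elems (strong_dual E)"
    using that dual_scale_mem by (simp add: strong_dual_simps)
  show "0 \<in> elems (strong_dual E)" by (simp add: strong_dual_simps dual_def zero_fun_def)
  show "seminorms (strong_dual E) \<noteq> {}"
    using bounded_singleton[OF zero] by (auto simp: strong_dual_simps)
  assume "q \<in> seminorms (strong_dual E)"
  then obtain B where q: "q = dual_sem B" and B: "bounded_in E B" "B \<noteq> {}" by (auto simp: strong_dual_simps)
  show "q (u + v) \<le> q u + q v" if "u \<in> elems (strong_dual E)" "v \<in> elems (strong_dual E)"
    unfolding q
  proof (rule dual_sem_le[OF B(2)])
    fix f assume f: "f \<in> B"
    have "cmod ((u + v) f) \<le> cmod (u f) + cmod (v f)" by (simp add: norm_triangle_ineq)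
    also have "\<dots> \<le> dual_sem B u + dual_sem B v"
      using that f B by (intro add_mono dual_sem_ge) (auto simp: strong_dual_simps)
    finally show "cmod ((u + v) f) \<le> dual_sem B u + dual_sem B v" .
  qed
  show "q (\<lambda>f. c * u f) = cmod c * q u" if "u \<in> elems (strong_dual E)"
  proof (rule homogeneous_if_subhomogeneous[where X = "dual E" and p = q])
    show "u \<in> dual E" using that by (simp add: strong_dual_simps)
    fix c and u assume u: "u \<in> dual E"
    show "(\<lambda>f. c * u f) \<in> dual E" by (rule dual_scale_mem[OF u])
    obtain b where b: "b \<in> B" using B by blast
    show "0 \<le> q u" unfolding q by (rule order_trans[OF norm_ge_zero dual_sem_ge[OF u B(1) b]])
    show "q (\<lambda>f. c * u f) \<le> cmod c * q u" unfolding q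
    proof (rule dual_sem_le[OF B(2)])
      fix f assume f: "f \<in> B"
      show "cmod (c * u f) \<le> cmod c * dual_sem B u"
        unfolding norm_mult by (intro mult_left_mono dual_sem_ge u B f) simp
    qed
  qed
qed

text \<open>A series of functionals \<open>\<phi> (s j)\<close> with coefficients of modulus
  \<open>(1 / 3) ^ j\<close> is dominated by \<open>3 / 2 * p\<close> and hence lies in the dual.
  Its values along \<open>b\<close> converge, so they are bounded, which is the hypothesis of the
  gliding hump.\<close>

lemma weakly_bounded:
  fixes \<phi> :: "'s \<Rightarrow> ('x \<Rightarrow> complex) \<Rightarrow> complex"
  assumes add: "\<And>s f g. f \<in> elems E \<Longrightarrow> g \<in> elems E \<Longrightarrow> \<phi> s (f + g) = \<phi> s f + \<phi> s g"
    and scl: "\<And>s c f. f \<in> elems E \<Longrightarrow> \<phi> s (\<lambda>x. c * f x) = c * \<phi> s f"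
    and p: "p \<in> seminorms E" and bd: "\<And>s f. f \<in> elems E \<Longrightarrow> cmod (\<phi> s f) \<le> p f"
    and b: "\<And>n. b n \<in> elems E" and weak: "\<And>u. u \<in> dual E \<Longrightarrow> convergent (\<lambda>n. u (b n))"
  shows "\<exists>K. \<forall>n s. cmod (\<phi> s (b n)) \<le> K"
proof -
  have "\<exists>K. \<forall>n. \<forall>s\<in>UNIV. cmod (\<phi> s (b n)) \<le> K"
  proof (rule uniform_boundedness_series)
    show "\<exists>K. \<forall>s\<in>UNIV. cmod (\<phi> s (b n)) \<le> K" for n using bd[OF b] by blast
    fix s :: "nat \<Rightarrow> 's" and c :: "nat \<Rightarrow> real" assume c: "\<And>j. \<bar>c j\<bar> = (1 / 3) ^ j"
    let ?w = "\<lambda>f. \<Sum>j. of_real (c j) * \<phi> (s j) f"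
    have le: "cmod (of_real (c j) * \<phi> (s j) f) \<le> (1 / 3) ^ j * p f" if "f \<in> elems E" for j f
      using bd[OF that] by (simp add: norm_mult c mult_left_mono)
    have sg: "summable (\<lambda>j. (1 / 3) ^ j * p f)" for f
      by (intro summable_mult2 summable_geometric) simp
    have sm: "summable (\<lambda>j. of_real (c j) * \<phi> (s j) f)" if "f \<in> elems E" for f
      by (rule summable_comparison_test[OF _ sg]) (use le[OF that] in blast)
    have "(\<lambda>f. if f \<in> elems E then ?w f else 0) \<in> dual E"
    proof (rule dualI[OF _ _ p])
      show "?w (f + g) = ?w f + ?w g" if "f \<in> elems E" "g \<in> elems E" for f g
        using that by (simp add: add distrib_left suminf_add[OF sm sm])
      show "?w (\<lambda>x. a * f x) = a * ?w f" if "f \<in> elems E" for a f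
        using that by (simp add: scl mult.left_commute[of _ a] suminf_mult[OF sm])
      show "cmod (?w f) \<le> (3 / 2) * p f" if f: "f \<in> elems E" for f
      proof -
        have "(\<lambda>j. (1 / 3) ^ j * p f) sums (1 / (1 - 1 / 3) * p f)"
          by (intro sums_mult2 geometric_sums) simp
        then have "(\<Sum>j. (1 / 3) ^ j * p f) = 3 / 2 * p f" by (simp add: sums_iff)
        moreover have "cmod (?w f) \<le> (\<Sum>j. (1 / 3) ^ j * p f)"
          by (rule norm_suminf_le[OF le[OF f] sg])
        ultimately show ?thesis by simp
      qed
    qed
    from convergent_imp_Bseq[OF weak[OF this]] show "\<exists>K. \<forall>n. cmod (?w (b n)) \<le> K"
      using b by (auto simp: Bseq_def)
  qed simp
  then show ?thesis by simp
qed

section \<open>Mean ergodicity\<close>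

text \<open>The triangle inequality that \<open>limitin_lcsI\<close> asks of the operator spaces.
  The suprema on the right are genuine because continuous operators are bounded on bounded
  sets.\<close>

lemma op_sem_diff_le:
  assumes "T \<in> cont_operators E" "S \<in> cont_operators E" "R \<in> cont_operators E"
    and p: "p \<in> seminorms E" and B: "bounded_in E B" "B \<noteq> {}"
  shows "(SUP f\<in>B. p ((T - R) f)) \<le> (SUP f\<in>B. p ((T - S) f)) + (SUP f\<in>B. p ((S - R) f))"
proof (rule cSUP_least[OF B(2)])
  have bdd: "bdd_above ((\<lambda>f. p ((T - S) f)) ` B)" if T: "T \<in> cont_operators E" and S: "S \<in> cont_operators E" for T S
  proof -
    obtain M N where M: "\<And>f. f \<in> B \<Longrightarrow> p (T f) \<le> M" and N: "\<And>f. f \<in> B \<Longrightarrow> p (S f) \<le> N"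
      using op_bounded[OF T B(1) p] op_bounded[OF S B(1) p] by (auto simp: bdd_above_def)
    show ?thesis
    proof (rule bdd_aboveI2)
      fix f assume f: "f \<in> B"
      have "p (T f - S f) \<le> p (T f) + p (S f)"
        using bounded_subset[OF B(1) f] by (intro sem_diff[OF p] op_mem[OF T] op_mem[OF S])
      also have "\<dots> \<le> M + N" by (intro add_mono M N f)
      finally show "p ((T - S) f) \<le> M + N" by simp
    qed
  qed
  fix f assume f: "f \<in> B"
  note fE = bounded_subset[OF B(1) f]
  have "p (T f - R f) \<le> p (T f - S f) + p (S f - R f)"
    by (rule sem_triangle[OF p op_mem[OF assms(1) fE] op_mem[OF assms(2) fE] op_mem[OF assms(3) fE]])
  also have "\<dots> \<le> (SUP f\<in>B. p ((T - S) f)) + (SUP f\<in>B. p ((S - R) f))"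
    using cSUP_upper[OF f bdd[OF assms(1,2)]] cSUP_upper[OF f bdd[OF assms(2,3)]] by simp
  finally show "p ((T - R) f) \<le> (SUP f\<in>B. p ((T - S) f)) + (SUP f\<in>B. p ((S - R) f))" by simp
qed

lemma op_sem_zero: "p \<in> seminorms E \<Longrightarrow> B \<noteq> {} \<Longrightarrow> (SUP f\<in>B. p ((0 :: ('x \<Rightarrow> complex) \<Rightarrow> 'x \<Rightarrow> complex) f)) = 0"
  by (simp add: sem_zero)

text \<open>Dividing by \<open>\<Lambda> n\<close> makes the error on \<open>B\<close> at most
  \<open>K / \<Lambda> n\<close>. Finite sets are bounded, so the same estimate serves both
  topologies.\<close>

lemma uniformly_mean_ergodicI:
  assumes T: "T \<in> cont_operators E" and ces: "\<And>n. cesaro_mean T n \<in> cont_operators E"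
    and P: "P \<in> cont_operators E" and \<Lambda>: "\<And>n. 1 \<le> \<Lambda> n" "filterlim \<Lambda> at_top sequentially"
    and bd: "\<And>p B. p \<in> seminorms E \<Longrightarrow> bounded_in E B \<Longrightarrow> B \<noteq> {} \<Longrightarrow>
      \<exists>K. \<forall>n. \<forall>f\<in>B. \<Lambda> n * p (cesaro_mean T n f - P f) \<le> K"
  shows "uniformly_mean_ergodic E T" "mean_ergodic E T"
proof -
  have lim: "eventually (\<lambda>n. (SUP f\<in>B. p ((cesaro_mean T n - P) f)) < r) sequentially"
    if p: "p \<in> seminorms E" and B: "bounded_in E B" "B \<noteq> {}" and r: "0 < r" for p B r
  proof -
    obtain K where K: "\<And>n f. f \<in> B \<Longrightarrow> \<Lambda> n * p (cesaro_mean T n f - P f) \<le> K"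
      using bd[OF p B] by blast
    have "eventually (\<lambda>n. (\<bar>K\<bar> + 1) / r \<le> \<Lambda> n) sequentially"
      using \<Lambda>(2) unfolding filterlim_at_top by blast
    then show ?thesis
    proof (rule eventually_mono)
      fix n assume n: "(\<bar>K\<bar> + 1) / r \<le> \<Lambda> n"
      have \<Lambda>0: "0 < \<Lambda> n" using \<Lambda>(1)[of n] by linarith
      have "(SUP f\<in>B. p ((cesaro_mean T n - P) f)) \<le> K / \<Lambda> n"
        using K \<Lambda>0 by (intro cSUP_least B) (simp add: pos_le_divide_eq mult.commute)
      also have "K / \<Lambda> n < r"
      proof -
        have "\<bar>K\<bar> + 1 \<le> \<Lambda> n * r" using n r by (simp add: pos_divide_le_eq)
        then have "K < \<Lambda> n * r" by linarith
        then show ?thesis using \<Lambda>0 by (simp add: pos_divide_less_eq mult.commute)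
      qed
      finally show "(SUP f\<in>B. p ((cesaro_mean T n - P) f)) < r" .
    qed
  qed
  have "limitin (lcs_topology (cont_operators_b E)) (cesaro_mean T) P sequentially"
  proof (rule limitin_lcsI)
    show "seminorms (cont_operators_b E) \<noteq> {}"
      using sem_ne bounded_singleton[OF zero] by (auto simp: cont_operators_b_def)
    fix q assume "q \<in> seminorms (cont_operators_b E)"
    then obtain p B where q: "q = (\<lambda>T. SUP f\<in>B. p (T f))" and p: "p \<in> seminorms E" and B: "bounded_in E B" "B \<noteq> {}"
      unfolding cont_operators_b_def by auto
    show "q 0 = 0" unfolding q by (rule op_sem_zero[OF p B(2)])
    show "eventually (\<lambda>n. q (cesaro_mean T n - P) < r) sequentially" if "0 < r" for r
      unfolding q by (rule lim[OF p B that])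
    show "q (T - R) \<le> q (T - S) + q (S - R)"
      if "T \<in> elems (cont_operators_b E)" "S \<in> elems (cont_operators_b E)" "R \<in> elems (cont_operators_b E)" for T S R
      unfolding q using that by (intro op_sem_diff_le p B) (simp_all add: cont_operators_b_def)
  qed (use P ces in \<open>simp_all add: cont_operators_b_def\<close>)
  then show "uniformly_mean_ergodic E T" using T unfolding uniformly_mean_ergodic_def by blast
  have "limitin (lcs_topology (cont_operators_s E)) (cesaro_mean T) P sequentially"
  proof (rule limitin_lcsI)
    have "finite_in E {0}" using zero by (simp add: finite_in_def)
    then show "seminorms (cont_operators_s E) \<noteq> {}"
      using sem_ne by (auto simp: cont_operators_s_def)
    fix q assume "q \<in> seminorms (cont_operators_s E)"
    then obtain p B where q: "q = (\<lambda>T. SUP f\<in>B. p (T f))" and p: "p \<in> seminorms E"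
      and "finite_in E B" and ne: "B \<noteq> {}"
      unfolding cont_operators_s_def by auto
    then have B: "bounded_in E B" by (intro finite_imp_bounded)
    show "q 0 = 0" unfolding q by (rule op_sem_zero[OF p ne])
    show "eventually (\<lambda>n. q (cesaro_mean T n - P) < r) sequentially" if "0 < r" for r
      unfolding q by (rule lim[OF p B ne that])
    show "q (T - R) \<le> q (T - S) + q (S - R)"
      if "T \<in> elems (cont_operators_s E)" "S \<in> elems (cont_operators_s E)" "R \<in> elems (cont_operators_s E)" for T S R
      unfolding q using that by (intro op_sem_diff_le p B ne) (simp_all add: cont_operators_s_def)
  qed (use P ces in \<open>simp_all add: cont_operators_s_def\<close>)
  then show "mean_ergodic E T" using T unfolding mean_ergodic_def by blast
qed

text \<open>A singleton is both finite and bounded, so each of the two operator topologies has the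
  seminorm \<open>p (T f)\<close>, and both kinds of ergodicity give convergence of the means at
  \<open>f\<close>.\<close>

lemma ergodicD:
  assumes erg: "mean_ergodic E T \<or> uniformly_mean_ergodic E T"
    and f: "f \<in> elems E" and ces: "\<And>n. cesaro_mean T n f \<in> elems E"
  shows "\<exists>g. limitin (lcs_topology E) (\<lambda>n. cesaro_mean T n f) g sequentially"
proof -
  have fin: "finite_in E {f}" and bdd: "bounded_in E {f}"
    using f by (simp_all add: finite_in_def bounded_in_def)
  obtain P where P: "P \<in> cont_operators E"
    and lim: "\<And>p r. p \<in> seminorms E \<Longrightarrow> 0 < r \<Longrightarrow> eventually (\<lambda>n. p (cesaro_mean T n f - P f) < r) sequentially"
  proof (rule disjE[OF erg])
    assume "mean_ergodic E T"
    then obtain P where L: "limitin (lcs_topology (cont_operators_s E)) (cesaro_mean T) P sequentially"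
      unfolding mean_ergodic_def by blast
    have mem: "(\<lambda>T. SUP f\<in>{f}. p (T f)) \<in> seminorms (cont_operators_s E)" if "p \<in> seminorms E" for p
      unfolding cont_operators_s_def lcs.select_convs
      by (rule CollectI, intro exI conjI, rule refl) (use that fin in simp_all)
    note D = limitin_lcsD[OF L mem]
    obtain p where "p \<in> seminorms E" using sem_ne by blast
    from D(1)[OF this _ zero_less_one] sem_zero[OF this] have "P \<in> cont_operators E"
      by (simp add: cont_operators_s_def)
    moreover have "eventually (\<lambda>n. p (cesaro_mean T n f - P f) < r) sequentially"
      if "p \<in> seminorms E" "0 < r" for p r
      using D(2)[OF that(1) _ that(2)] sem_zero[OF that(1)] by simp
    ultimately show thesis by (rule that)
  next
    assume "uniformly_mean_ergodic E T"
    then obtain P where L: "limitin (lcs_topology (cont_operators_b E)) (cesaro_mean T) P sequentially"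
      unfolding uniformly_mean_ergodic_def by blast
    have mem: "(\<lambda>T. SUP f\<in>{f}. p (T f)) \<in> seminorms (cont_operators_b E)" if "p \<in> seminorms E" for p
      unfolding cont_operators_b_def lcs.select_convs
      by (rule CollectI, intro exI conjI, rule refl) (use that bdd in simp_all)
    note D = limitin_lcsD[OF L mem]
    obtain p where "p \<in> seminorms E" using sem_ne by blast
    from D(1)[OF this _ zero_less_one] sem_zero[OF this] have "P \<in> cont_operators E"
      by (simp add: cont_operators_b_def)
    moreover have "eventually (\<lambda>n. p (cesaro_mean T n f - P f) < r) sequentially"
      if "p \<in> seminorms E" "0 < r" for p r
      using D(2)[OF that(1) _ that(2)] sem_zero[OF that(1)] by simp
    ultimately show thesis by (rule that)
  qed
  have "limitin (lcs_topology E) (\<lambda>n. cesaro_mean T n f) (P f) sequentially"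
    by (rule limitinI) (rule op_mem[OF P f] ces lim | assumption)+
  then show ?thesis by blast
qed

lemma dual_convergent:
  assumes "limitin (lcs_topology E) a l sequentially" "u \<in> dual E"
  shows "convergent (\<lambda>n. u (a n))"
  using continuous_sequentially[OF dual_continuous[OF assms(2)] assms(1)] by (auto simp: convergent_def)

end

section \<open>Multiplication operators\<close>

lemma bounded_inD: "bounded_in E B \<Longrightarrow> p \<in> seminorms E \<Longrightarrow> bdd_above (p ` B)"
  by (simp add: bounded_in_def)

text \<open>The features of a module over the multipliers that both spaces share. The first two make
  each multiplication operator continuous; the last, about two bounded sets at once, carries the
  rate of the means over to operators and to their transposes.\<close>

locale OM_module = fn_lcs E for E :: "(real \<Rightarrow> complex) lcs" +
  assumes mult_mem: "a \<in> OM_fun \<Longrightarrow> f \<in> elems E \<Longrightarrow> (\<lambda>x. a x * f x) \<in> elems E"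
    and mult_bd: "a \<in> OM_fun \<Longrightarrow> p \<in> seminorms E \<Longrightarrow>
      \<exists>q\<in>seminorms E. \<exists>C. \<forall>f\<in>elems E. p (\<lambda>x. a x * f x) \<le> C * q f"
    and mult_bounded: "bounded_in OM_space W \<Longrightarrow> bounded_in E B \<Longrightarrow>
      bounded_in E ((\<lambda>(a, f) x. a x * f x) ` (W \<times> B))"
begin

abbreviation (input) M :: "(real \<Rightarrow> complex) \<Rightarrow> (real \<Rightarrow> complex) \<Rightarrow> real \<Rightarrow> complex" where
  "M a \<equiv> mult_op E a"

abbreviation (input) M' :: "(real \<Rightarrow> complex) \<Rightarrow> ((real \<Rightarrow> complex) \<Rightarrow> complex) \<Rightarrow> (real \<Rightarrow> complex) \<Rightarrow> complex" where
  "M' a \<equiv> transpose_op E (mult_op E a)"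

lemma M_in: "f \<in> elems E \<Longrightarrow> M a f = (\<lambda>x. a x * f x)"
  and M_off: "f \<notin> elems E \<Longrightarrow> M a f = 0"
  by (simp_all add: mult_op_def)

lemma M_mem: "a \<in> OM_fun \<Longrightarrow> M a f \<in> elems E"
  by (cases "f \<in> elems E") (simp_all add: M_in M_off mult_mem zero)

lemma M_cont: assumes a: "a \<in> OM_fun" shows "M a \<in> cont_operators E"
proof -
  have "continuous_map (lcs_topology E) (lcs_topology E) (M a)"
  proof (rule continuous_lcsI)
    show "M a f \<in> elems E" for f by (rule M_mem[OF a])
    show "M a (f - g) = M a f - M a g" if "f \<in> elems E" "g \<in> elems E" for f g
      using that diff[OF that] by (simp add: M_in fun_eq_iff algebra_simps)
    fix p assume "p \<in> seminorms E"
    from mult_bd[OF a this] show "\<exists>q\<in>seminorms E. \<exists>C. \<forall>f\<in>elems E. p (M a f) \<le> C * q f"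
      by (simp add: M_in)
  qed
  moreover have "M a (f + g) = M a f + M a g" if "f \<in> elems E" "g \<in> elems E" for f g
    using that add[OF that] by (simp add: M_in fun_eq_iff algebra_simps)
  moreover have "M a (\<lambda>x. c * f x) = (\<lambda>x. c * M a f x)" if "f \<in> elems E" for c f
    using that scale[OF that] by (simp add: M_in fun_eq_iff algebra_simps)
  ultimately show ?thesis unfolding cont_operators_def using M_off by blast
qed

text \<open>Exponent 0 is left out: off \<open>elems E\<close> the identity differs from
  multiplication by 1, which is 0 there. The means start at exponent 1.\<close>

lemma M_funpow: "h \<in> OM_fun \<Longrightarrow> (M h ^^ Suc m) f = M (\<lambda>x. h x ^ Suc m) f"
proof (induction m)
  case 0
  then show ?case by (simp add: fun_eq_iff mult_op_def)
next
  case (Suc m)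
  have "(M h ^^ Suc (Suc m)) f = M h (M (\<lambda>x. h x ^ Suc m) f)"
    using Suc by simp
  also have "\<dots> = M (\<lambda>x. h x ^ Suc (Suc m)) f"
  proof (cases "f \<in> elems E")
    case True
    then have "M h (M (\<lambda>x. h x ^ Suc m) f) = (\<lambda>x. h x * M (\<lambda>x. h x ^ Suc m) f x)"
      by (intro M_in M_mem OM_power Suc)
    then show ?thesis using True by (simp add: M_in mult.assoc)
  next
    case False
    then show ?thesis using zero by (simp add: M_off M_in fun_eq_iff)
  qed
  finally show ?case .
qed

lemma cesaro_M: assumes h: "h \<in> OM_fun" shows "cesaro_mean (M h) n = M (mean_power h n)"
proof (intro ext)
  fix f x
  have "(M h ^^ m) f x = M (\<lambda>x. h x ^ m) f x" if "m \<in> {1..n}" for m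
    using that M_funpow[OF h, of _ f] by (cases m) (simp_all del: funpow.simps power_Suc)
  then have "cesaro_mean (M h) n f x = (1 / of_nat n) * (\<Sum>m=1..n. M (\<lambda>x. h x ^ m) f x)"
    unfolding cesaro_mean_def by simp
  also have "\<dots> = M (mean_power h n) f x"
    by (cases "f \<in> elems E") (simp_all add: M_in M_off mean_power_def sum_distrib_right mult.assoc)
  finally show "cesaro_mean (M h) n f x = M (mean_power h n) f x" .
qed

section \<open>Transposed multiplication operators\<close>

lemma M'_in: "u \<in> dual E \<Longrightarrow> M' a u = (\<lambda>f. u (M a f))"
  and M'_off: "u \<notin> dual E \<Longrightarrow> M' a u = 0"
  by (simp_all add: transpose_op_def)

lemma zero_dual: "0 \<in> dual E"
  using fn_lcs.zero[OF fn_lcs_strong_dual] by (simp add: strong_dual_simps)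

lemma M_add: "a \<in> OM_fun \<Longrightarrow> f \<in> elems E \<Longrightarrow> g \<in> elems E \<Longrightarrow> M a (f + g) = M a f + M a g"
  and M_scale: "a \<in> OM_fun \<Longrightarrow> f \<in> elems E \<Longrightarrow> M a (\<lambda>x. c * f x) = (\<lambda>x. c * M a f x)"
  and M_continuous: "a \<in> OM_fun \<Longrightarrow> continuous_map (lcs_topology E) (lcs_topology E) (M a)"
  using M_cont[of a] by (simp_all add: cont_operators_def)

lemma M'_mem: assumes a: "a \<in> OM_fun" shows "M' a u \<in> dual E"
proof (cases "u \<in> dual E")
  case True
  have "continuous_map (lcs_topology E) euclidean (u \<circ> M a)"
    by (rule continuous_map_compose[OF M_continuous[OF a] dual_continuous[OF True]])
  then have "continuous_map (lcs_topology E) euclidean (\<lambda>f. u (M a f))" by (simp add: o_def)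
  moreover have "u (M a (f + g)) = u (M a f) + u (M a g)" if "f \<in> elems E" "g \<in> elems E" for f g
    unfolding M_add[OF a that] by (rule dual_add[OF True M_mem[OF a] M_mem[OF a]])
  moreover have "u (M a (\<lambda>x. c * f x)) = c * u (M a f)" if "f \<in> elems E" for f c
    unfolding M_scale[OF a that] by (rule dual_scale[OF True M_mem[OF a]])
  moreover have "u (M a f) = 0" if "f \<notin> elems E" for f
    unfolding M_off[OF that] by (rule dual_zero[OF True])
  ultimately show ?thesis unfolding M'_in[OF True] dual_def by blast
next
  case False
  then show ?thesis by (simp add: M'_off zero_dual)
qed

text \<open>The seminorm over \<open>B\<close> of the transposed functional is at most the seminorm
  of \<open>u\<close> over the products of \<open>a\<close> with \<open>B\<close>, and these form a
  bounded set by \<open>mult_bounded\<close> with \<open>W = {a}\<close>.\<close>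

lemma M'_cont: assumes a: "a \<in> OM_fun" shows "M' a \<in> cont_operators (strong_dual E)"
proof -
  have sub: "M' a (u - v) = M' a u - M' a v" if "u \<in> dual E" "v \<in> dual E" for u v
    using that fn_lcs.diff[OF fn_lcs_strong_dual, of u v] by (simp add: M'_in strong_dual_simps fun_eq_iff)
  have "continuous_map (lcs_topology (strong_dual E)) (lcs_topology (strong_dual E)) (M' a)"
  proof (rule fn_lcs.continuous_lcsI[OF fn_lcs_strong_dual])
    show "M' a u \<in> elems (strong_dual E)" for u by (simp add: strong_dual_simps M'_mem[OF a])
    show "M' a (u - v) = M' a u - M' a v" if "u \<in> elems (strong_dual E)" "v \<in> elems (strong_dual E)" for u v
      using that by (simp add: strong_dual_simps sub)
    fix q assume "q \<in> seminorms (strong_dual E)"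
    then obtain B where q: "q = dual_sem B" and B: "bounded_in E B" "B \<noteq> {}" by (auto simp: strong_dual_simps)
    let ?B = "(\<lambda>(a, f) x. a x * f x) ` ({a} \<times> B)"
    have bB: "bounded_in E ?B"
      using a by (intro mult_bounded B OM.bounded_singleton) (simp add: OM_space_def)
    have "dual_sem B (M' a u) \<le> 1 * dual_sem ?B u" if u: "u \<in> dual E" for u
    proof (rule dual_sem_le[OF B(2)])
      fix f assume f: "f \<in> B"
      then have "M a f \<in> ?B" using bounded_subset[OF B(1) f] by (force simp: M_in)
      then show "cmod (M' a u f) \<le> 1 * dual_sem ?B u"
        using dual_sem_ge[OF u bB] by (simp add: M'_in[OF u])
    qed
    moreover have "dual_sem ?B \<in> seminorms (strong_dual E)"
      using bB B(2) unfolding strong_dual_simps by blast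
    ultimately show "\<exists>q'\<in>seminorms (strong_dual E). \<exists>C. \<forall>u\<in>elems (strong_dual E). q (M' a u) \<le> C * q' u"
      unfolding q strong_dual_simps(1) by blast
  qed
  moreover have "M' a (u + v) = M' a u + M' a v" if "u \<in> dual E" "v \<in> dual E" for u v
    using that dual_add_mem[OF that] by (simp add: M'_in fun_eq_iff)
  moreover have "M' a (\<lambda>f. c * u f) = (\<lambda>f. c * M' a u f)" if "u \<in> dual E" for c u
    using that dual_scale_mem[OF that] by (simp add: M'_in fun_eq_iff)
  ultimately show ?thesis unfolding cont_operators_def strong_dual_simps using M'_off by blast
qed

lemma M'_funpow: assumes h: "h \<in> OM_fun" shows "(M' h ^^ m) u = (if m = 0 then u else M' (\<lambda>x. h x ^ m) u)"
proof (cases "u \<in> dual E")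
  case True
  have "(M' h ^^ m) u = (\<lambda>f. u ((M h ^^ m) f)) \<and> (M' h ^^ m) u \<in> dual E" for m
  proof (induction m)
    case (Suc m)
    have "(M' h ^^ Suc m) u = M' h ((M' h ^^ m) u)" by simp
    also have "\<dots> = (\<lambda>f. (M' h ^^ m) u (M h f))" using Suc by (intro M'_in) blast
    also have "\<dots> = (\<lambda>f. u ((M h ^^ m) (M h f)))" using Suc by simp
    also have "\<dots> = (\<lambda>f. u ((M h ^^ Suc m) f))" by (simp only: funpow_Suc_right comp_apply)
    finally have "(M' h ^^ Suc m) u = (\<lambda>f. u ((M h ^^ Suc m) f))" .
    moreover have "(M' h ^^ Suc m) u \<in> dual E" using M'_mem[OF h] by simp
    ultimately show ?case by blast
  qed (simp add: True)
  then have "(M' h ^^ m) u = (\<lambda>f. u ((M h ^^ m) f))" by blast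
  then show ?thesis
    using M_funpow[OF h, of "m - 1"] by (cases m) (simp_all add: M'_in[OF True])
next
  case False
  have "M' h 0 = 0" using zero_dual by (simp add: M'_in fun_eq_iff)
  then have "(M' h ^^ Suc m) u = 0" for m
    by (induction m) (simp_all add: M'_off[OF False])
  then show ?thesis by (cases m) (simp_all add: M'_off[OF False] del: funpow.simps)
qed

lemma cesaro_M': assumes h: "h \<in> OM_fun" shows "cesaro_mean (M' h) n = M' (mean_power h n)"
proof (intro ext)
  fix u f
  have *: "cesaro_mean (M' h) n u f = (1 / of_nat n) * (\<Sum>m=1..n. M' (\<lambda>x. h x ^ m) u f)"
    unfolding cesaro_mean_def M'_funpow[OF h] by simp
  show "cesaro_mean (M' h) n u f = M' (mean_power h n) u f"
  proof (cases "u \<in> dual E")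
    case u: True
    show ?thesis
    proof (cases "f \<in> elems E")
      case f: True
      have mem: "(\<lambda>x. h x ^ m * f x) \<in> elems E" for m by (intro mult_mem OM_power h f)
      have "M' (mean_power h n) u f = u (\<lambda>x. (1 / of_nat n) * (\<Sum>m=1..n. h x ^ m * f x))"
        by (simp add: M'_in[OF u] M_in[OF f] mean_power_def sum_distrib_right)
      also have "\<dots> = (1 / of_nat n) * u (\<lambda>x. \<Sum>m=1..n. h x ^ m * f x)"
        by (rule dual_scale[OF u elems_sum[OF _ mem]]) simp
      also have "u (\<lambda>x. \<Sum>m=1..n. h x ^ m * f x) = (\<Sum>m=1..n. u (\<lambda>x. h x ^ m * f x))"
        by (rule dual_sum[OF u _ mem]) simp
      finally show ?thesis unfolding * by (simp add: M'_in[OF u] M_in[OF f])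
    next
      case False
      then show ?thesis unfolding * by (simp add: M'_in[OF u] M_off dual_zero[OF u])
    qed
  next
    case False
    then show ?thesis unfolding * by (simp add: M'_off)
  qed
qed

text \<open>The limit operator is multiplication by the constant \<open>c\<close>. On
  \<open>E\<close> the scaled errors lie in the bounded product of the given set with
  \<open>B\<close>. On the dual they are values of \<open>u\<close> on that same product, and the
  seminorm over it is bounded on \<open>U\<close>.\<close>

lemma ergodic_if_Mackey:
  assumes h: "h \<in> OM_fun" and \<Lambda>: "\<And>n. 1 \<le> \<Lambda> n" "filterlim \<Lambda> at_top sequentially"
    and W: "bounded_in OM_space (range (\<lambda>n x. of_real (\<Lambda> n) * (mean_power h n x - c)))"
  shows "uniformly_mean_ergodic E (M h)" "mean_ergodic E (M h)"
    "uniformly_mean_ergodic (strong_dual E) (M' h)" "mean_ergodic (strong_dual E) (M' h)"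
proof -
  let ?W = "range (\<lambda>n x. of_real (\<Lambda> n) * (mean_power h n x - c))"
  let ?a = "\<lambda>n. mean_power h n" and ?c = "\<lambda>x::real. c"
  have aO: "?a n \<in> OM_fun" for n by (rule mean_power_OM[OF h])
  have \<Lambda>0: "cmod (of_real (\<Lambda> n)) = \<Lambda> n" for n using \<Lambda>(1)[of n] by simp
  have diff: "M (?a n) f - M ?c f = (\<lambda>x. (?a n x - c) * f x)" if "f \<in> elems E" for n f
    using that by (simp add: M_in fun_eq_iff algebra_simps)
  have mem: "(\<lambda>x. (?a n x - c) * f x) \<in> elems E" if f: "f \<in> elems E" for n f
    unfolding diff[OF f, symmetric] by (intro fn_lcs.diff[OF fn_lcs_axioms] M_mem aO const_OM)
  have E: "\<exists>K. \<forall>n. \<forall>f\<in>B. \<Lambda> n * p (cesaro_mean (M h) n f - M ?c f) \<le> K"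
    if p: "p \<in> seminorms E" and B: "bounded_in E B" "B \<noteq> {}" for p B
  proof -
    have "bdd_above (p ` ((\<lambda>(a, f) x. a x * f x) ` (?W \<times> B)))"
      by (rule bounded_inD[OF mult_bounded[OF W B(1)] p])
    then obtain K where K: "\<And>w f. w \<in> ?W \<Longrightarrow> f \<in> B \<Longrightarrow> p (\<lambda>x. w x * f x) \<le> K"
      by (force simp: bdd_above_def)
    have "\<Lambda> n * p (cesaro_mean (M h) n f - M ?c f) \<le> K" if f: "f \<in> B" for n f
    proof -
      note fE = bounded_subset[OF B(1) f]
      have "\<Lambda> n * p (cesaro_mean (M h) n f - M ?c f) = p (\<lambda>x. of_real (\<Lambda> n) * ((?a n x - c) * f x))"
        unfolding cesaro_M[OF h] diff[OF fE] sem_scale[OF p mem[OF fE]] \<Lambda>0 ..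
      also have "\<dots> \<le> K"
        using K[of "\<lambda>x. of_real (\<Lambda> n) * (?a n x - c)" f] f by (simp add: mult.assoc)
      finally show ?thesis .
    qed
    then show ?thesis by blast
  qed
  have ces: "cesaro_mean (M h) n \<in> cont_operators E" for n
    unfolding cesaro_M[OF h] by (rule M_cont[OF aO])
  show "uniformly_mean_ergodic E (M h)" "mean_ergodic E (M h)"
    using uniformly_mean_ergodicI[OF M_cont[OF h] ces M_cont[OF const_OM] \<Lambda> E] by blast+
  have E': "\<exists>K. \<forall>n. \<forall>u\<in>U. \<Lambda> n * q (cesaro_mean (M' h) n u - M' ?c u) \<le> K"
    if q: "q \<in> seminorms (strong_dual E)" and U: "bounded_in (strong_dual E) U" "U \<noteq> {}" for q U
  proof -
    obtain B where q: "q = dual_sem B" and B: "bounded_in E B" "B \<noteq> {}"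
      using q by (auto simp: strong_dual_simps)
    let ?B = "(\<lambda>(a, f) x. a x * f x) ` (?W \<times> B)"
    have bB: "bounded_in E ?B" by (rule mult_bounded[OF W B(1)])
    have "dual_sem ?B \<in> seminorms (strong_dual E)"
      using bB B(2) unfolding strong_dual_simps by blast
    then have "bdd_above (dual_sem ?B ` U)" by (rule bounded_inD[OF U(1)])
    then obtain K where K: "\<And>u. u \<in> U \<Longrightarrow> dual_sem ?B u \<le> K" by (force simp: bdd_above_def)
    have "\<Lambda> n * q (cesaro_mean (M' h) n u - M' ?c u) \<le> K" if u: "u \<in> U" for n u
    proof -
      have uE: "u \<in> dual E" using U(1) u by (auto simp: bounded_in_def strong_dual_simps)
      have pos: "0 < \<Lambda> n" using \<Lambda>(1)[of n] by linarith
      have "dual_sem B (cesaro_mean (M' h) n u - M' ?c u) \<le> K / \<Lambda> n"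
      proof (rule dual_sem_le[OF B(2)])
        fix f assume f: "f \<in> B"
        note fE = bounded_subset[OF B(1) f]
        have "(cesaro_mean (M' h) n u - M' ?c u) f = u (M (?a n) f - M ?c f)"
          unfolding cesaro_M'[OF h] dual_diff[OF uE M_mem[OF aO] M_mem[OF const_OM]]
          by (simp add: M'_in[OF uE])
        also have "\<dots> = u (\<lambda>x. (?a n x - c) * f x)" unfolding diff[OF fE] ..
        finally have eq: "(cesaro_mean (M' h) n u - M' ?c u) f = u (\<lambda>x. (?a n x - c) * f x)" .
        have "\<Lambda> n * cmod (u (\<lambda>x. (?a n x - c) * f x)) = cmod (u (\<lambda>x. of_real (\<Lambda> n) * ((?a n x - c) * f x)))"
          unfolding dual_scale[OF uE mem[OF fE]] norm_mult \<Lambda>0 ..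
        also have "(\<lambda>x. of_real (\<Lambda> n) * ((?a n x - c) * f x)) \<in> ?B"
        proof (rule image_eqI)
          show "(\<lambda>x. of_real (\<Lambda> n) * ((?a n x - c) * f x)) =
            (case (\<lambda>x. of_real (\<Lambda> n) * (?a n x - c), f) of (a, f) \<Rightarrow> \<lambda>x. a x * f x)"
            by (simp add: mult.assoc)
          show "(\<lambda>x. of_real (\<Lambda> n) * (?a n x - c), f) \<in> ?W \<times> B" using f by blast
        qed
        then have "cmod (u (\<lambda>x. of_real (\<Lambda> n) * ((?a n x - c) * f x))) \<le> K"
          by (rule order_trans[OF dual_sem_ge[OF uE bB] K[OF u]])
        finally show "cmod ((cesaro_mean (M' h) n u - M' ?c u) f) \<le> K / \<Lambda> n"
          unfolding eq using pos by (simp add: pos_le_divide_eq mult.commute)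
      qed
      then show ?thesis unfolding q using pos by (simp add: pos_le_divide_eq mult.commute)
    qed
    then show ?thesis by blast
  qed
  have ces': "cesaro_mean (M' h) n \<in> cont_operators (strong_dual E)" for n
    unfolding cesaro_M'[OF h] by (rule M'_cont[OF aO])
  show "uniformly_mean_ergodic (strong_dual E) (M' h)" "mean_ergodic (strong_dual E) (M' h)"
    using fn_lcs.uniformly_mean_ergodicI[OF fn_lcs_strong_dual M'_cont[OF h] ces' M'_cont[OF const_OM] \<Lambda> E']
    by blast+
qed

text \<open>Convergence of the means at \<open>f\<close>, tested with \<open>u\<close>, and
  convergence of the transposed means at \<open>u\<close>, evaluated at \<open>f\<close>, concern
  the same numbers; the latter uses the strong seminorm over the singleton of
  \<open>f\<close>.\<close>

lemma weakly_convergent_if_ergodic: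
  assumes h: "h \<in> OM_fun"
    and erg: "mean_ergodic E (M h) \<or> uniformly_mean_ergodic E (M h) \<or>
      mean_ergodic (strong_dual E) (M' h) \<or> uniformly_mean_ergodic (strong_dual E) (M' h)"
    and u: "u \<in> dual E" and f: "f \<in> elems E"
  shows "convergent (\<lambda>n. u (\<lambda>x. mean_power h n x * f x))"
proof -
  note aO = mean_power_OM[OF h]
  consider "mean_ergodic E (M h) \<or> uniformly_mean_ergodic E (M h)"
    | "mean_ergodic (strong_dual E) (M' h) \<or> uniformly_mean_ergodic (strong_dual E) (M' h)"
    using erg by blast
  then show ?thesis
  proof cases
    case 1
    from ergodicD[OF this f] obtain g where "limitin (lcs_topology E) (\<lambda>n. cesaro_mean (M h) n f) g sequentially"
      unfolding cesaro_M[OF h] using M_mem[OF aO] by blast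
    from dual_convergent[OF this u] show ?thesis by (simp add: cesaro_M[OF h] M_in[OF f])
  next
    case 2
    from fn_lcs.ergodicD[OF fn_lcs_strong_dual this, of u] u
    obtain w where w: "limitin (lcs_topology (strong_dual E)) (\<lambda>n. cesaro_mean (M' h) n u) w sequentially"
      unfolding cesaro_M'[OF h] strong_dual_simps using M'_mem[OF aO] by blast
    have B: "bounded_in E {f}" by (rule bounded_singleton[OF f])
    have q: "dual_sem {f} \<in> seminorms (strong_dual E)"
      using B unfolding strong_dual_simps by blast
    have "(\<lambda>n. cesaro_mean (M' h) n u f) \<longlonglongrightarrow> w f"
    proof (rule tendstoI)
      fix e :: real assume "0 < e"
      from fn_lcs.limitinD(2)[OF fn_lcs_strong_dual w q this]
      show "eventually (\<lambda>n. dist (cesaro_mean (M' h) n u f) (w f) < e) sequentially"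
        by (simp add: dual_sem_def dist_norm)
    qed
    then show ?thesis
      by (auto simp: cesaro_M'[OF h] M'_in[OF u] M_in[OF f] convergent_def)
  qed
qed

end

interpretation S: OM_module schwartz_space
proof
  fix a f :: "real \<Rightarrow> complex"
  show "(\<lambda>x. a x * f x) \<in> elems schwartz_space" if "a \<in> OM_fun" "f \<in> elems schwartz_space"
    using that by (simp add: schwartz_space_def schwartz_mult)
  show "bounded_in schwartz_space ((\<lambda>(a, f) x. a x * f x) ` (W \<times> B))"
    if "bounded_in OM_space W" "bounded_in schwartz_space B" for W B
    using that by (rule bounded_OM_mult_schwartz)
  fix p assume a: "a \<in> OM_fun" and "p \<in> seminorms schwartz_space"
  then obtain n where p: "p = schwartz_norm n" by (auto simp: schwartz_space_def)
  obtain k C where C: "0 \<le> C" "\<And>f x. smooth f \<Longrightarrow> jet n (\<lambda>x. a x * f x) x \<le> C * ((1 + x\<^sup>2) ^ k * jet n f x)"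
    using OM_jet_mult[OF a] by metis
  have "schwartz_norm n (\<lambda>x. a x * f x) \<le> (C * real (Suc (n + k))) * schwartz_norm (n + k) f"
    if f: "f \<in> schwartz_fun" for f
  proof (rule schwartz_norm_le_jet)
    fix x :: real
    have "(1 + x\<^sup>2) ^ n * jet n (\<lambda>x. a x * f x) x \<le> (1 + x\<^sup>2) ^ n * (C * ((1 + x\<^sup>2) ^ k * jet n f x))"
      using C(2)[OF schwartz_smooth[OF f]] by (intro mult_left_mono) simp_all
    also have "\<dots> = C * ((1 + x\<^sup>2) ^ (n + k) * jet n f x)" by (simp add: power_add mult_ac)
    also have "\<dots> \<le> C * (real (Suc (n + k)) * schwartz_norm (n + k) f)"
      by (intro mult_left_mono jet_le_schwartz_norm f C) simp_all
    finally show "(1 + x\<^sup>2) ^ n * jet n (\<lambda>x. a x * f x) x \<le> (C * real (Suc (n + k))) * schwartz_norm (n + k) f"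
      by (simp add: mult.assoc)
  qed
  then show "\<exists>q\<in>seminorms schwartz_space. \<exists>C. \<forall>f\<in>elems schwartz_space. p (\<lambda>x. a x * f x) \<le> C * q f"
    unfolding p by (auto simp: schwartz_space_def)
qed

interpretation OM: OM_module OM_space
proof
  fix a f :: "real \<Rightarrow> complex"
  show "(\<lambda>x. a x * f x) \<in> elems OM_space" if "a \<in> OM_fun" "f \<in> elems OM_space"
    using that by (simp add: OM_space_def OM_mult)
  show "bounded_in OM_space ((\<lambda>(a, f) x. a x * f x) ` (W \<times> B))"
    if "bounded_in OM_space W" "bounded_in OM_space B" for W B
    using that by (rule bounded_OM_mult_OM)
  fix p assume a: "a \<in> OM_fun" and "p \<in> seminorms OM_space"
  then obtain m v where p: "p = OM_norm m v" and v: "v \<in> schwartz_fun" by (auto simp: OM_space_def)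
  obtain k C where C: "0 \<le> C" "\<And>f x. smooth f \<Longrightarrow> jet m (\<lambda>x. a x * f x) x \<le> C * ((1 + x\<^sup>2) ^ k * jet m f x)"
    using OM_jet_mult[OF a] by metis
  \<comment> \<open>The polynomial growth of the multiplier is moved into the weight.\<close>
  let ?w = "\<lambda>x. of_real ((1 + x\<^sup>2) ^ k) * v x"
  have w: "?w \<in> schwartz_fun" by (rule schwartz_mult[OF weight_OM v])
  have w': "cmod (?w x) = (1 + x\<^sup>2) ^ k * cmod (v x)" for x
    by (simp only: norm_mult norm_of_real abs_of_pos[OF weight_pos])
  have "OM_norm m v (\<lambda>x. a x * f x) \<le> (C * real (Suc m)) * OM_norm m ?w f" if f: "f \<in> OM_fun" for f
  proof (rule OM_norm_le_jet)
    fix x :: real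
    have "cmod (v x) * jet m (\<lambda>x. a x * f x) x \<le> cmod (v x) * (C * ((1 + x\<^sup>2) ^ k * jet m f x))"
      using C(2)[OF OM_smooth[OF f]] by (intro mult_left_mono) simp_all
    also have "\<dots> = C * (cmod (?w x) * jet m f x)" unfolding w' by (simp add: mult_ac)
    also have "\<dots> \<le> C * (real (Suc m) * OM_norm m ?w f)"
      by (intro mult_left_mono jet_le_OM_norm f w C)
    finally show "cmod (v x) * jet m (\<lambda>x. a x * f x) x \<le> (C * real (Suc m)) * OM_norm m ?w f"
      by (simp add: mult.assoc)
  qed
  moreover have "OM_norm m ?w \<in> seminorms OM_space" using w by (auto simp: OM_space_def)
  ultimately show "\<exists>q\<in>seminorms OM_space. \<exists>C. \<forall>f\<in>elems OM_space. p (\<lambda>x. a x * f x) \<le> C * q f"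
    unfolding p by (intro bexI[of _ "OM_norm m ?w"] exI[of _ "C * real (Suc m)"]) (simp add: OM_space_def)
qed

section \<open>The equivalences\<close>

lemma schwartz_simps: "elems schwartz_space = schwartz_fun" "schwartz_norm n \<in> seminorms schwartz_space"
  by (simp_all add: schwartz_space_def)

lemma OM_simps: "elems OM_space = OM_fun" "v \<in> schwartz_fun \<Longrightarrow> OM_norm m v \<in> seminorms OM_space"
  by (auto simp: OM_space_def)

text \<open>The derivatives of \<open>a\<^sub>n\<close> are controlled by those of the products \<open>v a\<^sub>n\<close>
  through \<open>v a\<^sub>n\<^sup>(\<^sup>i\<^sup>+\<^sup>1\<^sup>) = (v a\<^sub>n\<^sup>(\<^sup>i\<^sup>))' - v' a\<^sub>n\<^sup>(\<^sup>i\<^sup>)\<close>.\<close>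
lemma bounded_OM_if_products_bounded:
  assumes a: "\<And>n. a n \<in> OM_fun"
    and bd: "\<And>v j. v \<in> schwartz_fun \<Longrightarrow> \<exists>C. \<forall>n x. cmod (nth_deriv j (\<lambda>x. v x * a n x) x) \<le> C"
  shows "bounded_in OM_space (range a)"
proof -
  have sm: "smooth (nth_deriv i (a n))" for i n by (intro smooth_nth_deriv OM_smooth a)
  \<comment> \<open>Raising \<open>i\<close> by one uses the claim for \<open>Suc j\<close> and for
    the weight \<open>vd v\<close>, so it has to be proved for all \<open>j\<close> and
    \<open>v\<close> together.\<close>
  have all: "\<exists>C. \<forall>n x. cmod (nth_deriv j (\<lambda>x. v x * nth_deriv i (a n) x) x) \<le> C"
    if "v \<in> schwartz_fun" for v i j
    using that
  proof (induction i arbitrary: v j)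
    case 0
    then show ?case using bd by simp
  next
    case (Suc i)
    obtain C where C: "\<And>n x. cmod (nth_deriv (Suc j) (\<lambda>x. v x * nth_deriv i (a n) x) x) \<le> C"
      using Suc by blast
    obtain D where D: "\<And>n x. cmod (nth_deriv j (\<lambda>x. vd v x * nth_deriv i (a n) x) x) \<le> D"
      using Suc.IH[OF schwartz_vd[OF Suc.prems]] by blast
    have "cmod (nth_deriv j (\<lambda>x. v x * nth_deriv (Suc i) (a n) x) x) \<le> C + D" for n x
    proof -
      let ?F = "\<lambda>x. v x * nth_deriv i (a n) x" and ?G = "\<lambda>x. vd v x * nth_deriv i (a n) x"
      have s: "smooth ?F" "smooth ?G" "smooth (\<lambda>x. (-1) * ?G x)"
        by (intro smooth_cmult smooth_mult sm smooth_vd schwartz_smooth Suc.prems)+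
      have "vd ?F = (\<lambda>x. vd v x * nth_deriv i (a n) x + v x * nth_deriv (Suc i) (a n) x)"
        unfolding nth_deriv_Suc by (rule vd_mult[OF schwartz_smooth[OF Suc.prems] sm])
      then have "(\<lambda>x. v x * nth_deriv (Suc i) (a n) x) = (\<lambda>x. vd ?F x + (-1) * ?G x)"
        by (simp add: fun_eq_iff)
      then have "nth_deriv j (\<lambda>x. v x * nth_deriv (Suc i) (a n) x) x
        = nth_deriv (Suc j) ?F x + (-1) * nth_deriv j ?G x"
        using nth_deriv_add[OF smooth_vd[OF s(1)] s(3), of j] nth_deriv_cmult[OF s(2), of j "-1"]
        by (simp only: nth_deriv_Suc')
      then have "cmod (nth_deriv j (\<lambda>x. v x * nth_deriv (Suc i) (a n) x) x)
        \<le> cmod (nth_deriv (Suc j) ?F x) + cmod ((-1) * nth_deriv j ?G x)"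
        by (simp only: norm_triangle_ineq)
      also have "\<dots> \<le> C + D" using C[of n x] D[of n x] by simp
      finally show ?thesis .
    qed
    then show ?case by blast
  qed
  show ?thesis
    unfolding bounded_in_OM
  proof (intro conjI allI ballI)
    show "range a \<subseteq> OM_fun" using a by blast
    fix m v assume v: "v \<in> schwartz_fun"
    have "\<exists>C. \<forall>n x. cmod (v x) * cmod (nth_deriv i (a n) x) \<le> C" for i
      using all[OF v, of 0 i] by (simp add: norm_mult)
    then obtain C where C: "\<And>i n x. cmod (v x) * cmod (nth_deriv i (a n) x) \<le> C i" by metis
    have "cmod (v x) * jet m (a n) x \<le> (\<Sum>i\<le>m. C i)" for n x
      unfolding jet_def sum_distrib_left by (intro sum_mono C)
    then show "\<exists>C. \<forall>f\<in>range a. \<forall>x. cmod (v x) * jet m f x \<le> C" by blast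
  qed
qed

text \<open>For fixed \<open>v\<close> the products with \<open>a n\<close> are Schwartz functions,
  and evaluation of the derivative of order \<open>j\<close> at \<open>s\<close> is dominated by
  \<open>schwartz_norm j\<close> for every \<open>s\<close>; \<open>weakly_bounded\<close> then
  applies. Pointwise convergence comes from evaluating the product with a nonvanishing
  \<open>v\<close> and dividing.\<close>

lemma schwartz_weak_imp_bounded:
  assumes a: "\<And>n. a n \<in> OM_fun"
    and weak: "\<And>u f. u \<in> dual schwartz_space \<Longrightarrow> f \<in> schwartz_fun \<Longrightarrow> convergent (\<lambda>n. u (\<lambda>x. a n x * f x))"
  shows "bounded_in OM_space (range a)" "convergent (\<lambda>n. a n x)"
proof -
  have mem: "(\<lambda>x. a n x * v x) \<in> schwartz_fun" if "v \<in> schwartz_fun" for n v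
    by (rule schwartz_mult[OF a that])
  have bd: "cmod (nth_deriv j f s) \<le> schwartz_norm j f" if f: "f \<in> schwartz_fun" for f j s
  proof -
    have "1 * cmod (nth_deriv j f s) \<le> (1 + s\<^sup>2) ^ j * cmod (nth_deriv j f s)"
      by (intro mult_right_mono weight_ge_1) simp
    also have "\<dots> \<le> schwartz_norm j f" by (rule schwartz_norm_ge[OF f]) simp
    finally show ?thesis by simp
  qed
  show "bounded_in OM_space (range a)"
  proof (rule bounded_OM_if_products_bounded[OF a])
    fix v j assume v: "v \<in> schwartz_fun"
    have "\<exists>K. \<forall>n s. cmod (nth_deriv j (\<lambda>x. a n x * v x) s) \<le> K"
    proof (rule S.weakly_bounded[where \<phi> = "\<lambda>s f. nth_deriv j f s" and p = "schwartz_norm j"])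
      show "nth_deriv j (f + g) s = nth_deriv j f s + nth_deriv j g s"
        if "f \<in> elems schwartz_space" "g \<in> elems schwartz_space" for s f g
        using that by (simp add: schwartz_simps plus_fun_def nth_deriv_add schwartz_smooth)
      show "nth_deriv j (\<lambda>x. c * f x) s = c * nth_deriv j f s"
        if "f \<in> elems schwartz_space" for s c f
        using that by (simp add: schwartz_simps nth_deriv_cmult schwartz_smooth)
    qed (use bd mem[OF v] weak v in \<open>simp_all add: schwartz_simps\<close>)
    then show "\<exists>C. \<forall>n x. cmod (nth_deriv j (\<lambda>x. v x * a n x) x) \<le> C"
      by (simp add: mult.commute)
  qed
  obtain v where v: "v \<in> schwartz_fun" "\<And>x. v x \<noteq> 0" using nonvanishing_schwartz by blast
  have "(\<lambda>f. if f \<in> elems schwartz_space then f x else 0) \<in> dual schwartz_space"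
  proof (rule S.dualI[where p = "schwartz_norm 0" and C = 1])
    show "cmod (f x) \<le> 1 * schwartz_norm 0 f" if "f \<in> elems schwartz_space" for f
      using bd[of f 0 x] that by (simp add: schwartz_simps)
  qed (simp_all add: schwartz_simps)
  from weak[OF this v(1)] have "convergent (\<lambda>n. a n x * v x)"
    using mem[OF v(1)] by (simp add: schwartz_simps)
  then obtain l where "(\<lambda>n. a n x * v x) \<longlonglongrightarrow> l" by (auto simp: convergent_def)
  then have "(\<lambda>n. a n x * v x / v x) \<longlonglongrightarrow> l / v x" by (intro tendsto_intros v)
  then show "convergent (\<lambda>n. a n x)" using v(2)[of x] by (auto simp: convergent_def)
qed

text \<open>Here the weight goes into the functional: \<open>v s\<close> times the derivative of
  order \<open>i\<close> at \<open>s\<close> is dominated by \<open>OM_norm i v\<close> for every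
  \<open>s\<close>.\<close>

lemma OM_weak_imp_bounded:
  assumes a: "\<And>n. a n \<in> OM_fun" and weak: "\<And>u. u \<in> dual OM_space \<Longrightarrow> convergent (\<lambda>n. u (a n))"
  shows "bounded_in OM_space (range a)" "convergent (\<lambda>n. a n x)"
proof -
  show "bounded_in OM_space (range a)"
    unfolding bounded_in_OM
  proof (intro conjI allI ballI)
    show "range a \<subseteq> OM_fun" using a by blast
    fix m v assume v: "v \<in> schwartz_fun"
    have "\<exists>K. \<forall>n s. cmod (v s * nth_deriv i (a n) s) \<le> K" for i
    proof (rule OM.weakly_bounded[where \<phi> = "\<lambda>s f. v s * nth_deriv i f s" and p = "OM_norm i v"])
      show "v s * nth_deriv i (f + g) s = v s * nth_deriv i f s + v s * nth_deriv i g s"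
        if "f \<in> elems OM_space" "g \<in> elems OM_space" for s f g
        using that by (simp add: OM_simps plus_fun_def nth_deriv_add OM_smooth distrib_left)
      show "v s * nth_deriv i (\<lambda>x. c * f x) s = c * (v s * nth_deriv i f s)"
        if "f \<in> elems OM_space" for s c f
        using that by (simp add: OM_simps nth_deriv_cmult OM_smooth)
      show "cmod (v s * nth_deriv i f s) \<le> OM_norm i v f" if "f \<in> elems OM_space" for s f
        using OM_norm_ge[OF v, of f i i s] that by (simp add: OM_simps norm_mult)
    qed (use a weak OM_simps(2)[OF v] in \<open>simp_all add: OM_simps\<close>)
    then obtain C where C: "\<And>i n x. cmod (v x * nth_deriv i (a n) x) \<le> C i" by metis
    have "cmod (v x) * jet m (a n) x \<le> (\<Sum>i\<le>m. C i)" for n x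
      unfolding jet_def sum_distrib_left norm_mult[symmetric] by (intro sum_mono C)
    then show "\<exists>C. \<forall>f\<in>range a. \<forall>x. cmod (v x) * jet m f x \<le> C" by blast
  qed
  obtain v where v: "v \<in> schwartz_fun" "\<And>x. v x \<noteq> 0" using nonvanishing_schwartz by blast
  have "(\<lambda>f. if f \<in> elems OM_space then f x else 0) \<in> dual OM_space"
  proof (rule OM.dualI[where p = "OM_norm 0 v" and C = "1 / cmod (v x)"])
    show "cmod (f x) \<le> 1 / cmod (v x) * OM_norm 0 v f" if "f \<in> elems OM_space" for f
      using OM_norm_ge[OF v(1), of f 0 0 x] that v(2)[of x]
      by (simp add: OM_simps pos_le_divide_eq mult.commute)
  qed (use OM_simps(2)[OF v(1)] in \<open>simp_all add: OM_simps\<close>)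
  from weak[OF this] show "convergent (\<lambda>n. a n x)" using a by (simp add: OM_simps)
qed

lemma mean_power_Mackey:
  assumes B: "bounded_in OM_space (range (mean_power h))" and conv: "\<And>x. convergent (\<lambda>n. mean_power h n x)"
  obtains \<Lambda> c where "\<And>n. 1 \<le> \<Lambda> n" "filterlim \<Lambda> at_top sequentially"
    "bounded_in OM_space (range (\<lambda>n x. of_real (\<Lambda> n) * (mean_power h n x - c)))"
proof -
  obtain g where g: "\<And>x. (\<lambda>n. mean_power h n x) \<longlonglongrightarrow> g x"
    using conv unfolding convergent_def by metis
  have "g x \<in> {0, 1}" for x
    using cesaro_limit_0_or_1 g[of x] unfolding mean_power_def by blast
  then have "finite (range g)" by (intro finite_subset[of "range g" "{0, 1}"]) auto
  from pointwise_limit_constant[OF B g this] obtain c where c: "\<And>x. g x = c" by blast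
  let ?u = "\<lambda>n x. mean_power h n x - c"
  have u_eq: "?u n = (\<lambda>x. mean_power h n x + (\<lambda>x. - c) x)" for n by simp
  have "bounded_in OM_space (range ?u)"
    unfolding bounded_in_OM
  proof (intro conjI allI ballI)
    show "range ?u \<subseteq> OM_fun"
      using B OM_add[OF _ const_OM, of _ "- c"] by (auto simp: bounded_in_OM)
    fix m v assume v: "v \<in> schwartz_fun"
    obtain C where C: "\<And>n x. cmod (v x) * jet m (mean_power h n) x \<le> C"
      using B v unfolding bounded_in_OM by (meson rangeI)
    obtain D where D: "\<And>x. cmod (v x) * jet m (\<lambda>x. - c) x \<le> D" using OM_norm_bdd[OF v const_OM] by metis
    have "cmod (v x) * jet m (?u n) x \<le> C + D" for n x
    proof -
      have "smooth (mean_power h n)" using B by (auto simp: bounded_in_OM intro: OM_smooth)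
      then have "jet m (?u n) x \<le> jet m (mean_power h n) x + jet m (\<lambda>x. - c) x"
        unfolding u_eq by (intro jet_add OM_smooth[OF const_OM])
      then have "cmod (v x) * jet m (?u n) x \<le> cmod (v x) * (jet m (mean_power h n) x + jet m (\<lambda>x. - c) x)"
        by (rule mult_left_mono) simp
      also have "\<dots> \<le> C + D" unfolding distrib_left by (intro add_mono C D)
      finally show ?thesis .
    qed
    then show "\<exists>C. \<forall>f\<in>range ?u. \<forall>x. cmod (v x) * jet m f x \<le> C" by blast
  qed
  moreover have "(\<lambda>n. ?u n x) \<longlonglongrightarrow> 0" for x using g[of x] c[of x] by (simp add: LIM_zero)
  ultimately show thesis by (rule OM_Mackey_convergence) (rule that)
qed

lemma limit_if_Mackey:
  assumes h: "h \<in> OM_fun" and \<Lambda>: "\<And>n. 1 \<le> \<Lambda> n" "filterlim \<Lambda> at_top sequentially"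
    and W: "bounded_in OM_space (range (\<lambda>n x. of_real (\<Lambda> n) * (mean_power h n x - c)))"
  shows "limitin (lcs_topology OM_space) (mean_power h) (\<lambda>x. c) sequentially"
proof (rule OM.limitinI)
  show "(\<lambda>x. c) \<in> elems OM_space" "mean_power h n \<in> elems OM_space" for n
    by (simp_all add: OM_simps const_OM mean_power_OM h)
  fix p and r :: real assume p: "p \<in> seminorms OM_space" and r: "0 < r"
  let ?u = "\<lambda>n. mean_power h n - (\<lambda>x. c)"
  have uO: "?u n \<in> elems OM_space" for n
    by (rule OM.diff) (simp_all add: OM_simps const_OM mean_power_OM h)
  obtain K where K: "\<And>n. p (\<lambda>x. of_real (\<Lambda> n) * (mean_power h n x - c)) \<le> K"
    using bounded_inD[OF W p] by (auto simp: bdd_above_def)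
  have K': "\<Lambda> n * p (?u n) \<le> K" for n
    using K[of n] OM.sem_scale[OF p uO, of "of_real (\<Lambda> n)" n] \<Lambda>(1)[of n] by simp
  have "eventually (\<lambda>n. (\<bar>K\<bar> + 1) / r \<le> \<Lambda> n) sequentially"
    using \<Lambda>(2) unfolding filterlim_at_top by blast
  then show "eventually (\<lambda>n. p (?u n) < r) sequentially"
  proof (rule eventually_mono)
    fix n assume "(\<bar>K\<bar> + 1) / r \<le> \<Lambda> n"
    then have "\<bar>K\<bar> + 1 \<le> \<Lambda> n * r" using r by (simp add: pos_divide_le_eq)
    then have "\<Lambda> n * p (?u n) < \<Lambda> n * r" using K'[of n] by linarith
    then show "p (?u n) < r" using \<Lambda>(1)[of n] by simp
  qed
qed

theorem theorem4p2:
  fixes h :: "real \<Rightarrow> complex"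
  assumes "h \<in> elems OM_space"
  defines "item3 \<equiv> \<exists>g. limitin (lcs_topology OM_space) (mean_power h) g sequentially"
  shows
    "(mean_ergodic schwartz_space (mult_op schwartz_space h) \<longleftrightarrow> item3) \<and>
     (uniformly_mean_ergodic schwartz_space (mult_op schwartz_space h) \<longleftrightarrow> item3) \<and>
     (mean_ergodic (strong_dual schwartz_space)
        (transpose_op schwartz_space (mult_op schwartz_space h)) \<longleftrightarrow> item3) \<and>
     (uniformly_mean_ergodic (strong_dual schwartz_space)
        (transpose_op schwartz_space (mult_op schwartz_space h)) \<longleftrightarrow> item3) \<and>
     (mean_ergodic OM_space (mult_op OM_space h) \<longleftrightarrow> item3) \<and>
     (uniformly_mean_ergodic OM_space (mult_op OM_space h) \<longleftrightarrow> item3) \<and>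
     (mean_ergodic (strong_dual OM_space)
        (transpose_op OM_space (mult_op OM_space h)) \<longleftrightarrow> item3) \<and>
     (uniformly_mean_ergodic (strong_dual OM_space)
        (transpose_op OM_space (mult_op OM_space h)) \<longleftrightarrow> item3)"
proof -
  have h: "h \<in> OM_fun" using assms(1) by (simp add: OM_simps)
  note aO = mean_power_OM[OF h]
  \<comment> \<open>The hub of the nine properties: testing with functionals leads from each of them
    to \<open>tame\<close>, and the rate obtained from \<open>tame\<close> leads back to all of
    them.\<close>
  define tame where "tame \<longleftrightarrow> bounded_in OM_space (range (mean_power h)) \<and> (\<forall>x. convergent (\<lambda>n. mean_power h n x))"
  have weak_OM: "tame" if "\<And>u. u \<in> dual OM_space \<Longrightarrow> convergent (\<lambda>n. u (mean_power h n))"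
    using OM_weak_imp_bounded[of "mean_power h", OF aO that] unfolding tame_def by blast
  have from_S: "tame"
    if erg: "mean_ergodic schwartz_space (S.M h) \<or> uniformly_mean_ergodic schwartz_space (S.M h) \<or>
      mean_ergodic (strong_dual schwartz_space) (S.M' h) \<or> uniformly_mean_ergodic (strong_dual schwartz_space) (S.M' h)"
  proof -
    have "convergent (\<lambda>n. u (\<lambda>x. mean_power h n x * f x))"
      if "u \<in> dual schwartz_space" "f \<in> schwartz_fun" for u f
      using S.weakly_convergent_if_ergodic[OF h erg that(1)] that(2) by (simp add: schwartz_simps)
    from schwartz_weak_imp_bounded[of "mean_power h", OF aO this] show ?thesis unfolding tame_def by blast
  qed
  have from_OM: "tame"
    if erg: "mean_ergodic OM_space (OM.M h) \<or> uniformly_mean_ergodic OM_space (OM.M h) \<or>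
      mean_ergodic (strong_dual OM_space) (OM.M' h) \<or> uniformly_mean_ergodic (strong_dual OM_space) (OM.M' h)"
  proof (rule weak_OM)
    fix u assume "u \<in> dual OM_space"
    \<comment> \<open>The constant 1 is a multiplier, and its product with a mean is the mean
      itself.\<close>
    from OM.weakly_convergent_if_ergodic[OF h erg this, of "\<lambda>x. 1"]
    show "convergent (\<lambda>n. u (mean_power h n))" by (simp add: OM_simps const_OM)
  qed
  have from_3: "tame" if item3
  proof (rule weak_OM)
    fix u assume "u \<in> dual OM_space"
    with that show "convergent (\<lambda>n. u (mean_power h n))"
      unfolding item3_def using OM.dual_convergent by blast
  qed
  have to_all: "mean_ergodic schwartz_space (S.M h) \<and> uniformly_mean_ergodic schwartz_space (S.M h) \<and>
      mean_ergodic (strong_dual schwartz_space) (S.M' h) \<and> uniformly_mean_ergodic (strong_dual schwartz_space) (S.M' h) \<and>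
      mean_ergodic OM_space (OM.M h) \<and> uniformly_mean_ergodic OM_space (OM.M h) \<and>
      mean_ergodic (strong_dual OM_space) (OM.M' h) \<and> uniformly_mean_ergodic (strong_dual OM_space) (OM.M' h) \<and> item3"
    if t: tame
  proof -
    have B: "bounded_in OM_space (range (mean_power h))" and conv: "\<And>x. convergent (\<lambda>n. mean_power h n x)"
      using t by (simp_all add: tame_def)
    obtain \<Lambda> c where *: "\<And>n. 1 \<le> \<Lambda> n" "filterlim \<Lambda> at_top sequentially"
      "bounded_in OM_space (range (\<lambda>n x. of_real (\<Lambda> n) * (mean_power h n x - c)))"
      by (rule mean_power_Mackey[OF B conv]) (rule that)
    show ?thesis
      using S.ergodic_if_Mackey[OF h *] OM.ergodic_if_Mackey[OF h *] limit_if_Mackey[OF h *]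
      unfolding item3_def by blast
  qed
  from from_S from_OM from_3 to_all show ?thesis by blast
qed

end
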